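(* Let $(X,\mu)$ be a non-atomic probability space and let $T:X\to X$ be an ergodic automorphism of $(X,\mu)$ (an invertible measure-preserving map). Let $L^\infty(X,\mathrm{SL}(2,\mathbb{R}))$ be the space of measurable essentially bounded maps $A:X\to\mathrm{SL}(2,\mathbb{R})$ with the metric $\|A-B\|_\infty=\operatorname{ess\,sup}_x\|A(x)-B(x)\|$. Then there is a residual set $\mathcal{R}\subset L^\infty(X,\mathrm{SL}(2,\mathbb{R}))$ such that every $A\in\mathcal{R}$ either is uniformly hyperbolic or satisfies $\mathrm{LE}(A)=0$.
   Context: For a cocycle $A$ write $A^n(x)=A(T^{n-1}x)\cdots A(x)$ for $n>0$, $A^0=I$, and $A^n(x)=[A(T^nx)]^{-1}\cdots[A(T^{-1}x)]^{-1}$ for $n<0$. The limit $\lambda^+(x)=\lim_{n\to\infty}\frac1n\log\|A^n(x)\|\ge0$ exists $\mu$-a.e., and $\mathrm{LE}(A)=\int_X\lambda^+\,d\mu$. The cocycle $A$ (over $T$) is uniformly hyperbolic if for $\mu$-a.e. $x$ there is a splitting $\mathbb{R}^2=E^u(x)\oplus E^s(x)$, measurable in $x$, with $A(x)E^u(x)=E^u(Tx)$, $A(x)E^s(x)=E^s(Tx)$ a.e., and constants $C>0$, $0<\tau<1$ such that $\|A^n(x)v^s\|\le C\tau^n\|v^s\|$ and $\|A^{-n}(x)v^u\|\le C\tau^n\|v^u\|$ for a.e. $x$, all $v^s\in E^s(x)$, $v^u\in E^u(x)$ and $n\ge0$. *)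

theory Defs
  imports "HOL-Probability.Probability"
begin

type_synonym mat2 = "real^2^2"

definition mnorm :: "mat2 \<Rightarrow> real" where
  "mnorm A = onorm (\<lambda>v. A *v v)"

definition nonatomic :: "'a measure \<Rightarrow> bool" where
  "nonatomic M \<longleftrightarrow> (\<forall>A\<in>sets M. measure M A > 0 \<longrightarrow>
     (\<exists>B\<in>sets M. B \<subseteq> A \<and> 0 < measure M B \<and> measure M B < measure M A))"

definition automorphism :: "'a measure \<Rightarrow> ('a \<Rightarrow> 'a) \<Rightarrow> bool" where
  "automorphism M T \<longleftrightarrow> T \<in> M \<rightarrow>\<^sub>M M \<and> bij_betw T (space M) (space M) \<and>
     inv_into (space M) T \<in> M \<rightarrow>\<^sub>M M \<and>
     (\<forall>A\<in>sets M. emeasure M (T -` A \<inter> space M) = emeasure M A)"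

definition ergodic :: "'a measure \<Rightarrow> ('a \<Rightarrow> 'a) \<Rightarrow> bool" where
  "ergodic M T \<longleftrightarrow> (\<forall>A\<in>sets M. T -` A \<inter> space M = A \<longrightarrow>
     measure M A = 0 \<or> measure M A = 1)"

definition Linf_SL2 :: "'a measure \<Rightarrow> ('a \<Rightarrow> mat2) set" where
  "Linf_SL2 M = {A. A \<in> borel_measurable M \<and> (\<forall>x\<in>space M. det (A x) = 1) \<and>
     (\<exists>C. AE x in M. mnorm (A x) \<le> C)}"

definition linf_dist :: "'a measure \<Rightarrow> ('a \<Rightarrow> mat2) \<Rightarrow> ('a \<Rightarrow> mat2) \<Rightarrow> real" where
  "linf_dist M A B = real_of_ereal (esssup M (\<lambda>x. ereal (mnorm (A x - B x))))"

definition open_in_Linf :: "'a measure \<Rightarrow> ('a \<Rightarrow> mat2) set \<Rightarrow> bool" where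
  "open_in_Linf M U \<longleftrightarrow> U \<subseteq> Linf_SL2 M \<and>
     (\<forall>A\<in>U. \<exists>e>0. \<forall>B\<in>Linf_SL2 M. linf_dist M A B < e \<longrightarrow> B \<in> U)"

definition dense_in_Linf :: "'a measure \<Rightarrow> ('a \<Rightarrow> mat2) set \<Rightarrow> bool" where
  "dense_in_Linf M U \<longleftrightarrow> U \<subseteq> Linf_SL2 M \<and>
     (\<forall>A\<in>Linf_SL2 M. \<forall>e>0. \<exists>B\<in>U. linf_dist M A B < e)"

definition residual_in_Linf :: "'a measure \<Rightarrow> ('a \<Rightarrow> mat2) set \<Rightarrow> bool" where
  "residual_in_Linf M R \<longleftrightarrow> R \<subseteq> Linf_SL2 M \<and>
     (\<exists>U :: nat \<Rightarrow> ('a \<Rightarrow> mat2) set. (\<forall>k. open_in_Linf M (U k) \<and> dense_in_Linf M (U k)) \<and>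
        (\<Inter>k. U k) \<subseteq> R)"

fun cocycle_fwd :: "('a \<Rightarrow> 'a) \<Rightarrow> ('a \<Rightarrow> mat2) \<Rightarrow> nat \<Rightarrow> 'a \<Rightarrow> mat2" where
  "cocycle_fwd T A 0 x = mat 1"
| "cocycle_fwd T A (Suc n) x = A ((T ^^ n) x) ** cocycle_fwd T A n x"

fun cocycle_bwd :: "('a \<Rightarrow> 'a) \<Rightarrow> ('a \<Rightarrow> mat2) \<Rightarrow> nat \<Rightarrow> 'a \<Rightarrow> mat2" where
  "cocycle_bwd Tinv A 0 x = mat 1"
| "cocycle_bwd Tinv A (Suc n) x = matrix_inv (A ((Tinv ^^ Suc n) x)) ** cocycle_bwd Tinv A n x"

definition lyap_top :: "('a \<Rightarrow> 'a) \<Rightarrow> ('a \<Rightarrow> mat2) \<Rightarrow> 'a \<Rightarrow> real" where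
  "lyap_top T A x = lim (\<lambda>n. ln (mnorm (cocycle_fwd T A n x)) / real n)"

definition LE :: "'a measure \<Rightarrow> ('a \<Rightarrow> 'a) \<Rightarrow> ('a \<Rightarrow> mat2) \<Rightarrow> real" where
  "LE M T A = integral\<^sup>L M (lyap_top T A)"

text \<open>Measurability of a closed-subspace-valued map (Effros): all distance functions measurable.\<close>
definition measurable_subspace_field :: "'a measure \<Rightarrow> ('a \<Rightarrow> (real^2) set) \<Rightarrow> bool" where
  "measurable_subspace_field M E \<longleftrightarrow> (\<forall>v. (\<lambda>x. infdist v (E x)) \<in> borel_measurable M)"

definition uniformly_hyperbolic :: "'a measure \<Rightarrow> ('a \<Rightarrow> 'a) \<Rightarrow> ('a \<Rightarrow> mat2) \<Rightarrow> bool" where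
  "uniformly_hyperbolic M T A \<longleftrightarrow>
    (\<exists>Eu Es :: 'a \<Rightarrow> (real^2) set. \<exists>C \<tau> :: real.
       measurable_subspace_field M Eu \<and> measurable_subspace_field M Es \<and>
       C > 0 \<and> 0 < \<tau> \<and> \<tau> < 1 \<and>
       (AE x in M. subspace (Eu x) \<and> subspace (Es x) \<and> Eu x \<inter> Es x = {0} \<and>
                   {u + s | u s. u \<in> Eu x \<and> s \<in> Es x} = UNIV) \<and>
       (AE x in M. (\<lambda>v. A x *v v) ` Eu x = Eu (T x) \<and> (\<lambda>v. A x *v v) ` Es x = Es (T x)) \<and>
       (AE x in M. \<forall>n. \<forall>v\<in>Es x.
           norm (cocycle_fwd T A n x *v v) \<le> C * \<tau> ^ n * norm v) \<and>
       (AE x in M. \<forall>n. \<forall>v\<in>Eu x.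
           norm (cocycle_bwd (inv_into (space M) T) A n x *v v) \<le> C * \<tau> ^ n * norm v))"

end

theory Submission
  imports Defs
begin

text \<open>
  Write \<open>\<Lambda>(A)\<close> for the infimum over \<open>n\<close> of the mean of \<open>ln \<bar>A\<^sup>n\<bar> / n\<close>. The sets \<open>{\<Lambda> < d}\<close> are
  open, so each of them together with its exterior is open and dense, and it suffices to show that
  \<open>A\<close> is uniformly hyperbolic whenever \<open>\<Lambda> \<ge> d > 0\<close> on a neighbourhood of \<open>A\<close>.

  Fix a size \<open>\<eta>\<close> of perturbations. Suppose first that, for almost every \<open>x\<close> and every \<open>m\<close>, there are
  directions \<open>u\<close>, \<open>v\<close> such that no \<open>\<eta>\<close>-perturbation of the first \<open>m\<close> matrices along the orbit of \<open>x\<close>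
  maps \<open>u\<close> to \<open>v\<close>. Testing this with shears and one rotation shows that the orbit of \<open>v\<close> contracts
  and that of \<open>u\<close> expands at a dom_rate depending only on \<open>\<eta>\<close>, and compactness yields the splitting.

  Otherwise, for some \<open>m\<close>, all directions can be aligned in \<open>m\<close> steps on a set of positive measure.
  Take in it a set \<open>Z\<close> with long return times and a tiny subset \<open>W\<close> of \<open>Z\<close>. At each visit to \<open>Z\<close> align
  the most expanded direction of the product accumulated since the last visit to \<open>W\<close> with the most
  contracted direction of the coming block. If \<open>s\<close> and \<open>p\<close> are the logarithms of the norms of
  the product and of the block, the new value of \<open>s\<close> is at most \<open>max s p\<close> up to a constant, so \<open>s\<close>
  grows like the maximum, and not the sum, of the blocks; hence the perturbation has small \<open>\<Lambda>\<close>.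
\<close>

section \<open>Area form and operator norm in the plane\<close>

text \<open>The obstacle is measurability. The perturbation at \<open>x\<close> must depend
  measurably on \<open>x\<close>, yet it is chosen in view of the perturbed product, hence of
  earlier perturbations on the same orbit. Visits to \<open>W\<close> cut this regress: the product
  restarts from the identity there, so for almost every point only finitely many past steps count.
  Each choice is a least index in a countable dense family of perturbations, which is why alignment
  is only asked for up to arbitrarily small error. The restarts are paid for by the smallness of
  \<open>W\<close>. The parameters are chosen in this order: \<open>Z\<close> so sparse that the
  constant lost at each visit is negligible; then a length \<open>R\<close> such that few points are
  \<open>R\<close> or more steps away from their last visit to \<open>Z\<close>; then
  \<open>W\<close> so small that one block of length \<open>R\<close> per visit to \<open>W\<close>
  costs little. The plane geometry rests on one fact: matrices of determinant one preserve the area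
  form, so contraction of one direction forces expansion of another.\<close>

definition area :: "real^2 \<Rightarrow> real^2 \<Rightarrow> real" where
  "area u v = u$1 * v$2 - u$2 * v$1"

definition rot :: "real^2 \<Rightarrow> real^2" where
  "rot v = vector [- v$2, v$1]"

lemma rot_nth [simp]: "rot v $ 1 = - v$2" "rot v $ 2 = v$1"
  by (simp_all add: rot_def)

lemma norm_sq_2: "(norm (v::real^2))\<^sup>2 = (v$1)\<^sup>2 + (v$2)\<^sup>2"
  by (simp add: norm_vec_def L2_set_def sum_2)

lemma norm_rot [simp]: "norm (rot v) = norm v"
proof -
  have "(norm (rot v))\<^sup>2 = (norm v)\<^sup>2" by (simp add: norm_sq_2)
  then show ?thesis by simp
qed

lemma inner_2: "(u::real^2) \<bullet> v = u$1 * v$1 + u$2 * v$2"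
  by (simp add: inner_vec_def sum_2)

lemma matvec_nth: "(A *v v) $ i = A$i$1 * v$1 + A$i$2 * (v::real^2)$2"
  by (simp add: matrix_vector_mult_def sum_2)

lemma vec2_eq_iff: "(u::real^2) = v \<longleftrightarrow> u$1 = v$1 \<and> u$2 = v$2"
  by (simp add: vec_eq_iff forall_2)

lemma area_mult: "area (A *v u) (A *v v) = det A * area u v"
  unfolding area_def matvec_nth det_2 by algebra

lemma area_self [simp]: "area u u = 0" by (simp add: area_def)
lemma area_commute: "area u v = - area v u" by (simp add: area_def)
lemma area_add_left: "area (u + w) v = area u v + area w v" by (simp add: area_def algebra_simps)
lemma area_diff_left: "area (u - w) v = area u v - area w v" by (simp add: area_def algebra_simps)
lemma area_diff_right: "area u (v - w) = area u v - area u w" by (simp add: area_def algebra_simps)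
lemma area_scale_left: "area (c *\<^sub>R u) v = c * area u v" by (simp add: area_def algebra_simps)
lemma area_scale_right: "area u (c *\<^sub>R v) = c * area u v" by (simp add: area_def algebra_simps)
lemma area_zero [simp]: "area 0 v = 0" "area v 0 = 0" by (simp_all add: area_def)

lemma area_rot: "area v (rot v) = (norm v)\<^sup>2"
  unfolding norm_sq_2 by (simp add: area_def power2_eq_square)

lemma area_inner_sq: "(area u v)\<^sup>2 + (u \<bullet> v)\<^sup>2 = (norm u)\<^sup>2 * (norm v)\<^sup>2"
  unfolding norm_sq_2 area_def inner_2 by algebra

lemma area_le: "\<bar>area u v\<bar> \<le> norm u * norm v"
proof -
  have "\<bar>area u v\<bar>\<^sup>2 \<le> (norm u * norm v)\<^sup>2"
    using area_inner_sq[of u v] by (simp add: power_mult_distrib) (smt (verit) zero_le_power2)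
  then show ?thesis by (rule power2_le_imp_le) simp
qed

lemma unit_decomp:
  assumes "norm z = 1"
  shows "v = (z \<bullet> v) *\<^sub>R z + area z v *\<^sub>R rot z"
proof -
  have z: "(z$1)\<^sup>2 + (z$2)\<^sup>2 = 1" using norm_sq_2[of z] assms by simp
  have "v$1 = (z$1 * v$1 + z$2 * v$2) * z$1 + (z$1 * v$2 - z$2 * v$1) * (- z$2)"
    using z by algebra
  moreover have "v$2 = (z$1 * v$1 + z$2 * v$2) * z$2 + (z$1 * v$2 - z$2 * v$1) * z$1"
    using z by algebra
  ultimately show ?thesis by (simp add: vec2_eq_iff inner_2 area_def)
qed

section \<open>Operator norm and determinant one\<close>

lemma blin_mat: "bounded_linear (\<lambda>v. (A::mat2) *v v)"
  by (rule matrix_vector_mul_bounded_linear)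

lemma norm_le_mnorm: "norm (A *v v) \<le> mnorm A * norm v"
  unfolding mnorm_def by (rule onorm[OF blin_mat])

lemma mnorm_nonneg [simp]: "0 \<le> mnorm A"
  unfolding mnorm_def by (rule onorm_pos_le[OF blin_mat])

lemma mnorm_leI: "(\<And>v. norm (A *v v) \<le> c * norm v) \<Longrightarrow> mnorm A \<le> c"
  unfolding mnorm_def by (rule onorm_le)

lemma mnorm_mult: "mnorm (A ** B) \<le> mnorm A * mnorm B"
  by (rule mnorm_leI)
     (metis (no_types, opaque_lifting) matrix_vector_mul_assoc mult.assoc mult_left_mono mnorm_nonneg norm_le_mnorm order_trans)

lemma mnorm_add: "mnorm (A + B) \<le> mnorm A + mnorm B"
proof (rule mnorm_leI)
  fix v show "norm ((A + B) *v v) \<le> (mnorm A + mnorm B) * norm v"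
    using norm_triangle_ineq[of "A *v v" "B *v v"] norm_le_mnorm[of A v] norm_le_mnorm[of B v]
    by (simp add: matrix_vector_mult_add_rdistrib algebra_simps)
qed

lemma mnorm_minus_commute: "mnorm (A - B) = mnorm (B - A)"
proof -
  have "norm ((A - B) *v v) = norm ((B - A) *v v)" for v
    by (simp add: matrix_vector_mult_diff_rdistrib norm_minus_commute)
  then show ?thesis unfolding mnorm_def onorm_def by simp
qed

lemma mnorm_one [simp]: "mnorm (mat 1) = 1"
proof -
  have "mnorm (mat 1) \<le> 1" by (rule mnorm_leI) simp
  moreover have "1 \<le> mnorm (mat 1)"
    using norm_le_mnorm[of "mat 1" "axis 1 1"] by simp
  ultimately show ?thesis by simp
qed

lemma mnorm_diff_abs: "\<bar>mnorm A - mnorm B\<bar> \<le> mnorm (A - B)"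
  using mnorm_add[of "A - B" B] mnorm_add[of "B - A" A] mnorm_minus_commute[of A B] by simp

text \<open>In other words, inversion does not increase the norm. The area spanned by
  \<open>y\<close> and \<open>rot y\<close> is preserved, and the image of \<open>rot y\<close> has
  length at most \<open>mnorm A * norm y\<close>, so the image of \<open>y\<close> cannot be too
  short.\<close>

lemma norm_le_mnorm_inverse:
  assumes "det A = 1"
  shows "norm y \<le> mnorm A * norm (A *v y)"
proof (cases "y = 0")
  case False
  have "(norm y)\<^sup>2 = area (A *v y) (A *v rot y)"
    by (simp add: area_mult assms area_rot)
  also have "\<dots> \<le> norm (A *v y) * norm (A *v rot y)"
    using area_le abs_le_D1 by blast
  also have "\<dots> \<le> norm (A *v y) * (mnorm A * norm y)"
    using norm_le_mnorm[of A "rot y"] by (simp add: mult_left_mono)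
  finally show ?thesis using False by (simp add: power2_eq_square algebra_simps)
qed simp

lemma mnorm_ge_1:
  assumes "det A = 1" shows "1 \<le> mnorm A"
proof -
  have "area (A *v axis 1 1) (A *v rot (axis 1 1)) = 1"
    by (simp add: area_mult assms area_rot)
  then have "1 \<le> norm (A *v axis 1 1) * norm (A *v rot (axis 1 1))"
    by (metis abs_of_nonneg area_le zero_le_one)
  also have "\<dots> \<le> mnorm A * mnorm A"
    using norm_le_mnorm[of A "axis 1 1"] norm_le_mnorm[of A "rot (axis 1 1)"]
    by (intro mult_mono) auto
  finally show ?thesis
    by (metis abs_le_square_iff abs_of_nonneg mnorm_nonneg mult_1 power2_eq_square zero_le_one)
qed

lemma matrix_inv_det_1:
  assumes "det (A::mat2) = 1"
  shows "A ** matrix_inv A = mat 1" "matrix_inv A ** A = mat 1" "det (matrix_inv A) = 1"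
proof -
  have "\<exists>A'. A ** A' = mat 1 \<and> A' ** A = mat 1"
    using assms invertible_det_nz[of A] by (simp add: invertible_def)
  from someI_ex[OF this] show *: "A ** matrix_inv A = mat 1" "matrix_inv A ** A = mat 1"
    unfolding matrix_inv_def by blast+
  have "det (A ** matrix_inv A) = 1" using * by simp
  then show "det (matrix_inv A) = 1" by (simp add: det_mul assms)
qed

text \<open>A substitute for the singular value decomposition. The image of \<open>g\<close> is the
  image of \<open>e\<close> turned by a right angle; preservation of area forces \<open>g\<close> to
  be long, so after normalisation its image is short. The factor 2 appears because \<open>e\<close>
  realises only half of the norm, which spares attaining a supremum.\<close>

lemma contracted_vector:
  assumes "det A = 1"
  obtains f where "norm f = 1" "norm (A *v f) \<le> 2 / mnorm A"
proof -
  have m1: "1 \<le> mnorm A" by (rule mnorm_ge_1[OF assms])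
  obtain e0 where e0: "norm (A *v e0) > (mnorm A / 2) * norm e0"
  proof (rule ccontr)
    assume "\<not> thesis"
    then have "\<And>v. norm (A *v v) \<le> mnorm A / 2 * norm v" using that by (meson not_le)
    then show False using mnorm_leI[of A "mnorm A / 2"] m1 by simp
  qed
  then have e0n: "e0 \<noteq> 0" by auto
  define e where "e = (1 / norm e0) *\<^sub>R e0"
  have ne: "norm e = 1" using e0n by (simp add: e_def)
  have Ae: "norm (A *v e) > mnorm A / 2"
    using e0 e0n by (simp add: e_def matrix_vector_mult_scaleR field_simps)
  define g where "g = matrix_inv A *v rot (A *v e)"
  have Ag: "A *v g = rot (A *v e)"
    by (simp add: g_def matrix_vector_mul_assoc matrix_inv_det_1[OF assms])
  have "(norm (A *v e))\<^sup>2 = area e g"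
    using area_mult[of A e g] assms by (simp add: Ag area_rot)
  also have "\<dots> \<le> norm g" using area_le[of e g] ne by simp
  finally have ng: "(norm (A *v e))\<^sup>2 \<le> norm g" .
  have pos: "norm (A *v e) > 0" using Ae m1 by linarith
  have gpos: "norm g > 0" using ng pos by (smt (verit) zero_less_power)
  have "norm (A *v ((1 / norm g) *\<^sub>R g)) = norm (A *v e) / norm g"
    using Ag by (simp add: matrix_vector_mult_scaleR)
  also have "\<dots> \<le> norm (A *v e) / (norm (A *v e))\<^sup>2"
    using ng pos gpos by (intro divide_left_mono mult_pos_pos) auto
  also have "\<dots> = 1 / norm (A *v e)" by (simp add: power2_eq_square)
  also have "\<dots> \<le> 1 / (mnorm A / 2)"
    using Ae m1 pos by (intro divide_left_mono mult_pos_pos) auto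
  finally have "norm (A *v ((1 / norm g) *\<^sub>R g)) \<le> 2 / mnorm A" by simp
  then show ?thesis using that[of "(1 / norm g) *\<^sub>R g"] gpos by simp
qed

text \<open>In the frame \<open>f\<close>, \<open>rot f\<close> the factor \<open>S\<close> has one
  column of length at most 2 and one of length up to \<open>mnorm S\<close>. The short one is
  expanded by \<open>P\<close> at most by \<open>mnorm P\<close>; the long one is turned close to
  the direction \<open>v\<close> that \<open>P\<close> contracts. Hence a maximum instead of a
  product. The constant 5 is 2 from the short column plus 3 from the long one.\<close>

lemma aligned_product_norm:
  assumes S: "det S = 1" and P: "det P = 1" and c: "c \<ge> 1"
    and Q: "\<And>q. q \<in> I \<Longrightarrow> mnorm (Q q) \<le> c"
    and al: "\<And>u v e. e > 0 \<Longrightarrow> \<exists>q\<in>I. \<bar>area (Q q *v u) v\<bar> < e"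
  shows "\<exists>q\<in>I. mnorm (P ** Q q ** S) \<le> 5 * c * max (mnorm S) (mnorm P)"
proof -
  obtain f where f: "norm f = 1" "norm (S *v f) \<le> 2 / mnorm S"
    using contracted_vector[OF S] .
  obtain v where v: "norm v = 1" "norm (P *v v) \<le> 2 / mnorm P"
    using contracted_vector[OF P] .
  have s1: "1 \<le> mnorm S" and p1: "1 \<le> mnorm P" using mnorm_ge_1 S P by auto
  define u where "u = S *v rot f"
  have nu: "norm u \<le> mnorm S" using norm_le_mnorm[of S "rot f"] f by (simp add: u_def)
  \<comment> \<open>The tolerance is the error that \<open>P\<close> expands to length at most
    1.\<close>
  obtain q where q: "q \<in> I" "\<bar>area (Q q *v u) v\<bar> < 1 / mnorm P"
    using al[of "1 / mnorm P" u v] p1 by auto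
  define y where "y = Q q *v u"
  have ny: "norm y \<le> c * mnorm S"
  proof -
    have "norm y \<le> mnorm (Q q) * norm u" unfolding y_def by (rule norm_le_mnorm)
    also have "\<dots> \<le> c * mnorm S" using Q[OF q(1)] nu c by (intro mult_mono) auto
    finally show ?thesis .
  qed
  have yd: "y = (v \<bullet> y) *\<^sub>R v + area v y *\<^sub>R rot v" using unit_decomp[OF v(1)] .
  have a: "\<bar>v \<bullet> y\<bar> \<le> norm y" using Cauchy_Schwarz_ineq2[of v y] v by simp
  have b: "\<bar>area v y\<bar> \<le> 1 / mnorm P" using q(2) area_commute[of v y] by (simp add: y_def)
  have "norm (P *v y) = norm ((v \<bullet> y) *\<^sub>R (P *v v) + area v y *\<^sub>R (P *v rot v))"
    by (metis yd matrix_vector_mult_scaleR matrix_vector_right_distrib)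
  also have "\<dots> \<le> \<bar>v \<bullet> y\<bar> * norm (P *v v) + \<bar>area v y\<bar> * norm (P *v rot v)"
    by (metis norm_scaleR norm_triangle_ineq)
  also have "\<dots> \<le> (c * mnorm S) * 2 + (1 / mnorm P) * mnorm P"
  proof (intro add_mono mult_mono)
    show "norm (P *v v) \<le> 2" using v(2) p1 frac_le[of 2 2 1 "mnorm P"] by simp
    show "norm (P *v rot v) \<le> mnorm P" using norm_le_mnorm[of P "rot v"] v by simp
  qed (use a b ny s1 p1 c in auto)
  also have "\<dots> \<le> 3 * c * mnorm S"
    using p1 s1 c mult_mono[of 1 c 1 "mnorm S"] by simp
  finally have y3: "norm (P *v y) \<le> 3 * c * mnorm S" .
  have f2: "norm (P *v (Q q *v (S *v f))) \<le> 2 * c * mnorm P"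
  proof -
    have "norm (P *v (Q q *v (S *v f))) \<le> mnorm P * (mnorm (Q q) * norm (S *v f))"
      by (meson mnorm_nonneg mult_left_mono norm_le_mnorm order_trans)
    also have "\<dots> \<le> mnorm P * (c * 2)"
    proof (intro mult_left_mono mult_mono)
      show "norm (S *v f) \<le> 2" using f(2) s1 frac_le[of 2 2 1 "mnorm S"] by simp
    qed (use Q[OF q(1)] c in auto)
    finally show ?thesis by (simp add: algebra_simps)
  qed
  have "mnorm (P ** Q q ** S) \<le> 5 * c * max (mnorm S) (mnorm P)"
  proof (rule mnorm_leI)
    fix x
    have xd: "x = (f \<bullet> x) *\<^sub>R f + area f x *\<^sub>R rot f" using unit_decomp[OF f(1)] .
    have "(P ** Q q ** S) *v x = P *v (Q q *v (S *v x))"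
      by (simp add: matrix_vector_mul_assoc matrix_mul_assoc)
    also have "\<dots> = (f \<bullet> x) *\<^sub>R (P *v (Q q *v (S *v f))) + area f x *\<^sub>R (P *v y)"
      by (subst xd) (simp add: y_def u_def matrix_vector_mult_scaleR matrix_vector_right_distrib)
    finally have "norm ((P ** Q q ** S) *v x)
        \<le> \<bar>f \<bullet> x\<bar> * norm (P *v (Q q *v (S *v f))) + \<bar>area f x\<bar> * norm (P *v y)"
      by (metis norm_scaleR norm_triangle_ineq)
    also have "\<dots> \<le> norm x * (2 * c * mnorm P) + norm x * (3 * c * mnorm S)"
      using Cauchy_Schwarz_ineq2[of f x] area_le[of f x] f f2 y3
      by (intro add_mono mult_mono) auto
    also have "\<dots> \<le> norm x * (2 * c * max (mnorm S) (mnorm P)) + norm x * (3 * c * max (mnorm S) (mnorm P))"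
      using c by (intro add_mono mult_left_mono) auto
    finally show "norm ((P ** Q q ** S) *v x) \<le> 5 * c * max (mnorm S) (mnorm P) * norm x"
      by (simp add: algebra_simps)
  qed
  then show ?thesis using q(1) by blast
qed

section \<open>Rotations and shears near the identity\<close>

definition near_id :: "real \<Rightarrow> mat2 set" where
  "near_id \<eta> = {P. det P = 1 \<and> mnorm (P - mat 1) \<le> \<eta>}"

lemma mat_2_nth: "(mat 1 :: mat2)$1$1 = 1" "(mat 1 :: mat2)$1$2 = 0" "(mat 1 :: mat2)$2$1 = 0" "(mat 1 :: mat2)$2$2 = 1"
  by (simp_all add: mat_def)

lemma id_near_id: "\<eta> \<ge> 0 \<Longrightarrow> mat 1 \<in> near_id \<eta>"
proof -
  have "mnorm (0::mat2) \<le> 0" by (rule mnorm_leI) simp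
  then show "\<eta> \<ge> 0 \<Longrightarrow> mat 1 \<in> near_id \<eta>" by (simp add: near_id_def)
qed

lemma near_id_mnorm: "P \<in> near_id \<eta> \<Longrightarrow> mnorm P \<le> 1 + \<eta>"
  using mnorm_diff_abs[of P "mat 1"] by (auto simp: near_id_def)

text \<open>Lines are aligned, not vectors: the sign \<open>\<sigma>\<close> selects the nearer of
  \<open>z\<close> and \<open>- z\<close> and keeps the cosine nonnegative. Then
  \<open>1 - c\<close> is at most \<open>s^2\<close>, hence at most \<open>\<bar>s\<bar>\<close>,
  and the bound \<open>\<eta> / 2\<close> on the sine leaves the rotation within
  \<open>\<eta>\<close> of the identity.\<close>

lemma near_id_rotation:
  assumes \<eta>: "\<eta> \<ge> 0" and w: "w \<noteq> 0" and z: "z \<noteq> 0"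
    and small: "\<bar>area w z\<bar> \<le> \<eta> / 2 * (norm w * norm z)"
  obtains P where "P \<in> near_id \<eta>" "area (P *v w) z = 0"
proof -
  define \<sigma> :: real where "\<sigma> = (if w \<bullet> z \<ge> 0 then 1 else -1)"
  define c where "c = \<sigma> * (w \<bullet> z) / (norm w * norm z)"
  define s where "s = \<sigma> * area w z / (norm w * norm z)"
  have nz: "norm w * norm z > 0" using w z by simp
  have c0: "c \<ge> 0" using nz by (simp add: c_def \<sigma>_def)
  have s2: "\<sigma> * \<sigma> = 1" by (simp add: \<sigma>_def)
  have cs: "c\<^sup>2 + s\<^sup>2 = 1"
  proof -
    have "c\<^sup>2 + s\<^sup>2 = ((area w z)\<^sup>2 + (w \<bullet> z)\<^sup>2) / (norm w * norm z)\<^sup>2"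
      using s2 by (simp add: c_def s_def power_divide power_mult_distrib power2_eq_square[of \<sigma>] add_divide_distrib)
    also have "\<dots> = 1" unfolding area_inner_sq using nz w z by (simp add: power_mult_distrib)
    finally show ?thesis .
  qed
  have sa: "\<bar>s\<bar> \<le> \<eta> / 2"
  proof -
    have "\<bar>s\<bar> = \<bar>area w z\<bar> / (norm w * norm z)"
      by (simp add: s_def \<sigma>_def)
    then show ?thesis using small by (simp only: pos_divide_le_eq[OF nz])
  qed
  have "c\<^sup>2 \<le> 1" "s\<^sup>2 \<le> 1" using cs zero_le_power2[of c] zero_le_power2[of s] by linarith+
  then have c1: "c \<le> 1" and s1: "\<bar>s\<bar> \<le> 1" by (simp_all add: abs_square_le_1)
  have c2: "1 - c \<le> \<bar>s\<bar>"
  proof -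
    have "1 - c \<le> (1 - c) * (1 + c)" using c0 c1 by (simp add: mult_le_cancel_left1)
    also have "\<dots> = s\<^sup>2" using cs by (simp add: algebra_simps power2_eq_square)
    also have "\<dots> \<le> \<bar>s\<bar>" using s1 by (metis abs_ge_zero mult_left_le power2_abs power2_eq_square)
    finally show ?thesis .
  qed
  define P :: mat2 where "P = vector [vector [c, - s], vector [s, c]]"
  have Pn: "P$1$1 = c" "P$1$2 = - s" "P$2$1 = s" "P$2$2 = c" by (simp_all add: P_def)
  have d: "det P = 1" using cs by (simp add: det_2 Pn power2_eq_square)
  have "mnorm (P - mat 1) \<le> \<eta>"
  proof (rule mnorm_leI)
    fix v
    have "(P - mat 1) *v v = (c - 1) *\<^sub>R v + s *\<^sub>R rot v"
      by (simp add: vec2_eq_iff matvec_nth Pn mat_2_nth algebra_simps)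
    then have "norm ((P - mat 1) *v v) \<le> \<bar>c - 1\<bar> * norm v + \<bar>s\<bar> * norm v"
      by (metis norm_rot norm_scaleR norm_triangle_ineq)
    also have "\<dots> = (\<bar>c - 1\<bar> + \<bar>s\<bar>) * norm v" by (simp add: algebra_simps)
    also have "\<dots> \<le> \<eta> * norm v" using c1 c2 sa by (intro mult_right_mono) auto
    finally show "norm ((P - mat 1) *v v) \<le> \<eta> * norm v" .
  qed
  moreover have "area (P *v w) z = 0"
  proof -
    have "area (P *v w) z = c * area w z - s * (w \<bullet> z)"
      by (simp add: area_def matvec_nth Pn inner_2 algebra_simps)
    also have "\<dots> = 0" by (simp add: c_def s_def)
    finally show ?thesis .
  qed
  ultimately show ?thesis using that d by (auto simp: near_id_def)
qed

text \<open>The shear fixes \<open>z\<close> and pushes other vectors along \<open>z\<close>. A unit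
  vector is displaced by at most \<open>\<eta>\<close>, with equality when it is orthogonal to
  \<open>z\<close>, so the shear is as strong as \<open>near_id \<eta>\<close> permits.\<close>

lemma near_id_shear:
  assumes \<eta>: "\<eta> \<ge> 0" and z: "z \<noteq> 0"
  obtains P where "P \<in> near_id \<eta>" "\<And>w. P *v w = w + (\<eta> * area w z / (norm z)\<^sup>2) *\<^sub>R z"
proof -
  define k where "k = \<eta> / (norm z)\<^sup>2"
  define P :: mat2 where "P = vector [vector [1 + k * z$2 * z$1, - k * z$1 * z$1], vector [k * z$2 * z$2, 1 - k * z$1 * z$2]]"
  have Pn: "P$1$1 = 1 + k * z$2 * z$1" "P$1$2 = - k * z$1 * z$1" "P$2$1 = k * z$2 * z$2" "P$2$2 = 1 - k * z$1 * z$2"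
    by (simp_all add: P_def)
  have d: "det P = 1" by (simp add: det_2 Pn algebra_simps)
  have eq: "P *v w = w + (\<eta> * area w z / (norm z)\<^sup>2) *\<^sub>R z" for w
  proof -
    have "P *v w = w + (k * area w z) *\<^sub>R z"
      by (simp add: vec2_eq_iff matvec_nth Pn area_def algebra_simps)
    then show ?thesis by (simp add: k_def)
  qed
  have "mnorm (P - mat 1) \<le> \<eta>"
  proof (rule mnorm_leI)
    fix v
    have "(P - mat 1) *v v = (\<eta> * area v z / (norm z)\<^sup>2) *\<^sub>R z"
      using eq[of v] by (simp add: matrix_vector_mult_diff_rdistrib)
    then have "norm ((P - mat 1) *v v) = \<eta> * \<bar>area v z\<bar> / norm z"
      using \<eta> z by (simp add: abs_mult power2_eq_square)
    also have "\<dots> \<le> \<eta> * (norm v * norm z) / norm z"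
      using area_le[of v z] \<eta> by (intro divide_right_mono mult_left_mono) auto
    finally show "norm ((P - mat 1) *v v) \<le> \<eta> * norm v" using z by simp
  qed
  then show ?thesis using that d eq by (auto simp: near_id_def)
qed

section \<open>Domination from the absence of alignment\<close>

fun pert :: "('a \<Rightarrow> 'a) \<Rightarrow> ('a \<Rightarrow> mat2) \<Rightarrow> (nat \<Rightarrow> mat2) \<Rightarrow> nat \<Rightarrow> 'a \<Rightarrow> mat2" where
  "pert T A P 0 x = mat 1"
| "pert T A P (Suc n) x = A ((T ^^ n) x) ** P n ** pert T A P n x"

lemma pert_id: "pert T A (\<lambda>_. mat 1) n x = cocycle_fwd T A n x"
  by (induction n) auto

lemma pert_cong: "(\<And>i. i < n \<Longrightarrow> P i = P' i) \<Longrightarrow> pert T A P n x = pert T A P' n x"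
  by (induction n) auto

lemma det_cocycle: "(\<And>i. det (A ((T ^^ i) x)) = 1) \<Longrightarrow> det (cocycle_fwd T A n x) = 1"
  by (induction n) (auto simp: det_mul)

lemma cocycle_add: "cocycle_fwd T A (n + k) x = cocycle_fwd T A n ((T ^^ k) x) ** cocycle_fwd T A k x"
  by (induction n) (auto simp: matrix_mul_assoc funpow_add)

text \<open>The hypothesis says that the partial sum \<open>\<sigma> k\<close> of
  \<open>1 / b\<close> is at most \<open>L\<close> times its next increment, so these sums grow by
  the factor \<open>(L + 1) / L\<close> per step. Since \<open>1 / b i\<close> is a term of
  \<open>\<sigma> (Suc i)\<close> and \<open>\<sigma> k * b k \<le> L\<close>, growth of the sums
  becomes decay of \<open>b\<close>.\<close>

lemma geometric_decay:
  fixes b :: "nat \<Rightarrow> real" and L :: real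
  assumes L: "L > 0" and b: "\<And>i. b i > 0"
    and h: "\<And>k. k < m \<Longrightarrow> (\<Sum>i<k. 1 / b i) * b k \<le> L"
    and ik: "i \<le> k" "k < m"
  shows "b k \<le> (L + 1) * (L / (L + 1)) ^ (k - i) * b i"
proof -
  define \<theta> where "\<theta> = L / (L + 1)"
  define \<sigma> where "\<sigma> k = (\<Sum>i<k. 1 / b i)" for k
  have \<theta>: "\<theta> > 0" using L by (simp add: \<theta>_def)
  have \<sigma>0: "\<sigma> k \<ge> 0" for k unfolding \<sigma>_def by (intro sum_nonneg) (simp add: b less_imp_le)
  have step: "\<sigma> k \<le> \<theta> * \<sigma> (Suc k)" if "k < m" for k
  proof -
    have "\<sigma> k \<le> L * (1 / b k)" using h[OF that] b[of k] by (simp add: \<sigma>_def field_simps)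
    then have "\<sigma> k * (L + 1) \<le> L * \<sigma> (Suc k)" by (simp add: \<sigma>_def algebra_simps)
    then show ?thesis using L by (simp add: \<theta>_def field_simps)
  qed
  show ?thesis
  proof (cases "i = k")
    case True then show ?thesis using L b[of k] by (simp add: mult_le_cancel_right1)
  next
    case False
    then have ik': "Suc i \<le> k" using ik by simp
    have "1 / b i \<le> \<theta> ^ (k - Suc i) * \<sigma> k"
      using ik' ik(2)
    proof (induction k rule: dec_induct)
      case base then show ?case using \<sigma>0[of i] by (simp add: \<sigma>_def)
    next
      case (step n)
      have "1 / b i \<le> \<theta> ^ (n - Suc i) * \<sigma> n" using step by simp
      also have "\<dots> \<le> \<theta> ^ (n - Suc i) * (\<theta> * \<sigma> (Suc n))"
        using \<open>\<And>k. k < m \<Longrightarrow> \<sigma> k \<le> \<theta> * \<sigma> (Suc k)\<close>[of n] step.prems \<theta> by (intro mult_left_mono) auto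
      also have "\<dots> = \<theta> ^ (Suc n - Suc i) * \<sigma> (Suc n)" 
      proof -
        have "Suc n - Suc i = Suc (n - Suc i)" using step.hyps by simp
        then show ?thesis by (simp add: mult.assoc mult.left_commute)
      qed
      finally show ?case .
    qed
    then have "1 / b i * b k \<le> \<theta> ^ (k - Suc i) * \<sigma> k * b k" using b[of k] by (intro mult_right_mono) auto
    also have "\<dots> \<le> \<theta> ^ (k - Suc i) * L"
      using h[OF ik(2)] \<theta> by (simp add: \<sigma>_def mult.assoc mult_left_mono)
    \<comment> \<open>\<open>L = \<theta> * (L + 1)\<close> recovers the power lost by starting the
      induction at \<open>Suc i\<close>.\<close>
    also have "\<dots> = \<theta> ^ (k - Suc i) * \<theta> * (L + 1)" using L by (simp add: \<theta>_def)
    also have "\<theta> ^ (k - Suc i) * \<theta> = \<theta> ^ (k - i)"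
      using ik' by (metis Suc_diff_Suc Suc_le_lessD power_Suc2)
    finally have "b k \<le> \<theta> ^ (k - i) * (L + 1) * b i" using b[of i] by (simp add: field_simps)
    then show ?thesis by (simp add: \<theta>_def mult.commute)
  qed
qed

text \<open>The square root of \<open>L / (L + 1)\<close> with \<open>L = 4 / \<eta>^2\<close>; the
  root is there because \<open>geometric_decay\<close> is applied to squared norms.\<close>

definition dom_rate :: "real \<Rightarrow> real" where
  "dom_rate \<eta> = sqrt ((4 / \<eta>\<^sup>2) / (4 / \<eta>\<^sup>2 + 1))"

text \<open>\<open>sqrt (L + 1)\<close> is the constant for the contracted orbit and
  \<open>2 / \<eta>\<close> times it the one for the expanded orbit; their sum serves both.\<close>

definition dom_const :: "real \<Rightarrow> real" where
  "dom_const \<eta> = (1 + 2 / \<eta>) * sqrt (4 / \<eta>\<^sup>2 + 1)"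

lemma dom_rate_bounds: "\<eta> > 0 \<Longrightarrow> 0 < dom_rate \<eta> \<and> dom_rate \<eta> < 1"
  unfolding dom_rate_def by (simp add: field_simps add_pos_pos)

lemma dom_const_pos: "\<eta> > 0 \<Longrightarrow> dom_const \<eta> > 0"
  unfolding dom_const_def by (intro mult_pos_pos) (auto simp: add_pos_pos)

text \<open>Shears fixing the backward orbit of \<open>v\<close> accumulate a displacement of the orbit of \<open>u\<close>; at
  every time the displaced vector must stay at a definite angle from the orbit of \<open>v\<close>, since
  otherwise one rotation would align them. This forces geometric decay.\<close>

lemma unalignable_imp_domination:
  fixes A :: "'a \<Rightarrow> mat2"
  assumes \<eta>: "\<eta> > 0" and det: "\<And>i. det (A ((T ^^ i) x)) = 1"
    and nr: "\<And>P. (\<And>i. P i \<in> near_id \<eta>) \<Longrightarrow> area (pert T A P m x *v u) v \<noteq> 0"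
  shows "u \<noteq> 0 \<and> (\<forall>i k. i \<le> k \<longrightarrow> k < m \<longrightarrow> norm (cocycle_fwd T A i x *v u)
            \<le> dom_const \<eta> * dom_rate \<eta> ^ (k - i) * norm (cocycle_fwd T A k x *v u))"
    and "\<exists>z. z \<noteq> 0 \<and> (\<forall>i k. i \<le> k \<longrightarrow> k < m \<longrightarrow> norm (cocycle_fwd T A k x *v z)
            \<le> dom_const \<eta> * dom_rate \<eta> ^ (k - i) * norm (cocycle_fwd T A i x *v z))"
proof -
  define L where "L = 4 / \<eta>\<^sup>2"
  have L: "L > 0" using \<eta> by (simp add: L_def)
  have dc: "det (cocycle_fwd T A n x) = 1" for n by (rule det_cocycle) (rule det)
  \<comment> \<open>\<open>zz\<close> is the backward orbit of \<open>v\<close>. Reaching the line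
    of \<open>v\<close> at time \<open>m\<close> amounts to meeting the line of \<open>zz i\<close>
    at some earlier time and not perturbing afterwards. The area \<open>a\<close> between the orbits
    of \<open>u\<close> and \<open>z\<close> does not depend on time.\<close>
  define z where "z = matrix_inv (cocycle_fwd T A m x) *v v"
  define zz where "zz i = cocycle_fwd T A i x *v z" for i
  define p where "p i = cocycle_fwd T A i x *v u" for i
  have zm: "zz m = v"
    by (simp add: zz_def z_def matrix_vector_mul_assoc matrix_inv_det_1[OF dc])
  have zS: "zz (Suc k) = A ((T ^^ k) x) *v zz k" for k
    by (simp add: zz_def matrix_vector_mul_assoc)
  have pS: "p (Suc k) = A ((T ^^ k) x) *v p k" for k
    by (simp add: p_def matrix_vector_mul_assoc)
  define a where "a = area u z"
  have pz: "area (p i) (zz i) = a" for i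
    by (simp add: p_def zz_def area_mult dc a_def)
  have a0: "a \<noteq> 0"
  proof -
    have "area (pert T A (\<lambda>_. mat 1) m x *v u) v \<noteq> 0"
      using \<eta> by (intro nr id_near_id) auto
    then show ?thesis using pz[of m] by (simp add: pert_id p_def zm)
  qed
  have zn: "zz i \<noteq> 0" for i using pz[of i] a0 by auto
  have un: "u \<noteq> 0" using a0 by (auto simp: a_def)
  \<comment> \<open>Stated for every admissible \<open>P\<close> because it is applied twice below:
    to the unperturbed orbit and to the sheared one.\<close>
  have ang: "norm (pert T A P k x *v u) * norm (zz k) \<le> 2 / \<eta> * \<bar>area (pert T A P k x *v u) (zz k)\<bar>"
    if P: "\<And>i. P i \<in> near_id \<eta>" and k: "k < m" and nz: "area (pert T A P k x *v u) (zz k) \<noteq> 0" for P k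
  proof (rule ccontr)
    define w where "w = pert T A P k x *v u"
    assume "\<not> ?thesis"
    then have "\<bar>area w (zz k)\<bar> \<le> \<eta> / 2 * (norm w * norm (zz k))"
      using \<eta> by (simp add: w_def field_simps)
    moreover have "w \<noteq> 0" using nz by (auto simp: w_def)
    ultimately obtain R where R: "R \<in> near_id \<eta>" "area (R *v w) (zz k) = 0"
      using near_id_rotation[of \<eta> w "zz k"] zn[of k] \<eta> by auto
    define P' where "P' i = (if i < k then P i else if i = k then R else mat 1)" for i
    have "area (pert T A P' j x *v u) (zz j) = 0" if "Suc k \<le> j" for j
      using that
    proof (induction j rule: dec_induct)
      case base
      have "pert T A P' k x = pert T A P k x" by (rule pert_cong) (simp add: P'_def)
      then have "pert T A P' (Suc k) x *v u = A ((T ^^ k) x) *v (R *v w)"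
        by (simp add: P'_def w_def matrix_vector_mul_assoc matrix_mul_assoc)
      then show ?case using R(2) det by (simp add: zS area_mult)
    next
      case (step j)
      then have "pert T A P' (Suc j) x *v u = A ((T ^^ j) x) *v (pert T A P' j x *v u)"
        by (simp add: P'_def matrix_vector_mul_assoc matrix_mul_assoc)
      then show ?case using step.IH det by (simp add: zS area_mult)
    qed
    then have "area (pert T A P' m x *v u) v = 0" using k zm by (metis Suc_leI)
    moreover have "P' i \<in> near_id \<eta>" for i using P R(1) id_near_id[of \<eta>] \<eta> by (simp add: P'_def)
    ultimately show False using nr by blast
  qed
  have p_ang: "norm (p k) * norm (zz k) \<le> 2 / \<eta> * \<bar>a\<bar>" if "k < m" for k
    using ang[of "\<lambda>_. mat 1" k] that id_near_id[of \<eta>] \<eta> pz[of k] a0 by (simp add: pert_id p_def)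
  have "\<exists>P. P \<in> near_id \<eta> \<and> (\<forall>w. P *v w = w + (\<eta> * area w (zz k) / (norm (zz k))\<^sup>2) *\<^sub>R zz k)" for k
    using near_id_shear[of \<eta> "zz k"] \<eta> zn[of k] by (metis less_imp_le)
  then obtain S where S: "\<And>k. S k \<in> near_id \<eta>"
      "\<And>k w. S k *v w = w + (\<eta> * area w (zz k) / (norm (zz k))\<^sup>2) *\<^sub>R zz k"
    by metis
  define \<sigma> where "\<sigma> k = (\<Sum>i<k. 1 / (norm (zz i))\<^sup>2)" for k
  \<comment> \<open>Earlier displacements are parallel to \<open>zz k\<close>, so every shear sees
    the same area \<open>a\<close> and the displacements simply add up.\<close>
  have w: "pert T A S k x *v u = p k + (\<eta> * a * \<sigma> k) *\<^sub>R zz k" for k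
  proof (induction k)
    case (Suc k)
    have "pert T A S (Suc k) x *v u = A ((T ^^ k) x) *v (S k *v (pert T A S k x *v u))"
      by (simp add: matrix_vector_mul_assoc matrix_mul_assoc)
    also have "S k *v (pert T A S k x *v u) = p k + (\<eta> * a * \<sigma> (Suc k)) *\<^sub>R zz k"
      by (simp add: Suc S(2) area_add_left area_scale_left pz \<sigma>_def algebra_simps add_divide_distrib)
    finally show ?case by (simp add: pS zS matrix_vector_right_distrib matrix_vector_mult_scaleR)
  qed (simp add: p_def \<sigma>_def)
  have key: "(\<Sum>i<k. 1 / (norm (zz i))\<^sup>2) * (norm (zz k))\<^sup>2 \<le> L" if k: "k < m" for k
  proof -
    have omw: "area (pert T A S k x *v u) (zz k) = a" by (simp add: w area_add_left area_scale_left pz)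
    have s0: "\<sigma> k \<ge> 0" unfolding \<sigma>_def by (intro sum_nonneg) simp
    have "norm (p k + (\<eta> * a * \<sigma> k) *\<^sub>R zz k) * norm (zz k) \<le> 2 / \<eta> * \<bar>a\<bar>"
      using ang[of S k, OF S(1) k] omw a0 w[of k] by simp
    moreover have "norm ((\<eta> * a * \<sigma> k) *\<^sub>R zz k) \<le> norm (p k + (\<eta> * a * \<sigma> k) *\<^sub>R zz k) + norm (p k)"
      by (metis add.commute add_diff_cancel_left' norm_triangle_ineq4)
    \<comment> \<open>The displacement is the difference of the sheared and the unperturbed vector,
      and the angle bound holds for each; twice \<open>2 / \<eta>\<close> is the origin of the 4 in
      \<open>L\<close>.\<close>
    ultimately have "norm ((\<eta> * a * \<sigma> k) *\<^sub>R zz k) * norm (zz k) \<le> 2 / \<eta> * \<bar>a\<bar> + 2 / \<eta> * \<bar>a\<bar>"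
      using p_ang[OF k] mult_right_mono[of "norm ((\<eta> * a * \<sigma> k) *\<^sub>R zz k)" _ "norm (zz k)"]
      by (smt (verit) distrib_right norm_ge_zero)
    then have "\<bar>a\<bar> * (\<eta> * \<sigma> k * (norm (zz k))\<^sup>2) \<le> \<bar>a\<bar> * (4 / \<eta>)"
      using \<eta> s0 by (simp add: abs_mult power2_eq_square algebra_simps)
    then have "\<eta> * \<sigma> k * (norm (zz k))\<^sup>2 \<le> 4 / \<eta>" using a0 by (rule_tac mult_left_le_imp_le[of "\<bar>a\<bar>"]) auto
    then have "\<sigma> k * (norm (zz k))\<^sup>2 \<le> L" using \<eta> by (simp add: L_def field_simps power2_eq_square)
    then show ?thesis by (simp add: \<sigma>_def)
  qed
  define \<theta> where "\<theta> = L / (L + 1)"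
  have rt: "dom_rate \<eta> = sqrt \<theta>" by (simp add: dom_rate_def \<theta>_def L_def)
  have \<theta>0: "\<theta> \<ge> 0" using L by (simp add: \<theta>_def)
  define C where "C = sqrt (L + 1)"
  have C0: "C \<ge> 0" by (simp add: C_def L less_imp_le)
  have hc: "dom_const \<eta> = (1 + 2 / \<eta>) * C" by (simp add: dom_const_def C_def L_def)
  have zdec: "norm (zz k) \<le> C * dom_rate \<eta> ^ (k - i) * norm (zz i)" if "i \<le> k" "k < m" for i k
  proof -
    have "(norm (zz k))\<^sup>2 \<le> (L + 1) * \<theta> ^ (k - i) * (norm (zz i))\<^sup>2"
      unfolding \<theta>_def using zn by (intro geometric_decay[OF L _ key that]) auto
    also have "\<dots> = (C * dom_rate \<eta> ^ (k - i) * norm (zz i))\<^sup>2"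
    proof -
      have "C\<^sup>2 = L + 1" using L by (simp add: C_def)
      moreover have "(dom_rate \<eta> ^ (k - i))\<^sup>2 = \<theta> ^ (k - i)"
        using \<theta>0 by (simp add: rt power_mult[symmetric] mult.commute[of _ 2] power_mult)
      ultimately show ?thesis by (simp add: power_mult_distrib)
    qed
    finally show ?thesis
      by (rule power2_le_imp_le) (simp add: rt C0 \<theta>0)
  qed
  have r0: "dom_rate \<eta> \<ge> 0" using dom_rate_bounds \<eta> by (simp add: less_imp_le)
  \<comment> \<open>The product of the norms of \<open>p i\<close> and \<open>zz i\<close> is
    comparable to the constant \<open>\<bar>a\<bar>\<close>, so contraction of \<open>zz\<close> is
    expansion of \<open>p\<close>.\<close>
  have "norm (p i) \<le> dom_const \<eta> * dom_rate \<eta> ^ (k - i) * norm (p k)" if ik: "i \<le> k" "k < m" for i k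
  proof -
    have "norm (p i) * norm (zz i) \<le> 2 / \<eta> * \<bar>a\<bar>" using p_ang ik by simp
    also have "\<dots> \<le> 2 / \<eta> * (norm (p k) * norm (zz k))"
      using area_le[of "p k" "zz k"] pz[of k] \<eta> by (intro mult_left_mono) auto
    also have "\<dots> \<le> 2 / \<eta> * (norm (p k) * (C * dom_rate \<eta> ^ (k - i) * norm (zz i)))"
      using zdec[OF ik] \<eta> by (intro mult_left_mono) auto
    finally have "norm (p i) * norm (zz i) \<le> (2 / \<eta> * C * dom_rate \<eta> ^ (k - i) * norm (p k)) * norm (zz i)"
      by (simp add: algebra_simps)
    then have "norm (p i) \<le> 2 / \<eta> * C * dom_rate \<eta> ^ (k - i) * norm (p k)"
      using zn[of i] by (rule_tac mult_right_le_imp_le[of _ "norm (zz i)"]) auto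
    also have "\<dots> \<le> dom_const \<eta> * dom_rate \<eta> ^ (k - i) * norm (p k)"
      using \<eta> C0 r0 by (intro mult_right_mono) (auto simp: hc algebra_simps)
    finally show ?thesis .
  qed
  then show "u \<noteq> 0 \<and> (\<forall>i k. i \<le> k \<longrightarrow> k < m \<longrightarrow> norm (cocycle_fwd T A i x *v u)
            \<le> dom_const \<eta> * dom_rate \<eta> ^ (k - i) * norm (cocycle_fwd T A k x *v u))"
    using un by (simp add: p_def)
  have "norm (zz k) \<le> dom_const \<eta> * dom_rate \<eta> ^ (k - i) * norm (zz i)" if ik: "i \<le> k" "k < m" for i k
  proof -
    have "norm (zz k) \<le> C * dom_rate \<eta> ^ (k - i) * norm (zz i)" by (rule zdec[OF ik])
    also have "\<dots> \<le> dom_const \<eta> * dom_rate \<eta> ^ (k - i) * norm (zz i)"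
      using \<eta> C0 r0 by (intro mult_right_mono) (auto simp: hc algebra_simps)
    finally show ?thesis .
  qed
  moreover have "z \<noteq> 0" using a0 by (auto simp: a_def)
  ultimately show "\<exists>z. z \<noteq> 0 \<and> (\<forall>i k. i \<le> k \<longrightarrow> k < m \<longrightarrow> norm (cocycle_fwd T A k x *v z)
            \<le> dom_const \<eta> * dom_rate \<eta> ^ (k - i) * norm (cocycle_fwd T A i x *v z))"
    unfolding zz_def by blast
qed

section \<open>From finite horizons to contracted lines\<close>

text \<open>The vector may change with the horizon \<open>m\<close>. A cluster point on the unit
  circle inherits every single constraint, since each one holds from some horizon on.\<close>

lemma uniform_unit_vector:
  fixes N :: "nat \<Rightarrow> mat2" and c :: "nat \<Rightarrow> real"
  assumes "\<And>m. \<exists>z. z \<noteq> 0 \<and> (\<forall>k<m. norm (N k *v z) \<le> c k * norm z)"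
  shows "\<exists>z. norm z = 1 \<and> (\<forall>k. norm (N k *v z) \<le> c k)"
proof -
  have "\<exists>z. norm z = 1 \<and> (\<forall>k<m. norm (N k *v z) \<le> c k)" for m
  proof -
    obtain z where z: "z \<noteq> 0" "\<forall>k<m. norm (N k *v z) \<le> c k * norm z" using assms by blast
    have "norm (N k *v ((1 / norm z) *\<^sub>R z)) \<le> c k" if "k < m" for k
      using z that by (simp add: matrix_vector_mult_scaleR pos_divide_le_eq)
    then show ?thesis using z(1) by (intro exI[of _ "(1 / norm z) *\<^sub>R z"]) simp
  qed
  then obtain Z where Z: "\<And>m. norm (Z m) = 1" "\<And>m k. k < m \<Longrightarrow> norm (N k *v Z m) \<le> c k" by metis
  have "\<forall>m. Z m \<in> sphere 0 1" using Z(1) by simp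
  then obtain l r where l: "l \<in> sphere 0 1" "strict_mono r" "(Z \<circ> r) \<longlonglongrightarrow> l"
    using compact_sphere[of "0::real^2" 1] unfolding compact_def by metis
  have "norm (N k *v l) \<le> c k" for k
  proof (rule LIMSEQ_le_const2)
    show "(\<lambda>n. norm (N k *v (Z \<circ> r) n)) \<longlonglongrightarrow> norm (N k *v l)"
      by (intro tendsto_norm bounded_linear.tendsto[OF blin_mat] l)
    show "\<exists>K. \<forall>n\<ge>K. norm (N k *v (Z \<circ> r) n) \<le> c k"
      using Z(2) seq_suble[OF l(2)] by (intro exI[of _ "Suc k"]) (metis Suc_le_lessD comp_apply order_less_le_trans)
  qed
  then show ?thesis using l(1) by auto
qed

text \<open>The first part describes the line without reference to \<open>z\<close>, from which its
  invariance will follow by shifting a limit. The second exhibits the distance to it as a limit of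
  quantities measurable in the matrices. Both use area: \<open>\<bar>area z v\<bar>\<close> is
  bounded by the product of the image norms, and the image of \<open>rot z\<close> carries the norm
  of \<open>N n\<close> up to a vanishing error.\<close>

lemma contracted_line:
  fixes N :: "nat \<Rightarrow> mat2"
  assumes det: "\<And>n. det (N n) = 1" and z: "norm z = 1"
    and dec: "\<And>n. norm (N n *v z) \<le> C * \<tau> ^ n" and \<tau>: "0 < \<tau>" "\<tau> < 1"
  shows "{v. (\<lambda>n. N n *v v) \<longlonglongrightarrow> 0} = range (\<lambda>c. c *\<^sub>R z)"
    and "(\<lambda>n. norm (N n *v v) / mnorm (N n)) \<longlonglongrightarrow> infdist v (range (\<lambda>c. c *\<^sub>R z))"
proof -
  have "(\<lambda>n. C * \<tau> ^ n) \<longlonglongrightarrow> C * 0"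
    using \<tau> by (intro tendsto_mult tendsto_const LIMSEQ_power_zero) auto
  then have g: "(\<lambda>n. C * \<tau> ^ n) \<longlonglongrightarrow> 0" by simp
  have Nz: "(\<lambda>n. N n *v z) \<longlonglongrightarrow> 0"
    by (rule Lim_null_comparison[OF _ g]) (use dec in auto)
  show "{v. (\<lambda>n. N n *v v) \<longlonglongrightarrow> 0} = range (\<lambda>c. c *\<^sub>R z)"
  proof (intro equalityI subsetI)
    fix v assume "v \<in> {v. (\<lambda>n. N n *v v) \<longlonglongrightarrow> 0}"
    then have Nv: "(\<lambda>n. N n *v v) \<longlonglongrightarrow> 0" by simp
    have "(\<lambda>n. norm (N n *v z) * norm (N n *v v)) \<longlonglongrightarrow> 0"
      using tendsto_mult[OF tendsto_norm[OF Nz] tendsto_norm[OF Nv]] by simp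
    moreover have "\<bar>area z v\<bar> \<le> norm (N n *v z) * norm (N n *v v)" for n
      using area_le[of "N n *v z" "N n *v v"] by (simp add: area_mult det)
    ultimately have "\<bar>area z v\<bar> \<le> 0" by (intro LIMSEQ_le_const) auto
    then have "v = (z \<bullet> v) *\<^sub>R z" using unit_decomp[OF z, of v] by simp
    then show "v \<in> range (\<lambda>c. c *\<^sub>R z)" by blast
  next
    fix v assume "v \<in> range (\<lambda>c. c *\<^sub>R z)"
    then obtain c where "v = c *\<^sub>R z" by blast
    then show "v \<in> {v. (\<lambda>n. N n *v v) \<longlonglongrightarrow> 0}"
      using tendsto_scaleR[OF tendsto_const[of c] Nz] by (simp add: matrix_vector_mult_scaleR)
  qed
  have inf: "infdist v (range (\<lambda>c. c *\<^sub>R z)) = \<bar>area z v\<bar>"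
  proof (rule antisym)
    have "norm (v - (z \<bullet> v) *\<^sub>R z) = \<bar>area z v\<bar>"
    proof -
      have "v - (z \<bullet> v) *\<^sub>R z = area z v *\<^sub>R rot z" using unit_decomp[OF z, of v] by (metis add_diff_cancel_left')
      then show ?thesis using z by simp
    qed
    then show "infdist v (range (\<lambda>c. c *\<^sub>R z)) \<le> \<bar>area z v\<bar>"
      by (metis dist_norm infdist_le rangeI)
    have "\<bar>area z v\<bar> \<le> dist v a" if "a \<in> range (\<lambda>c. c *\<^sub>R z)" for a
    proof -
      from that obtain c where a: "a = c *\<^sub>R z" by (elim rangeE) blast
      have "area z v = area z (v - a)" by (simp add: area_diff_right a area_scale_right)
      then show ?thesis using area_le[of z "v - a"] z by (simp add: dist_norm)
    qed
    then show "\<bar>area z v\<bar> \<le> infdist v (range (\<lambda>c. c *\<^sub>R z))"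
      unfolding infdist_def by (auto intro!: cINF_greatest)
  qed
  define \<alpha> \<beta> where "\<alpha> = z \<bullet> v" and "\<beta> = area z v"
  have v: "v = \<alpha> *\<^sub>R z + \<beta> *\<^sub>R rot z" using unit_decomp[OF z] by (simp add: \<alpha>_def \<beta>_def)
  have bd: "\<bar>norm (N n *v v) / mnorm (N n) - \<bar>\<beta>\<bar>\<bar> \<le> (\<bar>\<alpha>\<bar> + \<bar>\<beta>\<bar>) * norm (N n *v z)" for n
  proof -
    have m1: "1 \<le> mnorm (N n)" by (rule mnorm_ge_1[OF det])
    have Nv: "N n *v v = \<alpha> *\<^sub>R (N n *v z) + \<beta> *\<^sub>R (N n *v rot z)"
      by (subst v) (simp add: matrix_vector_mult_scaleR matrix_vector_right_distrib)
    have 1: "\<bar>norm (N n *v v) - \<bar>\<beta>\<bar> * norm (N n *v rot z)\<bar> \<le> \<bar>\<alpha>\<bar> * norm (N n *v z)"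
      using norm_triangle_ineq3[of "N n *v v" "\<beta> *\<^sub>R (N n *v rot z)"] by (simp add: Nv)
    have 2: "norm (N n *v rot z) \<le> mnorm (N n)" using norm_le_mnorm[of "N n" "rot z"] z by simp
    have 3: "mnorm (N n) \<le> norm (N n *v z) + norm (N n *v rot z)"
    proof (rule mnorm_leI)
      fix y
      have "N n *v y = (z \<bullet> y) *\<^sub>R (N n *v z) + area z y *\<^sub>R (N n *v rot z)"
        by (metis unit_decomp[OF z] matrix_vector_mult_scaleR matrix_vector_right_distrib)
      then have "norm (N n *v y) \<le> \<bar>z \<bullet> y\<bar> * norm (N n *v z) + \<bar>area z y\<bar> * norm (N n *v rot z)"
        by (metis norm_scaleR norm_triangle_ineq)
      also have "\<dots> \<le> norm y * norm (N n *v z) + norm y * norm (N n *v rot z)"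
        using Cauchy_Schwarz_ineq2[of z y] area_le[of z y] z by (intro add_mono mult_right_mono) auto
      finally show "norm (N n *v y) \<le> (norm (N n *v z) + norm (N n *v rot z)) * norm y"
        by (simp add: algebra_simps)
    qed
    have "\<bar>\<bar>\<beta>\<bar> * norm (N n *v rot z) - \<bar>\<beta>\<bar> * mnorm (N n)\<bar> = \<bar>\<beta>\<bar> * (mnorm (N n) - norm (N n *v rot z))"
      using 2 by (simp add: abs_mult abs_minus_commute flip: right_diff_distrib)
    also have "\<dots> \<le> \<bar>\<beta>\<bar> * norm (N n *v z)" using 3 by (intro mult_left_mono) auto
    finally have "\<bar>norm (N n *v v) - \<bar>\<beta>\<bar> * mnorm (N n)\<bar> \<le> (\<bar>\<alpha>\<bar> + \<bar>\<beta>\<bar>) * norm (N n *v z)"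
      using 1 unfolding distrib_right by linarith
    moreover have "norm (N n *v v) / mnorm (N n) - \<bar>\<beta>\<bar> = (norm (N n *v v) - \<bar>\<beta>\<bar> * mnorm (N n)) / mnorm (N n)"
      using m1 by (simp add: diff_divide_distrib)
    then have "\<bar>norm (N n *v v) / mnorm (N n) - \<bar>\<beta>\<bar>\<bar> = \<bar>norm (N n *v v) - \<bar>\<beta>\<bar> * mnorm (N n)\<bar> / mnorm (N n)"
      using m1 by simp
    moreover have "\<dots> \<le> \<bar>norm (N n *v v) - \<bar>\<beta>\<bar> * mnorm (N n)\<bar> / 1"
      using m1 by (intro divide_left_mono) auto
    ultimately show ?thesis by simp
  qed
  have "(\<lambda>n. (\<bar>\<alpha>\<bar> + \<bar>\<beta>\<bar>) * norm (N n *v z)) \<longlonglongrightarrow> (\<bar>\<alpha>\<bar> + \<bar>\<beta>\<bar>) * norm (0::real^2)"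
    by (intro tendsto_intros Nz)
  then have lim: "(\<lambda>n. (\<bar>\<alpha>\<bar> + \<bar>\<beta>\<bar>) * norm (N n *v z)) \<longlonglongrightarrow> 0" by simp
  have "(\<lambda>n. norm (N n *v v) / mnorm (N n) - \<bar>\<beta>\<bar>) \<longlonglongrightarrow> 0"
    by (rule Lim_null_comparison[OF always_eventually lim]) (use bd in \<open>simp only: real_norm_def simp_thms\<close>)
  then have "(\<lambda>n. norm (N n *v v) / mnorm (N n)) \<longlonglongrightarrow> \<bar>\<beta>\<bar>" by (rule LIM_zero_cancel)
  then show "(\<lambda>n. norm (N n *v v) / mnorm (N n)) \<longlonglongrightarrow> infdist v (range (\<lambda>c. c *\<^sub>R z))"
    by (simp only: inf \<beta>_def)
qed

section \<open>Ergodic automorphisms\<close>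

locale ergodic_automorphism = prob_space M for M :: "'a measure" +
  fixes T :: "'a \<Rightarrow> 'a"
  assumes aut: "automorphism M T" and erg: "ergodic M T"
begin

abbreviation "Ti \<equiv> inv_into (space M) T"

lemma T_meas [measurable]: "T \<in> M \<rightarrow>\<^sub>M M" and Ti_meas [measurable]: "Ti \<in> M \<rightarrow>\<^sub>M M"
  and T_bij: "bij_betw T (space M) (space M)"
  and T_emeasure: "B \<in> sets M \<Longrightarrow> emeasure M (T -` B \<inter> space M) = emeasure M B"
  using aut by (auto simp: automorphism_def)

lemma T_space [simp]: "x \<in> space M \<Longrightarrow> T x \<in> space M"
  and Ti_space [simp]: "x \<in> space M \<Longrightarrow> Ti x \<in> space M"
  and Ti_T [simp]: "x \<in> space M \<Longrightarrow> Ti (T x) = x"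
  and T_Ti [simp]: "x \<in> space M \<Longrightarrow> T (Ti x) = x"
  using T_bij by (auto simp: bij_betw_def inv_into_into inv_into_f_f f_inv_into_f)

lemma Tn_space [simp]: "x \<in> space M \<Longrightarrow> (T ^^ n) x \<in> space M"
  by (induction n) auto

lemma Tin_space [simp]: "x \<in> space M \<Longrightarrow> (Ti ^^ n) x \<in> space M"
  by (induction n) auto

lemma Tn_meas [measurable]: "(T ^^ n) \<in> M \<rightarrow>\<^sub>M M"
  by (induction n) (auto simp: id_def)

lemma Tin_meas [measurable]: "(Ti ^^ n) \<in> M \<rightarrow>\<^sub>M M"
  by (induction n) (auto simp: id_def)

lemma Tin_Tn [simp]: "x \<in> space M \<Longrightarrow> (Ti ^^ n) ((T ^^ n) x) = x"
  by (induction n arbitrary: x) (auto simp: funpow_swap1)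

lemma Tn_Tin [simp]: "x \<in> space M \<Longrightarrow> (T ^^ n) ((Ti ^^ n) x) = x"
  by (induction n arbitrary: x) (auto simp: funpow_swap1)

lemma Tin_Tn_le: "x \<in> space M \<Longrightarrow> j \<le> n \<Longrightarrow> (Ti ^^ j) ((T ^^ n) x) = (T ^^ (n - j)) x"
proof -
  assume x: "x \<in> space M" and j: "j \<le> n"
  have "(T ^^ n) x = (T ^^ j) ((T ^^ (n - j)) x)"
    using j by (metis funpow_add le_add_diff_inverse o_apply)
  then show "(Ti ^^ j) ((T ^^ n) x) = (T ^^ (n - j)) x" using x by simp
qed

lemma Tn_Tin_le: "x \<in> space M \<Longrightarrow> j \<le> n \<Longrightarrow> (T ^^ j) ((Ti ^^ n) x) = (Ti ^^ (n - j)) x"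
proof -
  assume x: "x \<in> space M" and j: "j \<le> n"
  have "(Ti ^^ n) x = (Ti ^^ j) ((Ti ^^ (n - j)) x)"
    using j by (metis funpow_add le_add_diff_inverse o_apply)
  then show "(T ^^ j) ((Ti ^^ n) x) = (Ti ^^ (n - j)) x" using x by simp
qed

lemma distr_T: "distr M M T = M"
  by (rule measure_eqI) (auto simp: emeasure_distr T_emeasure)

lemma distr_Tn: "distr M M (T ^^ n) = M"
proof (induction n)
  case 0 show ?case by (simp add: id_def distr_id)
next
  case (Suc n)
  have "distr M M (T ^^ Suc n) = distr (distr M M (T ^^ n)) M T"
    by (subst distr_distr) auto
  then show ?case unfolding Suc distr_T .
qed

lemma AE_T: "AE x in M. P x \<Longrightarrow> AE x in M. P (T x)"
  using AE_distrD[OF T_meas, of P] by (metis distr_T)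

text \<open>Makes forward statements available along backward orbits.\<close>

lemma inverse_ergodic: "ergodic_automorphism M Ti"
proof
  have bi: "bij_betw Ti (space M) (space M)" using T_bij by (rule bij_betw_inv_into)
  have eq: "inv_into (space M) Ti x = T x" if "x \<in> space M" for x
    using that bi by (metis Ti_T T_space bij_betw_def inv_into_f_f)
  have vim: "Ti -` B \<inter> space M = T ` B" if "B \<subseteq> space M" for B
  proof (intro equalityI subsetI)
    fix x assume "x \<in> Ti -` B \<inter> space M"
    then show "x \<in> T ` B" by (intro image_eqI[of _ _ "Ti x"]) auto
  qed (use that in auto)
  have Tim: "T -` (T ` B) \<inter> space M = B" if "B \<subseteq> space M" for B
  proof (intro equalityI subsetI)
    fix x assume x: "x \<in> T -` (T ` B) \<inter> space M"
    then obtain y where "y \<in> B" "T x = T y" by auto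
    then show "x \<in> B" using x that by (metis IntD2 Ti_T subsetD)
  qed (use that in auto)
  show "automorphism M Ti" unfolding automorphism_def
  proof (intro conjI ballI)
    show "inv_into (space M) Ti \<in> M \<rightarrow>\<^sub>M M"
      using T_meas by (simp cong: measurable_cong add: eq)
    fix B assume B: "B \<in> sets M"
    have "Ti -` B \<inter> space M \<in> sets M" using B by simp
    from T_emeasure[OF this] show "emeasure M (Ti -` B \<inter> space M) = emeasure M B"
      using sets.sets_into_space[OF B] by (simp add: vim Tim)
  qed (use bi in auto)
  show "ergodic M Ti" unfolding ergodic_def
  proof (intro ballI impI)
    fix B assume B: "B \<in> sets M" "Ti -` B \<inter> space M = B"
    have "T -` B \<inter> space M = B"
      using sets.sets_into_space[OF B(1)] B(2) vim[of B] Tim[of B] by simp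
    then show "measure M B = 0 \<or> measure M B = 1" using erg B by (simp add: ergodic_def)
  qed
qed

lemma AE_Tn: "AE x in M. P x \<Longrightarrow> AE x in M. \<forall>n. P ((T ^^ n) x)"
proof -
  assume P: "AE x in M. P x"
  have "AE x in M. P ((T ^^ n) x)" for n
  proof (induction n)
    case (Suc n)
    from AE_T[OF this] show ?case by (simp add: funpow_swap1)
  qed (use P in simp)
  then show ?thesis by (simp add: AE_all_countable)
qed

lemma AE_Tin: "AE x in M. P x \<Longrightarrow> AE x in M. \<forall>n. P ((Ti ^^ n) x)"
  by (rule ergodic_automorphism.AE_Tn[OF inverse_ergodic])

section \<open>Recurrence, small sets and sparse sets\<close>

text \<open>The hitting set \<open>F\<close> merely contains its preimage, whereas
  \<open>ergodic\<close> asks for exact invariance. The iterated preimages of \<open>F\<close>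
  decrease and all have the measure of \<open>F\<close>, so their intersection \<open>G\<close> is
  exactly invariant and just as large.\<close>

lemma AE_hits:
  assumes E: "E \<in> sets M" "measure M E > 0"
  shows "AE x in M. \<exists>n. (T ^^ n) x \<in> E"
proof -
  define F where "F = {x \<in> space M. \<exists>n. (T ^^ n) x \<in> E}"
  define G where "G = (\<Inter>k. (T ^^ k) -` F \<inter> space M)"
  have Fs [measurable]: "F \<in> sets M" unfolding F_def using E(1) by measurable
  have Gs: "G \<in> sets M" unfolding G_def by measurable
  have sub: "T x \<in> F \<Longrightarrow> x \<in> space M \<Longrightarrow> x \<in> F" for x
  proof -
    assume Tx: "T x \<in> F" and x: "x \<in> space M"
    from Tx obtain n where "(T ^^ n) (T x) \<in> E" by (auto simp: F_def)
    then have "(T ^^ Suc n) x \<in> E" by (simp add: funpow_swap1)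
    then show "x \<in> F" using x unfolding F_def by blast
  qed
  have inv: "T -` G \<inter> space M = G"
  proof (intro equalityI subsetI)
    fix x assume x: "x \<in> T -` G \<inter> space M"
    have "(T ^^ k) x \<in> F" for k
    proof (cases k)
      case 0
      have "(T ^^ 0) (T x) \<in> F" using x unfolding G_def by blast
      then have "T x \<in> F" by simp
      then show ?thesis using sub x 0 by auto
    next
      case (Suc j)
      have "(T ^^ j) (T x) \<in> F" using x unfolding G_def by blast
      then show ?thesis using Suc by (simp add: funpow_swap1)
    qed
    then show "x \<in> G" using x by (auto simp: G_def)
  next
    fix x assume x: "x \<in> G"
    then have "x \<in> space M" by (auto simp: G_def)
    moreover have "(T ^^ k) (T x) \<in> F" for k
    proof -
      have "(T ^^ Suc k) x \<in> F" using x unfolding G_def by blast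
      then show ?thesis by (simp add: funpow_swap1)
    qed
    ultimately show "x \<in> T -` G \<inter> space M" by (auto simp: G_def)
  qed
  have "decseq (\<lambda>k. (T ^^ k) -` F \<inter> space M)"
    by (rule decseq_SucI) (auto intro: sub[OF _ Tn_space])
  then have "(\<lambda>k. measure M ((T ^^ k) -` F \<inter> space M)) \<longlonglongrightarrow> measure M G"
    unfolding G_def by (intro finite_Lim_measure_decseq) auto
  moreover have "measure M ((T ^^ k) -` F \<inter> space M) = measure M F" for k
    using measure_distr[OF Tn_meas Fs, of k] by (simp add: distr_Tn)
  ultimately have "measure M G = measure M F" by (simp add: LIMSEQ_const_iff)
  moreover have "measure M E \<le> measure M F"
    using E(1) Fs sets.sets_into_space[OF E(1)]
    by (intro finite_measure_mono) (auto simp: F_def intro: exI[of _ 0])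
  ultimately have "measure M F = 1"
    using erg Gs inv E(2) by (auto simp: ergodic_def)
  then have "AE x in M. x \<in> F" using prob_eq_1[OF Fs] by simp
  then show ?thesis by eventually_elim (auto simp: F_def)
qed

lemma AE_hits_bwd:
  "E \<in> sets M \<Longrightarrow> measure M E > 0 \<Longrightarrow> AE x in M. \<exists>n. (Ti ^^ n) x \<in> E"
  by (rule ergodic_automorphism.AE_hits[OF inverse_ergodic])

lemma integral_Tn:
  fixes f :: "'a \<Rightarrow> real"
  assumes "f \<in> borel_measurable M"
  shows "(\<integral>x. f ((T ^^ n) x) \<partial>M) = (\<integral>x. f x \<partial>M)"
  using integral_distr[OF Tn_meas assms, of n] by (simp add: distr_Tn)

lemma integrable_Tn:
  fixes f :: "'a \<Rightarrow> real"
  assumes "integrable M f"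
  shows "integrable M (\<lambda>x. f ((T ^^ n) x))"
  using integrable_distr[OF Tn_meas, of n f] assms by (simp add: distr_Tn)

text \<open>Of a proper part and the remainder, one has at most half the measure; halving is then
  iterated.\<close>

lemma small_subset:
  assumes na: "nonatomic M" and E: "E \<in> sets M" "measure M E > 0" and \<kappa>: "\<kappa> > 0"
  shows "\<exists>B\<in>sets M. B \<subseteq> E \<and> 0 < measure M B \<and> measure M B < \<kappa>"
proof -
  have half: "\<exists>B\<in>sets M. B \<subseteq> C \<and> 0 < measure M B \<and> measure M B \<le> measure M C / 2"
    if C: "C \<in> sets M" "measure M C > 0" for C
  proof -
    obtain B where B: "B \<in> sets M" "B \<subseteq> C" "0 < measure M B" "measure M B < measure M C"
      using na C unfolding nonatomic_def by blast
    have d: "measure M (C - B) = measure M C - measure M B"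
      using B C by (intro finite_measure_Diff) auto
    show ?thesis
    proof (cases "measure M B \<le> measure M C / 2")
      case True then show ?thesis using B by blast
    next
      case False then show ?thesis using B C d by (intro bexI[of _ "C - B"]) auto
    qed
  qed
  have "\<exists>B\<in>sets M. B \<subseteq> E \<and> 0 < measure M B \<and> measure M B \<le> measure M E / 2 ^ n" for n
  proof (induction n)
    case 0 then show ?case using E by auto
  next
    case (Suc n)
    then obtain B where B: "B\<in>sets M" "B \<subseteq> E" "0 < measure M B" "measure M B \<le> measure M E / 2 ^ n" by blast
    from half[OF B(1,3)] obtain B' where "B' \<in> sets M" "B' \<subseteq> B" "0 < measure M B'" "measure M B' \<le> measure M B / 2" by blast
    then show ?case using B by (intro bexI[of _ B']) auto
  qed
  moreover obtain n where "(1/2::real) ^ n < \<kappa>" using real_arch_pow_inv[OF \<kappa>, of "1/2"] by auto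
  moreover have "measure M E / 2 ^ n \<le> (1/2) ^ n" for n
    by (simp add: power_divide divide_right_mono)
  ultimately show ?thesis by (meson order_le_less_trans)
qed

text \<open>\<open>Z\<close> consists of the points of a small set \<open>F\<close> that stay away
  from \<open>F\<close> for the next \<open>N - 1\<close> steps. If it were null, almost every point
  would have visited \<open>F\<close> within its last \<open>N\<close> positions, so
  \<open>N\<close> copies of \<open>F\<close> would cover the space, against
  \<open>measure M F < 1 / N\<close>.\<close>

lemma sparse_subset:
  assumes na: "nonatomic M" and E: "E \<in> sets M" "measure M E > 0" and N: "N > (0::nat)"
  shows "\<exists>Z\<in>sets M. Z \<subseteq> E \<and> 0 < measure M Z \<and> measure M Z < 1 / N \<and>
           (\<forall>z\<in>Z. \<forall>j. 0 < j \<longrightarrow> j < N \<longrightarrow> (T ^^ j) z \<notin> Z)"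
proof -
  obtain F where F [measurable]: "F \<in> sets M" and F': "F \<subseteq> E" "0 < measure M F" "measure M F < 1 / N"
    using small_subset[OF na E, of "1 / N"] N by auto
  define Z where "Z = {x \<in> F. \<forall>j. 0 < j \<longrightarrow> j < N \<longrightarrow> (T ^^ j) x \<notin> F}"
  have "Z = {x \<in> space M. x \<in> F \<and> (\<forall>j. 0 < j \<longrightarrow> j < N \<longrightarrow> (T ^^ j) x \<notin> F)}"
    using sets.sets_into_space[OF F] by (auto simp: Z_def)
  then have Zs [measurable]: "Z \<in> sets M" by simp
  have "measure M Z \<noteq> 0"
  proof
    assume "measure M Z = 0"
    then have "AE x in M. x \<notin> Z" using Zs by (simp add: prob_eq_0)
    then have "AE x in M. \<forall>n. (Ti ^^ n) x \<notin> Z" by (rule AE_Tin)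
    then have "AE x in M. x \<in> (\<Union>j<N. (Ti ^^ j) -` F \<inter> space M)"
      using AE_hits_bwd[OF F F'(2)] AE_space
    proof eventually_elim
      case (elim x)
      define b where "b = (LEAST n. (Ti ^^ n) x \<in> F)"
      have b: "(Ti ^^ b) x \<in> F" unfolding b_def using elim(2) by (rule LeastI_ex)
      have bl: "(Ti ^^ j) x \<notin> F" if "j < b" for j using that not_less_Least unfolding b_def by blast
      have "(T ^^ j) ((Ti ^^ b) x) \<notin> F" if "0 < j" "j \<le> b" for j
        using bl[of "b - j"] that elim(3) by (simp add: Tn_Tin_le)
      then have "b \<ge> N \<Longrightarrow> (Ti ^^ b) x \<in> Z" using b unfolding Z_def by simp
      then have "b < N" using elim(1) not_less by blast
      then show ?case using b elim(3) by auto
    qed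
    then have "1 \<le> measure M (\<Union>j<N. (Ti ^^ j) -` F \<inter> space M)"
      by (subst (asm) AE_in_set_eq_1) auto
    also have "\<dots> \<le> (\<Sum>j<N. measure M ((Ti ^^ j) -` F \<inter> space M))"
      by (intro finite_measure_subadditive_finite) auto
    also have "\<dots> = (\<Sum>j<N. measure M F)"
    proof (intro sum.cong refl)
      fix j
      show "measure M ((Ti ^^ j) -` F \<inter> space M) = measure M F"
        using measure_distr[OF Tin_meas F, of j] ergodic_automorphism.distr_Tn[OF inverse_ergodic, of j] by simp
    qed
    also have "\<dots> < 1" using F'(3) N by (simp add: field_simps)
    finally show False by simp
  qed
  then have "measure M Z > 0" by (simp add: zero_less_measure_iff)
  moreover have "measure M Z \<le> measure M F" by (intro finite_measure_mono) (auto simp: Z_def)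
  ultimately show ?thesis using F' Zs by (intro bexI[of _ Z]) (auto simp: Z_def)
qed

section \<open>Maximal inequality and upper Birkhoff bound\<close>

text \<open>Garsia's argument: where the running maximum \<open>X N\<close> is positive, it is
  attained at a positive time and exceeds its value at \<open>T x\<close> by at most
  \<open>h x\<close>. In the integral the two maxima cancel by invariance of the measure. The
  hypothesis makes the sets where \<open>X N\<close> is positive exhaust the space.\<close>

lemma maximal_ergodic:
  fixes h :: "'a \<Rightarrow> real"
  assumes h: "integrable M h" and pos: "AE x in M. \<exists>n. (\<Sum>j<n. h ((T ^^ j) x)) > 0"
  shows "(\<integral>x. h x \<partial>M) \<ge> 0"
proof -
  define S where "S n x = (\<Sum>j<n. h ((T ^^ j) x))" for n x
  define X where "X N x = Max ((\<lambda>n. S n x) ` {..N})" for N x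
  have [measurable]: "h \<in> borel_measurable M" using h by simp
  have Sint: "integrable M (S n)" for n unfolding S_def by (intro Bochner_Integration.integrable_sum integrable_Tn h)
  have Sm [measurable]: "S n \<in> borel_measurable M" for n using Sint by simp
  have Xint: "integrable M (X N)" for N
  proof (induction N)
    case 0 show ?case using Sint[of 0] by (simp add: X_def)
  next
    case (Suc N)
    have "X (Suc N) = (\<lambda>x. max (S (Suc N) x) (X N x))"
      by (rule ext) (simp add: X_def atMost_Suc)
    then show ?case using Suc Sint[of "Suc N"] by simp
  qed
  have Xm [measurable]: "X N \<in> borel_measurable M" for N using Xint by simp
  have X0: "X N x \<ge> 0" for N x
  proof -
    have "S 0 x \<le> X N x" unfolding X_def by (intro Max_ge) auto
    then show ?thesis by (simp add: S_def)
  qed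
  have SS: "S (Suc n) x = h x + S n (T x)" for n x
    unfolding S_def sum.lessThan_Suc_shift by (simp add: funpow_swap1)
  have main: "(\<integral>x. h x * indicator {x. X N x > 0} x \<partial>M) \<ge> 0" for N
  proof -
    have pw: "X N x - X N (T x) \<le> h x * indicator {x. X N x > 0} x" for x
    proof (cases "X N x > 0")
      case True
      have "X N x \<in> (\<lambda>n. S n x) ` {..N}" unfolding X_def by (intro Max_in) auto
      then obtain n where n: "n \<le> N" "X N x = S n x" by auto
      then have "n \<noteq> 0" using True by (intro notI) (simp add: S_def)
      then obtain m where m: "n = Suc m" by (cases n) auto
      have "S m (T x) \<le> X N (T x)" unfolding X_def using n m by (intro Max_ge) auto
      then show ?thesis using n m True by (simp add: SS)
    next
      case False then show ?thesis using X0[of N "T x"] X0[of N x] by simp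
    qed
    have XT: "integrable M (\<lambda>x. X N (T x))" using integrable_Tn[OF Xint, of N 1] by simp
    have hi: "integrable M (\<lambda>x. h x * indicator {x. X N x > 0} x)"
    proof -
      have "(\<lambda>x. h x * indicator {x. X N x > 0} x) = (\<lambda>x. if X N x > 0 then h x else 0)" by auto
      moreover have "integrable M (\<lambda>x. if X N x > 0 then h x else 0)"
        by (rule Bochner_Integration.integrable_bound[OF h]) auto
      ultimately show ?thesis by simp
    qed
    have "0 = (\<integral>x. X N x - X N (T x) \<partial>M)"
      using integral_Tn[of "X N" 1] XT Xint by simp
    also have "\<dots> \<le> (\<integral>x. h x * indicator {x. X N x > 0} x \<partial>M)"
      using XT Xint hi pw by (intro integral_mono) auto
    finally show ?thesis .
  qed
  have "(\<lambda>N. \<integral>x. h x * indicator {x. X N x > 0} x \<partial>M) \<longlonglongrightarrow> (\<integral>x. h x \<partial>M)"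
  proof (rule integral_dominated_convergence[where w="\<lambda>x. \<bar>h x\<bar>"])
    show "AE x in M. (\<lambda>N. h x * indicator {x. X N x > 0} x) \<longlonglongrightarrow> h x"
      using pos
    proof eventually_elim
      case (elim x)
      then obtain n where n: "S n x > 0" by (auto simp: S_def)
      have "X N x > 0" if "N \<ge> n" for N
      proof -
        have "S n x \<le> X N x" unfolding X_def using that by (intro Max_ge) auto
        then show ?thesis using n by simp
      qed
      then have "\<forall>\<^sub>F N in sequentially. h x = h x * indicator {x. X N x > 0} x"
        by (intro eventually_sequentiallyI[of n]) simp
      then show ?case by (rule Lim_transform_eventually[OF tendsto_const])
    qed
    show "(\<lambda>x. h x * indicator {x. X i x > 0} x) \<in> borel_measurable M" for i
    proof -
      have "(\<lambda>x. h x * indicator {x. X i x > 0} x) = (\<lambda>x. if X i x > 0 then h x else 0)" by auto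
      then show ?thesis by simp
    qed
  qed (use h in \<open>auto simp: indicator_def\<close>)
  then show ?thesis using main by (intro LIMSEQ_le_const) auto
qed

text \<open>One half of the ergodic theorem, as a linear bound. The set where the sums of
  \<open>g - d\<close> are unbounded above is invariant; if it had full measure, the maximal
  inequality would contradict the negative mean of \<open>g - d\<close>.\<close>

lemma birkhoff_upper:
  fixes g :: "'a \<Rightarrow> real"
  assumes g: "integrable M g" and less: "(\<integral>x. g x \<partial>M) < d"
  shows "AE x in M. \<exists>C. \<forall>n. (\<Sum>j<n. g ((T ^^ j) x)) \<le> d * n + C"
proof -
  define h where "h x = g x - d" for x
  have hi: "integrable M h" unfolding h_def using g by simp
  have hneg: "(\<integral>x. h x \<partial>M) < 0" unfolding h_def using g less by (simp add: prob_space)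
  have [measurable]: "h \<in> borel_measurable M" using hi by simp
  define S where "S n x = (\<Sum>j<n. h ((T ^^ j) x))" for n x
  have [measurable]: "S n \<in> borel_measurable M" for n unfolding S_def by measurable
  define E where "E = {x \<in> space M. \<forall>k::nat. \<exists>n. S n x > k}"
  have Es [measurable]: "E \<in> sets M" unfolding E_def by measurable
  have SS: "S (Suc n) x = h x + S n (T x)" for n x
    unfolding S_def sum.lessThan_Suc_shift by (simp add: funpow_swap1)
  have "T x \<in> E \<longleftrightarrow> x \<in> E" if x: "x \<in> space M" for x
  proof
    assume e: "T x \<in> E"
    have "\<exists>n. S n x > k" for k :: nat
    proof -
      obtain l :: nat where l: "real l \<ge> k - h x" using real_arch_simple by blast
      obtain n where "S n (T x) > l" using e by (auto simp: E_def)
      then have "S (Suc n) x > k" using l by (simp add: SS)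
      then show ?thesis ..
    qed
    then show "x \<in> E" using x by (simp add: E_def)
  next
    assume e: "x \<in> E"
    have "\<exists>n. S n (T x) > k" for k :: nat
    proof -
      obtain l :: nat where l: "real l \<ge> k + h x" using real_arch_simple by blast
      obtain n where n: "S n x > l" using e by (auto simp: E_def)
      then have "n \<noteq> 0" by (cases n) (auto simp: S_def)
      then obtain m where "n = Suc m" by (cases n) auto
      then have "S m (T x) > k" using l n by (simp add: SS)
      then show ?thesis ..
    qed
    then show "T x \<in> E" using x by (simp add: E_def)
  qed
  then have "T -` E \<inter> space M = E" by (auto simp: E_def)
  then have "measure M E = 0 \<or> measure M E = 1" using erg Es by (simp add: ergodic_def)
  moreover have "measure M E \<noteq> 1"
  proof
    assume "measure M E = 1"
    then have "AE x in M. x \<in> E" using prob_eq_1[OF Es] by simp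
    then have "AE x in M. \<exists>n. (\<Sum>j<n. h ((T ^^ j) x)) > 0"
    proof eventually_elim
      case (elim x)
      then have "\<exists>n. S n x > real 0" unfolding E_def by blast
      then show ?case by (simp add: S_def)
    qed
    from maximal_ergodic[OF hi this] show False using hneg by simp
  qed
  ultimately have "AE x in M. x \<notin> E" by (simp add: prob_eq_0)
  then show ?thesis using AE_space
  proof eventually_elim
    case (elim x)
    then obtain k :: nat where k: "\<And>n. S n x \<le> k" by (auto simp: E_def not_less)
    have "S n x = (\<Sum>j<n. g ((T ^^ j) x)) - d * n" for n
      by (simp add: S_def h_def sum_subtractf)
    then show ?case using k by (intro exI[of _ "real k"]) (smt (verit))
  qed
qed

end

section \<open>The space of bounded cocycles and the residual set\<close>

lemma borel_measurable_matmul [measurable]: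
  fixes f g :: "'b \<Rightarrow> mat2"
  assumes "f \<in> borel_measurable M" "g \<in> borel_measurable M"
  shows "(\<lambda>x. f x ** g x) \<in> borel_measurable M"
proof (rule borel_measurable_continuous_Pair[OF assms])
  show "continuous_on UNIV (\<lambda>x. fst x ** snd x :: mat2)"
    unfolding matrix_matrix_mult_def by (intro continuous_intros)
qed

lemma borel_measurable_matvec [measurable]:
  fixes f :: "'b \<Rightarrow> mat2"
  assumes "f \<in> borel_measurable M"
  shows "(\<lambda>x. f x *v v) \<in> borel_measurable M"
proof -
  have "continuous_on UNIV (\<lambda>X::mat2. X *v v)"
    unfolding matrix_vector_mult_def by (intro continuous_intros)
  from borel_measurable_continuous_on[OF this assms] show ?thesis by simp
qed

lemma mnorm_le_norm: "mnorm A \<le> 4 * norm A"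
proof -
  have "\<bar>A$i$j\<bar> \<le> norm A" for i j
    using component_le_norm_cart[of "A$i" j] Finite_Cartesian_Product.norm_nth_le[of A i] by linarith
  from onorm_le_matrix_component[of A, OF this] show ?thesis by (simp add: mnorm_def)
qed

lemma borel_measurable_mnorm [measurable]: "mnorm \<in> borel_measurable borel"
proof -
  have "4-lipschitz_on UNIV mnorm"
  proof (rule lipschitz_onI)
    fix A B :: mat2
    show "dist (mnorm A) (mnorm B) \<le> 4 * dist A B"
      using mnorm_diff_abs[of A B] mnorm_le_norm[of "A - B"] by (simp add: dist_norm)
  qed simp
  then show ?thesis by (intro borel_measurable_continuous_onI lipschitz_on_continuous_on)
qed

lemma borel_measurable_area [measurable]:
  fixes f :: "'b \<Rightarrow> real^2"
  assumes "f \<in> borel_measurable M"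
  shows "(\<lambda>x. area (f x) v) \<in> borel_measurable M"
proof -
  have "continuous_on UNIV (\<lambda>x. area x v)" unfolding area_def by (intro continuous_intros)
  from borel_measurable_continuous_on[OF this assms] show ?thesis by simp
qed

text \<open>The logarithm has slope at most 1 from 1 on, which is where determinant one keeps the
  norm.\<close>

lemma ln_mnorm_diff:
  assumes "det A = 1" "det B = 1"
  shows "ln (mnorm B) \<le> ln (mnorm A) + mnorm (A - B)"
proof -
  have a: "1 \<le> mnorm A" and b: "1 \<le> mnorm B" using assms mnorm_ge_1 by auto
  have "ln (mnorm B) - ln (mnorm A) \<le> (mnorm B - mnorm A) / mnorm A"
    using a b by (intro ln_diff_le) auto
  also have "\<dots> \<le> mnorm (A - B) / mnorm A"
    using mnorm_diff_abs[of A B] a by (intro divide_right_mono) auto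
  also have "\<dots> \<le> mnorm (A - B) / 1" using a by (intro divide_left_mono) auto
  finally show ?thesis by simp
qed

section \<open>The essential supremum distance\<close>

context prob_space begin

text \<open>\<open>real_of_ereal\<close> sends infinite values to 0, so the essential supremum must
  be shown finite before its real value bounds anything.\<close>

lemma linf_dist_AE:
  assumes "A \<in> Linf_SL2 M" "B \<in> Linf_SL2 M"
  shows "AE x in M. mnorm (A x - B x) \<le> linf_dist M A B"
proof -
  have [measurable]: "A \<in> borel_measurable M" "B \<in> borel_measurable M"
    using assms by (auto simp: Linf_SL2_def)
  obtain C D where C: "AE x in M. mnorm (A x) \<le> C" and D: "AE x in M. mnorm (B x) \<le> D"
    using assms by (auto simp: Linf_SL2_def)
  let ?f = "\<lambda>x. ereal (mnorm (A x - B x))"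
  have ub: "esssup M ?f \<le> ereal (C + D)"
  proof (rule esssup_I)
    show "AE x in M. ?f x \<le> ereal (C + D)" using C D
    proof eventually_elim
      case (elim x)
      have "mnorm (- B x) \<le> mnorm (B x)"
        by (rule mnorm_leI) (metis add_diff_cancel_left' diff_0 matrix_vector_mult_diff_rdistrib
            matrix_vector_mult_0 norm_le_mnorm norm_minus_cancel)
      then show ?case using mnorm_add[of "A x" "- B x"] elim by simp
    qed
  qed measurable
  have ae: "AE x in M. ?f x \<le> esssup M ?f" by (rule esssup_AE)
  have "AE x in M. 0 \<le> esssup M ?f" using ae
  proof eventually_elim
    case (elim x)
    have "0 \<le> ereal (mnorm (A x - B x))" by simp
    then show ?case using elim by (rule order_trans)
  qed
  then have "0 \<le> esssup M ?f" by (simp add: AE_const)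
  then obtain r where "esssup M ?f = ereal r" using ub by (cases "esssup M ?f") auto
  then show ?thesis using ae by (simp add: linf_dist_def)
qed

lemma linf_dist_le:
  assumes "A \<in> Linf_SL2 M" "B \<in> Linf_SL2 M" "AE x in M. mnorm (A x - B x) \<le> c"
  shows "linf_dist M A B \<le> c"
proof -
  have [measurable]: "A \<in> borel_measurable M" "B \<in> borel_measurable M"
    using assms by (auto simp: Linf_SL2_def)
  have ub: "esssup M (\<lambda>x. ereal (mnorm (A x - B x))) \<le> ereal c"
    by (rule esssup_I) (use assms(3) in auto)
  have "AE x in M. 0 \<le> c" using assms(3) by eventually_elim (use mnorm_nonneg order_trans in blast)
  then have "c \<ge> 0" by (simp add: AE_const)
  then show ?thesis using ub unfolding linf_dist_def
    by (cases "esssup M (\<lambda>x. ereal (mnorm (A x - B x)))") auto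
qed

lemma linf_dist_triangle:
  assumes "A \<in> Linf_SL2 M" "B \<in> Linf_SL2 M" "D \<in> Linf_SL2 M"
  shows "linf_dist M A D \<le> linf_dist M A B + linf_dist M B D"
proof (rule linf_dist_le[OF assms(1,3)])
  show "AE x in M. mnorm (A x - D x) \<le> linf_dist M A B + linf_dist M B D"
    using linf_dist_AE[OF assms(1,2)] linf_dist_AE[OF assms(2,3)]
  proof eventually_elim
    case (elim x)
    then show ?case using mnorm_add[of "A x - B x" "B x - D x"] by simp
  qed
qed

lemma linf_dist_self: "A \<in> Linf_SL2 M \<Longrightarrow> linf_dist M A A \<le> 0"
proof (rule linf_dist_le)
  have "mnorm (0::mat2) \<le> 0" by (rule mnorm_leI) simp
  then show "AE x in M. mnorm (A x - A x) \<le> 0" by simp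
qed

end

context ergodic_automorphism begin

section \<open>Mean logarithmic growth\<close>

lemma LinfD:
  assumes "A \<in> Linf_SL2 M"
  shows "A \<in> borel_measurable M" "\<And>x. x \<in> space M \<Longrightarrow> det (A x) = 1"
    "\<exists>K\<ge>1. AE x in M. mnorm (A x) \<le> K"
proof -
  show "A \<in> borel_measurable M" "\<And>x. x \<in> space M \<Longrightarrow> det (A x) = 1"
    using assms by (auto simp: Linf_SL2_def)
  obtain C where "AE x in M. mnorm (A x) \<le> C" using assms by (auto simp: Linf_SL2_def)
  then have "AE x in M. mnorm (A x) \<le> max 1 C" by eventually_elim simp
  then show "\<exists>K\<ge>1. AE x in M. mnorm (A x) \<le> K" by (intro exI[of _ "max 1 C"]) simp
qed

lemma cocycle_measurable:
  "A \<in> Linf_SL2 M \<Longrightarrow> cocycle_fwd T A n \<in> borel_measurable M"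
proof (induction n)
  case (Suc n)
  have [measurable]: "A \<in> borel_measurable M" "cocycle_fwd T A n \<in> borel_measurable M"
    using Suc LinfD by auto
  have eq: "cocycle_fwd T A (Suc n) = (\<lambda>x. A ((T ^^ n) x) ** cocycle_fwd T A n x)" by (rule ext) simp
  show ?case unfolding eq by measurable
next
  case 0
  have "cocycle_fwd T A 0 = (\<lambda>x. mat 1)" by (rule ext) simp
  then show ?case by simp
qed

lemma pert_measurable:
  assumes "A \<in> Linf_SL2 M"
  shows "(\<lambda>x. pert T A P n x) \<in> borel_measurable M"
proof (induction n)
  case (Suc n)
  note [measurable] = Suc LinfD(1)[OF assms]
  show ?case by simp
qed simp

lemma cocycle_det: "A \<in> Linf_SL2 M \<Longrightarrow> x \<in> space M \<Longrightarrow> det (cocycle_fwd T A n x) = 1"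
  by (intro det_cocycle LinfD) auto

lemma cocycle_mnorm_le:
  assumes "\<And>i. mnorm (A ((T ^^ i) x)) \<le> K"
  shows "mnorm (cocycle_fwd T A n x) \<le> K ^ n"
proof (induction n)
  case (Suc n)
  have "mnorm (cocycle_fwd T A (Suc n) x) \<le> mnorm (A ((T ^^ n) x)) * mnorm (cocycle_fwd T A n x)"
    using mnorm_mult by simp
  also have "\<dots> \<le> K * K ^ n" using assms[of n] Suc order_trans[OF mnorm_nonneg assms[of n]]
    by (intro mult_mono) auto
  finally show ?case by simp
qed simp

definition log_norm :: "('a \<Rightarrow> mat2) \<Rightarrow> nat \<Rightarrow> 'a \<Rightarrow> real" where
  "log_norm A n x = ln (mnorm (cocycle_fwd T A n x))"

lemma log_norm_measurable [measurable]: "A \<in> Linf_SL2 M \<Longrightarrow> log_norm A n \<in> borel_measurable M"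
  unfolding log_norm_def using cocycle_measurable[of A n] by measurable

lemma log_norm_nonneg: "A \<in> Linf_SL2 M \<Longrightarrow> x \<in> space M \<Longrightarrow> 0 \<le> log_norm A n x"
  unfolding log_norm_def using mnorm_ge_1[OF cocycle_det[of A x n]] by simp

lemma log_norm_le:
  assumes "A \<in> Linf_SL2 M" "x \<in> space M" "\<And>i. mnorm (A ((T ^^ i) x)) \<le> K" "K \<ge> 1"
  shows "log_norm A n x \<le> n * ln K"
proof -
  have "1 \<le> mnorm (cocycle_fwd T A n x)" by (rule mnorm_ge_1[OF cocycle_det[OF assms(1,2)]])
  then have "log_norm A n x \<le> ln (K ^ n)"
    unfolding log_norm_def using cocycle_mnorm_le[of A x K n] assms(3,4) by (intro ln_mono) auto
  then show ?thesis using assms(4) by (simp add: ln_realpow)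
qed

lemma log_norm_subadd:
  assumes A: "A \<in> Linf_SL2 M" and x: "x \<in> space M"
  shows "log_norm A (n + k) x \<le> log_norm A n ((T ^^ k) x) + log_norm A k x"
proof -
  have 1: "1 \<le> mnorm (cocycle_fwd T A (n + k) x)" "1 \<le> mnorm (cocycle_fwd T A n ((T ^^ k) x))"
      "1 \<le> mnorm (cocycle_fwd T A k x)"
    using mnorm_ge_1[OF cocycle_det[OF A]] x by auto
  have "log_norm A (n + k) x \<le> ln (mnorm (cocycle_fwd T A n ((T ^^ k) x)) * mnorm (cocycle_fwd T A k x))"
    unfolding log_norm_def using 1 mnorm_mult by (intro ln_mono) (auto simp: cocycle_add)
  then show ?thesis unfolding log_norm_def using 1 by (simp add: ln_mult)
qed

lemma log_norm_integrable: assumes A: "A \<in> Linf_SL2 M" shows "integrable M (log_norm A n)"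
proof -
  obtain K where K: "K \<ge> 1" "AE x in M. mnorm (A x) \<le> K" using LinfD(3)[OF A] by blast
  have "AE x in M. norm (log_norm A n x) \<le> n * ln K"
    using AE_Tn[OF K(2)] AE_space
  proof eventually_elim
    case (elim x)
    then show ?case using log_norm_le[OF A elim(2) _ K(1), of n] log_norm_nonneg[OF A elim(2), of n] by simp
  qed
  then show ?thesis using A by (intro integrable_const_bound) auto
qed

text \<open>By subadditivity the infimum of the means over \<open>n\<close> is their limit, so this
  is the set of cocycles with integrated exponent below \<open>d\<close>. A single witness
  \<open>n\<close> makes membership a condition on finitely many matrices along each orbit, hence
  stable under small perturbations.\<close>

definition small_LE :: "real \<Rightarrow> ('a \<Rightarrow> mat2) set" where
  "small_LE d = {A \<in> Linf_SL2 M. \<exists>n\<ge>1. (\<integral>x. log_norm A n x \<partial>M) < n * d}"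

lemma small_LE_open: "open_in_Linf M (small_LE d)"
  unfolding open_in_Linf_def
proof (intro conjI ballI)
  show "small_LE d \<subseteq> Linf_SL2 M" by (auto simp: small_LE_def)
  fix A assume "A \<in> small_LE d"
  then obtain n where A: "A \<in> Linf_SL2 M" and n: "n \<ge> 1" "(\<integral>x. log_norm A n x \<partial>M) < n * d"
    by (auto simp: small_LE_def)
  obtain K where K: "K \<ge> 1" "AE x in M. mnorm (A x) \<le> K" using LinfD(3)[OF A] by blast
  \<comment> \<open>\<open>c\<close> is a Lipschitz constant for the \<open>n\<close>-step product
    near \<open>A\<close>; the cap 1 in \<open>e\<close> keeps the perturbed matrices below
    \<open>K + 1\<close>, where this constant is valid.\<close>
  define c where "c = n * (K + 1) ^ n"
  have c: "c > 0" using n K by (simp add: c_def)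
  define e where "e = min 1 ((n * d - (\<integral>x. log_norm A n x \<partial>M)) / c)"
  have e: "e > 0" using n c by (simp add: e_def)
  show "\<exists>e>0. \<forall>B\<in>Linf_SL2 M. linf_dist M A B < e \<longrightarrow> B \<in> small_LE d"
  proof (intro exI conjI ballI impI)
    show "e > 0" by (rule e)
    fix B assume B: "B \<in> Linf_SL2 M" and dAB: "linf_dist M A B < e"
    define r where "r = linf_dist M A B"
    have "AE x in M. mnorm (A x) \<le> K \<and> mnorm (A x - B x) \<le> r"
      using K(2) linf_dist_AE[OF A B] by (auto simp: r_def)
    from AE_Tn[OF this] have "AE x in M. log_norm B n x \<le> log_norm A n x + c * r"
      using AE_space
    proof eventually_elim
      case (elim x)
      then have a: "\<And>i. mnorm (A ((T ^^ i) x)) \<le> K" and ab: "\<And>i. mnorm (A ((T ^^ i) x) - B ((T ^^ i) x)) \<le> r" by auto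
      have r0: "r \<ge> 0" using ab[of 0] mnorm_nonneg order_trans by blast
      have b: "mnorm (B ((T ^^ i) x)) \<le> K + 1" for i
        using a[of i] ab[of i] mnorm_diff_abs[of "A ((T ^^ i) x)" "B ((T ^^ i) x)"] dAB unfolding r_def e_def by linarith
      have "mnorm (cocycle_fwd T A k x - cocycle_fwd T B k x) \<le> k * (K + 1) ^ k * r" for k
      proof (induction k)
        case 0
        have "mnorm (0::mat2) \<le> 0" by (rule mnorm_leI) simp
        then show ?case by simp
      next
        case (Suc k)
        let ?A = "A ((T ^^ k) x)" and ?B = "B ((T ^^ k) x)"
        let ?P = "cocycle_fwd T A k x" and ?Q = "cocycle_fwd T B k x"
        have "?A ** ?P - ?B ** ?Q = ?A ** (?P - ?Q) + (?A - ?B) ** ?Q"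
          by (simp add: vec_eq_iff matrix_matrix_mult_def sum_2 algebra_simps)
        then have "mnorm (cocycle_fwd T A (Suc k) x - cocycle_fwd T B (Suc k) x)
            \<le> mnorm (?A ** (?P - ?Q)) + mnorm ((?A - ?B) ** ?Q)"
          using mnorm_add by simp
        also have "\<dots> \<le> mnorm ?A * mnorm (?P - ?Q) + mnorm (?A - ?B) * mnorm ?Q"
          by (intro add_mono mnorm_mult)
        also have "\<dots> \<le> (K + 1) * (k * (K + 1) ^ k * r) + r * (K + 1) ^ k"
          using a[of k] ab[of k] Suc cocycle_mnorm_le[of B x "K + 1" k] b K(1) r0
          by (intro add_mono mult_mono) auto
        also have "\<dots> \<le> (K + 1) * (k * (K + 1) ^ k * r) + r * (K + 1) ^ (Suc k)"
          using K(1) r0 by (intro add_mono mult_left_mono power_increasing) auto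
        also have "\<dots> = Suc k * (K + 1) ^ Suc k * r" by (simp add: algebra_simps)
        finally show ?case .
      qed
      from this[of n] show ?case
        unfolding log_norm_def c_def
        using ln_mnorm_diff[OF cocycle_det[OF A elim(2)] cocycle_det[OF B elim(2)], of n n] by linarith
    qed
    then have "(\<integral>x. log_norm B n x \<partial>M) \<le> (\<integral>x. log_norm A n x + c * r \<partial>M)"
      using log_norm_integrable[OF A] log_norm_integrable[OF B] by (intro integral_mono_AE) auto
    also have "\<dots> = (\<integral>x. log_norm A n x \<partial>M) + c * r"
      using log_norm_integrable[OF A] by (simp add: prob_space)
    also have "\<dots> < n * d"
    proof -
      have "r < (n * d - (\<integral>x. log_norm A n x \<partial>M)) / c" using dAB by (simp add: r_def e_def)
      then show ?thesis using c by (simp add: pos_less_divide_eq algebra_simps)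
    qed
    finally show "B \<in> small_LE d" using B n by (auto simp: small_LE_def)
  qed
qed

text \<open>The sum \<open>H n\<close> of \<open>m\<close> consecutive values telescopes: by
  subadditivity it grows at step \<open>n\<close> by at most
  \<open>log_norm A m ((T ^^ n) x)\<close>. Growth is thus controlled by Birkhoff sums over
  \<open>T\<close> itself rather than over its \<open>m\<close>-th power, which may fail to be
  ergodic.\<close>

lemma small_LE_all_imp_zero:
  assumes A: "A \<in> Linf_SL2 M" and small: "\<And>d. d > 0 \<Longrightarrow> A \<in> small_LE d"
  shows "LE M T A = 0"
proof -
  obtain K where K: "K \<ge> 1" "AE x in M. mnorm (A x) \<le> K" using LinfD(3)[OF A] by blast
  have bound: "AE x in M. \<exists>C. \<forall>n. log_norm A n x \<le> d * n + C" if d: "d > 0" for d :: real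
  proof -
    obtain m where m: "m \<ge> 1" "(\<integral>x. log_norm A m x \<partial>M) < m * d"
      using small[OF d] by (auto simp: small_LE_def)
    show ?thesis
      using birkhoff_upper[OF log_norm_integrable[OF A] m(2)] AE_Tn[OF K(2)] AE_space
    proof eventually_elim
      case (elim x)
      then obtain C where C: "\<And>n. (\<Sum>j<n. log_norm A m ((T ^^ j) x)) \<le> m * d * n + C" by blast
      define H where "H n = (\<Sum>i<m. log_norm A (n + i) x)" for n
      have H: "H n \<le> H 0 + (\<Sum>j<n. log_norm A m ((T ^^ j) x))" for n
      proof (induction n)
        case (Suc n)
        have "H (Suc n) + log_norm A n x = (\<Sum>i<Suc m. log_norm A (n + i) x)"
          unfolding H_def sum.lessThan_Suc_shift by simp
        also have "\<dots> = H n + log_norm A (n + m) x" by (simp add: H_def)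
        finally have "H (Suc n) = H n + log_norm A (m + n) x - log_norm A n x" by (simp add: add.commute)
        also have "\<dots> \<le> H n + log_norm A m ((T ^^ n) x)" using log_norm_subadd[OF A elim(3), of m n] by simp
        finally show ?case using Suc by simp
      qed simp
      \<comment> \<open>Undoing fewer than \<open>m\<close> steps costs a bounded factor, because
        inversion does not increase the norm. Hence a single value is controlled by the mean over
        its window.\<close>
      have low: "log_norm A n x \<le> log_norm A (n + i) x + m * ln K" if "i < m" for n i
      proof -
        let ?X = "cocycle_fwd T A i ((T ^^ n) x)" and ?Y = "cocycle_fwd T A n x"
        have dX: "det ?X = 1" using elim(3) cocycle_det[OF A] by simp
        have dY: "det ?Y = 1" using elim(3) cocycle_det[OF A] by simp
        have y: "1 \<le> mnorm ?Y" by (rule mnorm_ge_1[OF dY])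
        have xp: "1 \<le> mnorm ?X" by (rule mnorm_ge_1[OF dX])
        have xy: "1 \<le> mnorm (?X ** ?Y)" by (rule mnorm_ge_1) (simp add: det_mul dX dY)
        have "mnorm ?Y \<le> mnorm ?X * mnorm (?X ** ?Y)"
        proof (rule mnorm_leI)
          fix v
          have "norm (?Y *v v) \<le> mnorm ?X * norm (?X *v (?Y *v v))" by (rule norm_le_mnorm_inverse[OF dX])
          also have "\<dots> \<le> mnorm ?X * (mnorm (?X ** ?Y) * norm v)"
            by (intro mult_left_mono) (simp_all add: matrix_vector_mul_assoc norm_le_mnorm)
          finally show "norm (?Y *v v) \<le> mnorm ?X * mnorm (?X ** ?Y) * norm v" by simp
        qed
        then have "ln (mnorm ?Y) \<le> ln (mnorm ?X * mnorm (?X ** ?Y))" using y xy xp by (intro ln_mono) (auto intro: mult_pos_pos)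
        also have "\<dots> = ln (mnorm ?X) + ln (mnorm (?X ** ?Y))" using xp xy by (simp add: ln_mult)
        finally have 1: "log_norm A n x \<le> log_norm A i ((T ^^ n) x) + log_norm A (n + i) x"
          by (simp add: log_norm_def add.commute[of n i] cocycle_add)
        have "log_norm A i ((T ^^ n) x) \<le> i * ln K"
        proof (rule log_norm_le[OF A _ _ K(1)])
          show "mnorm (A ((T ^^ j) ((T ^^ n) x))) \<le> K" for j
            using elim(2) by (metis funpow_add o_apply)
        qed (use elim(3) in simp)
        also have "\<dots> \<le> m * ln K" using that K(1) by (intro mult_right_mono) auto
        finally show ?thesis using 1 by simp
      qed
      have "log_norm A n x \<le> d * n + (H 0 + C + m * (m * ln K)) / m" for n
      proof -
        have "m * log_norm A n x = (\<Sum>i<m. log_norm A n x)" by simp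
        also have "\<dots> \<le> (\<Sum>i<m. log_norm A (n + i) x + m * ln K)" using low by (intro sum_mono) auto
        also have "\<dots> = H n + m * (m * ln K)" by (simp add: H_def sum.distrib)
        also have "\<dots> \<le> H 0 + (m * d * n + C) + m * (m * ln K)" using H[of n] C[of n] by linarith
        finally show ?thesis using m(1) by (simp add: field_simps)
      qed
      then show ?case by blast
    qed
  qed
  \<comment> \<open>Countably many rates, so that one null set serves them all.\<close>
  have "AE x in M. \<forall>k::nat. \<exists>C. \<forall>n. log_norm A n x \<le> 1 / Suc k * n + C"
    unfolding AE_all_countable by (intro allI bound) simp
  then have "AE x in M. lyap_top T A x = 0" using AE_space
  proof eventually_elim
    case (elim x)
    have "(\<lambda>n. log_norm A n x / n) \<longlonglongrightarrow> 0"
    proof (rule LIMSEQ_I)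
      fix r :: real assume r: "r > 0"
      obtain k where k: "1 / Suc k < r / 2" using nat_approx_posE[of "r / 2"] r by auto
      obtain C where C: "\<And>n. log_norm A n x \<le> 1 / Suc k * n + C" using elim(1) by blast
      obtain N :: nat where N: "real N > \<bar>C\<bar> * 2 / r" using reals_Archimedean2 by blast
      show "\<exists>no. \<forall>n\<ge>no. norm (log_norm A n x / real n - 0) < r"
      proof (intro exI allI impI)
        fix n assume n: "n \<ge> Suc N"
        then have n0: "real n > 0" by simp
        have "real n > \<bar>C\<bar> * 2 / r" using N n by simp
        then have c: "\<bar>C\<bar> < r / 2 * n" using r by (simp add: field_simps)
        have "log_norm A n x \<le> 1 / Suc k * n + C" by (rule C)
        also have "\<dots> < r / 2 * n + r / 2 * n"
          using c mult_strict_right_mono[OF k n0] by linarith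
        finally have "log_norm A n x < r * n" by simp
        then show "norm (log_norm A n x / real n - 0) < r"
          using n0 log_norm_nonneg[OF A elim(2), of n] by (simp add: pos_divide_less_eq)
      qed
    qed
    then show ?case unfolding lyap_top_def log_norm_def by (rule limI)
  qed
  then show ?thesis unfolding LE_def by (rule integral_eq_zero_AE)
qed

section \<open>The residual set\<close>

lemma residual_dichotomy:
  "\<exists>R. residual_in_Linf M R \<and> (\<forall>A\<in>R. A \<in> Linf_SL2 M \<and> (LE M T A = 0 \<or>
      (\<exists>d>0. \<exists>e>0. \<forall>B\<in>Linf_SL2 M. linf_dist M A B < e \<longrightarrow> B \<notin> small_LE d)))"
proof -
  define V where "V k = small_LE (1 / Suc k)" for k :: nat
  define X where "X k = {A \<in> Linf_SL2 M. \<exists>e>0. \<forall>B\<in>Linf_SL2 M. linf_dist M A B < e \<longrightarrow> B \<notin> V k}" for k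
  have XO: "open_in_Linf M (X k)" for k
    unfolding open_in_Linf_def
  proof (intro conjI ballI)
    show "X k \<subseteq> Linf_SL2 M" by (auto simp: X_def)
    fix A assume "A \<in> X k"
    then obtain e where A: "A \<in> Linf_SL2 M" and e: "e > 0" "\<forall>B\<in>Linf_SL2 M. linf_dist M A B < e \<longrightarrow> B \<notin> V k"
      by (auto simp: X_def)
    have "B \<in> X k" if B: "B \<in> Linf_SL2 M" "linf_dist M A B < e / 2" for B
    proof -
      have "D \<notin> V k" if "D \<in> Linf_SL2 M" "linf_dist M B D < e / 2" for D
        using e(2) linf_dist_triangle[OF A B(1) that(1)] B(2) that by auto
      then show ?thesis using B(1) e(1) by (auto simp: X_def intro!: exI[of _ "e / 2"])
    qed
    then show "\<exists>e>0. \<forall>B\<in>Linf_SL2 M. linf_dist M A B < e \<longrightarrow> B \<in> X k"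
      using e(1) by (intro exI[of _ "e / 2"]) auto
  qed
  have VO: "open_in_Linf M (V k)" for k unfolding V_def by (rule small_LE_open)
  have UO: "open_in_Linf M (V k \<union> X k)" for k
    using VO[of k] XO[of k] unfolding open_in_Linf_def by (metis Un_iff Un_subset_iff)
  have UD: "dense_in_Linf M (V k \<union> X k)" for k
    unfolding dense_in_Linf_def
  proof (intro conjI ballI allI impI)
    show "V k \<union> X k \<subseteq> Linf_SL2 M" using UO[of k] by (simp add: open_in_Linf_def)
    fix A and e :: real assume A: "A \<in> Linf_SL2 M" and e: "e > 0"
    show "\<exists>B\<in>V k \<union> X k. linf_dist M A B < e"
    proof (cases "\<exists>B\<in>V k. linf_dist M A B < e")
      case False
      then have "A \<in> X k" using A e by (auto simp: X_def)
      then show ?thesis using linf_dist_self[OF A] e by (intro bexI[of _ A]) auto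
    qed blast
  qed
  define R where "R = (\<Inter>k. V k \<union> X k)"
  have RL: "R \<subseteq> Linf_SL2 M" using UO[of 0] by (auto simp: R_def open_in_Linf_def)
  have "residual_in_Linf M R" unfolding residual_in_Linf_def
    using RL UO UD by (auto simp: R_def intro!: exI[of _ "\<lambda>k. V k \<union> X k"])
  moreover have "LE M T A = 0 \<or> (\<exists>d>0. \<exists>e>0. \<forall>B\<in>Linf_SL2 M. linf_dist M A B < e \<longrightarrow> B \<notin> small_LE d)"
    if A: "A \<in> R" for A
  proof (cases "\<forall>k. A \<in> V k")
    case True
    have "A \<in> small_LE d" if d: "d > 0" for d
    proof -
      obtain k where k: "1 / Suc k < d" using nat_approx_posE[OF d] by auto
      from True obtain n where n: "n \<ge> 1" "(\<integral>x. log_norm A n x \<partial>M) < n * (1 / Suc k)" "A \<in> Linf_SL2 M"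
        by (auto simp: V_def small_LE_def)
      have "n * (1 / Suc k) \<le> n * d" using k by (intro mult_left_mono) auto
      then show ?thesis using n by (auto simp: small_LE_def intro!: exI[of _ n])
    qed
    then show ?thesis using small_LE_all_imp_zero A RL by blast
  next
    case False
    then obtain k where "A \<notin> V k" by blast
    then have "A \<in> X k" using A by (auto simp: R_def)
    then obtain e where "e > 0" "\<forall>B\<in>Linf_SL2 M. linf_dist M A B < e \<longrightarrow> B \<notin> small_LE (1 / Suc k)"
      unfolding X_def V_def by auto
    moreover have "1 / real (Suc k) > 0" by simp
    ultimately show ?thesis by blast
  qed
  ultimately show ?thesis using RL by blast
qed

end

section \<open>Uniform hyperbolicity\<close>

lemma tendsto_matmul:
  fixes f g :: "'b \<Rightarrow> mat2"
  assumes "(f \<longlongrightarrow> a) F" "(g \<longlongrightarrow> b) F"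
  shows "((\<lambda>x. f x ** g x) \<longlongrightarrow> a ** b) F"
  unfolding matrix_matrix_mult_def by (intro tendsto_intros assms)

lemma pert_tendsto:
  assumes "\<And>i. i < m \<Longrightarrow> (\<lambda>j. E j i) \<longlonglongrightarrow> P i"
  shows "(\<lambda>j. pert T A (E j) m x) \<longlonglongrightarrow> pert T A P m x"
  using assms by (induction m) (auto intro!: tendsto_matmul)

text \<open>Countability later makes the choice of a perturbation measurable, as a least index. Only
  finitely many factors are approximated at a time, so finite lists over a countable dense set
  suffice.\<close>

lemma countable_dense_perturbations:
  assumes "\<eta> \<ge> 0"
  obtains e :: "nat \<Rightarrow> nat \<Rightarrow> mat2" where "\<And>q i. e q i \<in> near_id \<eta>"
    and "\<And>P m. (\<And>i. P i \<in> near_id \<eta>) \<Longrightarrow> \<exists>q. \<forall>i<m. (\<lambda>j. e (q j) i) \<longlonglongrightarrow> P i"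
proof -
  obtain D where D: "countable D" "D \<subseteq> near_id \<eta>" "near_id \<eta> \<subseteq> closure D"
    using separable[of "near_id \<eta>"] by blast
  have Dne: "D \<noteq> {}" using D(3) id_near_id[OF assms] by auto
  define d where "d = from_nat_into D"
  have rd: "range d = D" unfolding d_def using Dne D(1) by (rule range_from_nat_into)
  \<comment> \<open>Past the end of the decoded list the default \<open>d 0\<close> keeps the
    sequence inside \<open>near_id \<eta>\<close>.\<close>
  define e where "e q i = d (if i < length (from_nat q :: nat list) then (from_nat q :: nat list) ! i else 0)" for q i
  show ?thesis
  proof
    show "e q i \<in> near_id \<eta>" for q i using rd D(2) by (auto simp: e_def)
    fix P :: "nat \<Rightarrow> mat2" and m
    assume P: "\<And>i. P i \<in> near_id \<eta>"
    have "\<exists>n. dist (d n) (P i) < 1 / Suc j" for i j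
    proof -
      have "P i \<in> closure D" using P D(3) by blast
      then obtain y where "y \<in> D" "dist y (P i) < 1 / Suc j"
        using closure_approachable[of "P i" D] by (metis divide_pos_pos of_nat_0_less_iff zero_less_Suc zero_less_one)
      then show ?thesis using rd by blast
    qed
    then obtain l where l: "\<And>i j. dist (d (l i j)) (P i) < 1 / Suc j" by metis
    define q where "q j = to_nat (map (\<lambda>i. l i j) [0..<m])" for j
    have "(\<lambda>j. e (q j) i) \<longlonglongrightarrow> P i" if "i < m" for i
    proof -
      have "e (q j) i = d (l i j)" for j using that by (simp add: e_def q_def)
      moreover have "(\<lambda>j. d (l i j)) \<longlonglongrightarrow> P i"
      proof (rule metric_LIMSEQ_I)
        fix r :: real assume r: "r > 0"
        obtain N where N: "1 / Suc N < r" using nat_approx_posE[OF r] by auto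
        have "dist (d (l i j)) (P i) < r" if "j \<ge> N" for j
        proof -
          have "1 / Suc j \<le> 1 / Suc N" using that by (simp add: frac_le)
          then show ?thesis using l[of i j] N by linarith
        qed
        then show "\<exists>no. \<forall>n\<ge>no. dist (d (l i n)) (P i) < r" by blast
      qed
      ultimately show ?thesis by simp
    qed
    then show "\<exists>q. \<forall>i<m. (\<lambda>j. e (q j) i) \<longlonglongrightarrow> P i" by blast
  qed
qed

text \<open>Cayley-Hamilton: for determinant one the inverse is linear in the entries, which yields
  measurability of the backward cocycle.\<close>

lemma matrix_inv_2:
  assumes "det (A::mat2) = 1"
  shows "matrix_inv A = (A$1$1 + A$2$2) *\<^sub>R mat 1 - A"
proof -
  let ?B = "(A$1$1 + A$2$2) *\<^sub>R mat 1 - A"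
  have d: "A$1$1 * A$2$2 - A$1$2 * A$2$1 = 1" using assms by (simp add: det_2)
  have "A ** ?B = mat 1"
    using d by (simp add: vec_eq_iff forall_2 matrix_matrix_mult_def sum_2 mat_def algebra_simps)
  then have "matrix_inv A ** (A ** ?B) = matrix_inv A" by simp
  then show ?thesis by (simp add: matrix_mul_assoc matrix_inv_det_1[OF assms])
qed

context ergodic_automorphism begin

section \<open>The backward cocycle\<close>

lemma bwd_eq_fwd: "cocycle_bwd Ti A n x = cocycle_fwd Ti (\<lambda>x. matrix_inv (A (Ti x))) n x"
  by (induction n) auto

lemma bwd_measurable: "A \<in> Linf_SL2 M \<Longrightarrow> cocycle_bwd Ti A n \<in> borel_measurable M"
proof (induction n)
  case 0
  have "cocycle_bwd Ti A 0 = (\<lambda>x. mat 1)" by (rule ext) simp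
  then show ?case by simp
next
  case (Suc n)
  have [measurable]: "A \<in> borel_measurable M" "cocycle_bwd Ti A n \<in> borel_measurable M"
    using Suc LinfD by auto
  have "(\<lambda>x. matrix_inv (A x)) \<in> borel_measurable M \<longleftrightarrow>
        (\<lambda>x. (A x$1$1 + A x$2$2) *\<^sub>R mat 1 - A x) \<in> borel_measurable M"
    using LinfD(2)[OF Suc.prems] by (intro measurable_cong matrix_inv_2)
  moreover have nth: "(\<lambda>x. A x$i$j) \<in> borel_measurable M" for i j
    by (rule borel_measurable_continuous_on[OF _ \<open>A \<in> borel_measurable M\<close>]) (intro continuous_intros)
  then have "(\<lambda>x. (A x$1$1 + A x$2$2) *\<^sub>R mat 1 - A x) \<in> borel_measurable M"
    by (intro borel_measurable_diff borel_measurable_scaleR borel_measurable_add) auto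
  ultimately have im [measurable]: "(\<lambda>x. matrix_inv (A x)) \<in> borel_measurable M" by simp
  have "(\<lambda>x. matrix_inv (A ((Ti ^^ Suc n) x))) \<in> borel_measurable M"
    using measurable_compose[OF Tin_meas im, of "Suc n"] .
  then have "(\<lambda>x. matrix_inv (A ((Ti ^^ Suc n) x)) ** cocycle_bwd Ti A n x) \<in> borel_measurable M"
    by measurable
  moreover have "cocycle_bwd Ti A (Suc n) = (\<lambda>x. matrix_inv (A ((Ti ^^ Suc n) x)) ** cocycle_bwd Ti A n x)"
    by (rule ext) simp
  ultimately show ?case by simp
qed

lemma bwd_det: "A \<in> Linf_SL2 M \<Longrightarrow> x \<in> space M \<Longrightarrow> det (cocycle_bwd Ti A n x) = 1"
  unfolding bwd_eq_fwd using LinfD(2)[of A] by (intro det_cocycle matrix_inv_det_1) simp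

lemma bwd_fwd:
  assumes A: "A \<in> Linf_SL2 M" and y: "y \<in> space M"
  shows "k \<le> m \<Longrightarrow> cocycle_bwd Ti A k ((T ^^ m) y) *v (cocycle_fwd T A m y *v u) = cocycle_fwd T A (m - k) y *v u"
proof (induction k)
  case (Suc k)
  let ?w = "cocycle_fwd T A m y *v u"
  obtain j where j: "m - k = Suc j" "m - Suc k = j" using Suc.prems by (metis Suc_diff_Suc Suc_le_lessD)
  have "cocycle_bwd Ti A (Suc k) ((T ^^ m) y) *v ?w
      = matrix_inv (A ((Ti ^^ Suc k) ((T ^^ m) y))) *v (cocycle_bwd Ti A k ((T ^^ m) y) *v ?w)"
    by (simp only: cocycle_bwd.simps matrix_vector_mul_assoc matrix_mul_assoc)
  also have "(Ti ^^ Suc k) ((T ^^ m) y) = (T ^^ j) y" using Tin_Tn_le[OF y Suc.prems] j by simp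
  also have "cocycle_bwd Ti A k ((T ^^ m) y) *v ?w = A ((T ^^ j) y) *v (cocycle_fwd T A j y *v u)"
    using Suc by (simp add: j matrix_vector_mul_assoc)
  also have "matrix_inv (A ((T ^^ j) y)) *v \<dots> = cocycle_fwd T A j y *v u"
    using LinfD(2)[OF A, of "(T ^^ j) y"] y by (simp add: matrix_vector_mul_assoc matrix_mul_assoc matrix_inv_det_1)
  finally show ?case by (simp only: j)
qed simp

text \<open>The source of the invariance of the field of backward contracted vectors.\<close>

lemma bwd_Suc_T:
  assumes A: "A \<in> Linf_SL2 M" and y: "y \<in> space M"
  shows "cocycle_bwd Ti A (Suc n) (T y) *v (A y *v v) = cocycle_bwd Ti A n y *v v"
proof (induction n)
  case 0
  then show ?case using LinfD(2)[OF A y] y by (simp add: matrix_vector_mul_assoc matrix_inv_det_1)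
next
  case (Suc n)
  have "(Ti ^^ Suc (Suc n)) (T y) = (Ti ^^ Suc n) y"
    using y by (simp only: funpow_Suc_right o_apply Ti_T)
  then have "cocycle_bwd Ti A (Suc (Suc n)) (T y) *v (A y *v v)
    = matrix_inv (A ((Ti ^^ Suc n) y)) *v (cocycle_bwd Ti A (Suc n) (T y) *v (A y *v v))"
    by (simp only: cocycle_bwd.simps(2)[of Ti A "Suc n"] matrix_vector_mul_assoc matrix_mul_assoc)
  also have "\<dots> = cocycle_bwd Ti A (Suc n) y *v v"
    by (simp only: Suc) (simp only: cocycle_bwd.simps(2)[of Ti A n] matrix_vector_mul_assoc)
  finally show ?case .
qed

lemma image_matrix_iff:
  assumes "det (B::mat2) = 1" "\<And>v. v \<in> E \<longleftrightarrow> B *v v \<in> F"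
  shows "(\<lambda>v. B *v v) ` E = F"
proof (intro equalityI subsetI)
  fix w assume w: "w \<in> F"
  have "B *v (matrix_inv B *v w) = w" by (simp add: matrix_vector_mul_assoc matrix_inv_det_1[OF assms(1)])
  then show "w \<in> (\<lambda>v. B *v v) ` E" using w assms(2) by (metis image_eqI)
qed (use assms in auto)

section \<open>Invariant splitting in the absence of alignment\<close>

definition unalignable :: "real \<Rightarrow> ('a \<Rightarrow> mat2) \<Rightarrow> 'a \<Rightarrow> bool" where
  "unalignable \<eta> A x \<longleftrightarrow> (\<forall>m. \<exists>u v. \<forall>P. (\<forall>i. P i \<in> near_id \<eta>) \<longrightarrow> area (pert T A P m x *v u) v \<noteq> 0)"

lemma unalignable_stable_vector:
  assumes A: "A \<in> Linf_SL2 M" and \<eta>: "\<eta> > 0" and x: "x \<in> space M" and ux: "unalignable \<eta> A x"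
  shows "\<exists>z. norm z = 1 \<and> (\<forall>k. norm (cocycle_fwd T A k x *v z) \<le> dom_const \<eta> * dom_rate \<eta> ^ k)"
proof (rule uniform_unit_vector)
  fix m
  obtain u v where uv: "\<And>P. (\<And>i. P i \<in> near_id \<eta>) \<Longrightarrow> area (pert T A P m x *v u) v \<noteq> 0"
    using ux unfolding unalignable_def by blast
  have det: "\<And>i. det (A ((T ^^ i) x)) = 1" using LinfD(2)[OF A] x by simp
  obtain z where z: "z \<noteq> 0" "\<And>i k. i \<le> k \<Longrightarrow> k < m \<Longrightarrow> norm (cocycle_fwd T A k x *v z)
            \<le> dom_const \<eta> * dom_rate \<eta> ^ (k - i) * norm (cocycle_fwd T A i x *v z)"
    using unalignable_imp_domination(2)[OF \<eta> det uv] by blast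
  show "\<exists>z. z \<noteq> 0 \<and> (\<forall>k<m. norm (cocycle_fwd T A k x *v z) \<le> dom_const \<eta> * dom_rate \<eta> ^ k * norm z)"
    using z(1) z(2)[of 0] by (intro exI[of _ z]) simp
qed

text \<open>The vector \<open>u\<close> is found \<open>m\<close> steps in the past and carried
  forward to \<open>x\<close>; its expansion on the way is contraction when seen backwards from
  \<open>x\<close>.\<close>

lemma unalignable_unstable_vector:
  assumes A: "A \<in> Linf_SL2 M" and \<eta>: "\<eta> > 0" and x: "x \<in> space M" and ux: "\<And>n. unalignable \<eta> A ((Ti ^^ n) x)"
  shows "\<exists>p. norm p = 1 \<and> (\<forall>k. norm (cocycle_bwd Ti A k x *v p) \<le> dom_const \<eta> * dom_rate \<eta> ^ k)"
proof (rule uniform_unit_vector)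
  fix m
  define y where "y = (Ti ^^ m) x"
  have y: "y \<in> space M" and Ty: "(T ^^ m) y = x" using x by (simp_all add: y_def)
  \<comment> \<open>The horizon is \<open>Suc m\<close> because domination covers times strictly
    below the horizon and time \<open>m\<close> is used.\<close>
  obtain u v where uv: "\<And>P. (\<And>i. P i \<in> near_id \<eta>) \<Longrightarrow> area (pert T A P (Suc m) y *v u) v \<noteq> 0"
    using ux[of m] unfolding unalignable_def y_def by blast
  have det: "\<And>i. det (A ((T ^^ i) y)) = 1" using LinfD(2)[OF A] y by simp
  have u: "u \<noteq> 0" "\<And>i k. i \<le> k \<Longrightarrow> k < Suc m \<Longrightarrow> norm (cocycle_fwd T A i y *v u)
            \<le> dom_const \<eta> * dom_rate \<eta> ^ (k - i) * norm (cocycle_fwd T A k y *v u)"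
    using unalignable_imp_domination(1)[OF \<eta> det uv] by blast+
  let ?p = "cocycle_fwd T A m y *v u"
  have "norm (cocycle_bwd Ti A k x *v ?p) \<le> dom_const \<eta> * dom_rate \<eta> ^ k * norm ?p" if "k < m" for k
    using u(2)[of "m - k" m] bwd_fwd[OF A y, of k m u] that by (simp add: Ty)
  moreover have "?p \<noteq> 0"
    using norm_le_mnorm_inverse[OF cocycle_det[OF A y], of u m] u(1) by auto
  ultimately show "\<exists>z. z \<noteq> 0 \<and> (\<forall>k<m. norm (cocycle_bwd Ti A k x *v z) \<le> dom_const \<eta> * dom_rate \<eta> ^ k * norm z)"
    by blast
qed

lemma range_scale_subspace: "subspace (range (\<lambda>c. c *\<^sub>R (z::real^2)))"
  by (simp add: subspace_span flip: span_singleton)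

text \<open>By \<open>contracted_line\<close> the distance to the line is a pointwise limit of
  measurable functions. Off \<open>G\<close> the default \<open>{0}\<close> has distance
  \<open>norm v\<close>, so measurability holds on the whole space.\<close>

lemma line_field_measurable:
  fixes N :: "nat \<Rightarrow> 'a \<Rightarrow> mat2"
  assumes [measurable]: "\<And>n. N n \<in> borel_measurable M" and G: "G \<in> sets M"
    and det: "\<And>n x. x \<in> G \<Longrightarrow> det (N n x) = 1"
    and z: "\<And>x. x \<in> G \<Longrightarrow> \<exists>z. norm z = 1 \<and> (\<forall>n. norm (N n x *v z) \<le> C * \<tau> ^ n)"
    and \<tau>: "0 < \<tau>" "\<tau> < 1"
  shows "measurable_subspace_field M (\<lambda>x. if x \<in> G then {v. (\<lambda>n. N n x *v v) \<longlonglongrightarrow> 0} else {0})"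
  unfolding measurable_subspace_field_def
proof
  fix v
  show "(\<lambda>x. infdist v (if x \<in> G then {v. (\<lambda>n. N n x *v v) \<longlonglongrightarrow> 0} else {0})) \<in> borel_measurable M"
  proof (rule borel_measurable_LIMSEQ_real)
    fix x
    show "(\<lambda>n. if x \<in> G then norm (N n x *v v) / mnorm (N n x) else norm v)
      \<longlonglongrightarrow> infdist v (if x \<in> G then {v. (\<lambda>n. N n x *v v) \<longlonglongrightarrow> 0} else {0})"
    proof (cases "x \<in> G")
      case True
      then obtain z where "norm z = 1" "\<And>n. norm (N n x *v z) \<le> C * \<tau> ^ n" using z by blast
      from contracted_line[OF det[OF True] this \<tau>] True show ?thesis by simp
    next
      case False then show ?thesis by (simp add: infdist_singleton)
    qed
  qed (use G in measurable)
qed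

lemma unalignable_imp_uniformly_hyperbolic:
  assumes A: "A \<in> Linf_SL2 M" and \<eta>: "\<eta> > 0" and ae: "AE x in M. unalignable \<eta> A x"
  shows "uniformly_hyperbolic M T A"
proof -
  let ?C = "dom_const \<eta>" and ?r = "dom_rate \<eta>"
  have r: "0 < ?r" "?r < 1" and C: "?C > 0" using dom_rate_bounds dom_const_pos \<eta> by auto
  define good where "good x \<longleftrightarrow> x \<in> space M \<and> (\<forall>n. unalignable \<eta> A ((T ^^ n) x)) \<and> (\<forall>n. unalignable \<eta> A ((Ti ^^ n) x))" for x
  have aeg: "AE x in M. good x"
    using AE_Tn[OF ae] AE_Tin[OF ae] AE_space by eventually_elim (simp add: good_def)
  \<comment> \<open>\<open>unalignable\<close> quantifies over uncountably many perturbations and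
    need not define a measurable set; \<open>G\<close> is a measurable set of full measure inside
    the good points.\<close>
  then obtain N where N: "N \<in> null_sets M" "{x \<in> space M. \<not> good x} \<subseteq> N"
    by (auto elim!: AE_E simp: null_sets_def)
  define G where "G = space M - N"
  have Gs: "G \<in> sets M" using N by (auto simp: G_def)
  have Gg: "good x" if "x \<in> G" for x using that N by (auto simp: G_def)
  have Gsp: "x \<in> space M" if "x \<in> G" for x using that by (auto simp: G_def)
  have aeG: "AE x in M. x \<in> G"
    using AE_not_in[OF N(1)] AE_space by eventually_elim (simp add: G_def)
  define s where "s x = {v. (\<lambda>n. cocycle_fwd T A n x *v v) \<longlonglongrightarrow> 0}" for x
  define u where "u x = {v. (\<lambda>n. cocycle_bwd Ti A n x *v v) \<longlonglongrightarrow> 0}" for x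
  have goodT: "good ((T ^^ n) x)" if "good x" for n x
  proof -
    have "unalignable \<eta> A ((Ti ^^ k) ((T ^^ n) x))" for k
    proof (cases "k \<le> n")
      case True then show ?thesis using that by (simp add: good_def Tin_Tn_le)
    next
      case False
      then obtain j where "k = j + n" by (metis add.commute le_add_diff_inverse nat_le_linear)
      then have "(Ti ^^ k) ((T ^^ n) x) = (Ti ^^ j) x" using that by (simp add: funpow_add good_def)
      then show ?thesis using that by (simp add: good_def)
    qed
    moreover have "unalignable \<eta> A ((T ^^ k) ((T ^^ n) x))" for k
      using that unfolding good_def by (metis funpow_add o_apply)
    ultimately show ?thesis using that by (simp add: good_def)
  qed
  have sv: "\<exists>z. norm z = 1 \<and> (\<forall>k. norm (cocycle_fwd T A k x *v z) \<le> ?C * ?r ^ k)" if "good x" for x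
    using that by (intro unalignable_stable_vector[OF A \<eta>]) (auto simp: good_def dest: spec[of _ 0])
  have uv: "\<exists>z. norm z = 1 \<and> (\<forall>k. norm (cocycle_bwd Ti A k x *v z) \<le> ?C * ?r ^ k)" if "good x" for x
    using that by (intro unalignable_unstable_vector[OF A \<eta>]) (auto simp: good_def)
  have sl: "s x = range (\<lambda>c. c *\<^sub>R z)" if "good x" "norm z = 1" "\<And>k. norm (cocycle_fwd T A k x *v z) \<le> ?C * ?r ^ k" for x z
    unfolding s_def using that r by (intro contracted_line[OF cocycle_det[OF A]]) (auto simp: good_def)
  have ul: "u x = range (\<lambda>c. c *\<^sub>R z)" if "good x" "norm z = 1" "\<And>k. norm (cocycle_bwd Ti A k x *v z) \<le> ?C * ?r ^ k" for x z
    unfolding u_def using that r by (intro contracted_line[OF bwd_det[OF A]]) (auto simp: good_def)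
  have sdec: "norm (cocycle_fwd T A n x *v v) \<le> ?C * ?r ^ n * norm v" if g: "good x" and v: "v \<in> s x" for x n v
  proof -
    obtain z where z: "norm z = 1" "\<And>k. norm (cocycle_fwd T A k x *v z) \<le> ?C * ?r ^ k" using sv[OF g] by blast
    then obtain c where "v = c *\<^sub>R z" using sl[OF g z] v by blast
    then show ?thesis using z mult_left_mono[OF z(2), of "\<bar>c\<bar>" n]
      by (simp add: matrix_vector_mult_scaleR mult.commute)
  qed
  have udec: "norm (cocycle_bwd Ti A n x *v v) \<le> ?C * ?r ^ n * norm v" if g: "good x" and v: "v \<in> u x" for x n v
  proof -
    obtain z where z: "norm z = 1" "\<And>k. norm (cocycle_bwd Ti A k x *v z) \<le> ?C * ?r ^ k" using uv[OF g] by blast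
    then obtain c where "v = c *\<^sub>R z" using ul[OF g z] v by blast
    then show ?thesis using z mult_left_mono[OF z(2), of "\<bar>c\<bar>" n]
      by (simp add: matrix_vector_mult_scaleR mult.commute)
  qed
  have sinv: "v \<in> s x \<longleftrightarrow> A x *v v \<in> s (T x)" for x v
  proof -
    have "cocycle_fwd T A (Suc n) x *v v = cocycle_fwd T A n (T x) *v (A x *v v)" for n
      using cocycle_add[of T A n 1 x] by (simp add: matrix_vector_mul_assoc)
    then have "A x *v v \<in> s (T x) \<longleftrightarrow> (\<lambda>n. cocycle_fwd T A (Suc n) x *v v) \<longlonglongrightarrow> 0"
      unfolding s_def by (simp only: mem_Collect_eq)
    also have "\<dots> \<longleftrightarrow> v \<in> s x" unfolding s_def mem_Collect_eq by (rule filterlim_sequentially_Suc)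
    finally show ?thesis by simp
  qed
  have uinv: "v \<in> u x \<longleftrightarrow> A x *v v \<in> u (T x)" if "x \<in> space M" for x v
  proof -
    have "A x *v v \<in> u (T x) \<longleftrightarrow> (\<lambda>n. cocycle_bwd Ti A (Suc n) (T x) *v (A x *v v)) \<longlonglongrightarrow> 0"
      unfolding u_def mem_Collect_eq by (rule filterlim_sequentially_Suc[symmetric])
    also have "\<dots> \<longleftrightarrow> v \<in> u x" unfolding u_def mem_Collect_eq bwd_Suc_T[OF A that] ..
    finally show ?thesis by simp
  qed
  have uinvn: "v \<in> u x \<Longrightarrow> cocycle_fwd T A n x *v v \<in> u ((T ^^ n) x)" if "x \<in> space M" for x v n
  proof (induction n)
    case (Suc n)
    then have "A ((T ^^ n) x) *v (cocycle_fwd T A n x *v v) \<in> u (T ((T ^^ n) x))"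
      using uinv[of "(T ^^ n) x"] that by simp
    then show ?case by (simp add: matrix_vector_mul_assoc)
  qed simp
  have split: "subspace (u x) \<and> subspace (s x) \<and> u x \<inter> s x = {0} \<and> {a + b | a b. a \<in> u x \<and> b \<in> s x} = UNIV"
    if g: "good x" for x
  proof -
    have x: "x \<in> space M" using g by (simp add: good_def)
    obtain z where z: "norm z = 1" "\<And>k. norm (cocycle_fwd T A k x *v z) \<le> ?C * ?r ^ k" using sv[OF g] by blast
    obtain p where p: "norm p = 1" "\<And>k. norm (cocycle_bwd Ti A k x *v p) \<le> ?C * ?r ^ k" using uv[OF g] by blast
    note sx = sl[OF g z] and ux = ul[OF g p]
    have "area p z \<noteq> 0"
    proof
      assume "area p z = 0"
      then have "z = (p \<bullet> z) *\<^sub>R p" using unit_decomp[OF p(1), of z] by simp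
      then have zu: "z \<in> u x" unfolding ux by blast
      \<comment> \<open>If \<open>z\<close> were also backward contracted, it would shrink on its
        way to time \<open>n\<close> and shrink again on its way back, yet it returns to
        itself.\<close>
      have "1 \<le> (?C * ?r ^ n) * (?C * ?r ^ n)" for n
      proof -
        let ?y = "cocycle_fwd T A n x *v z"
        have "cocycle_bwd Ti A n ((T ^^ n) x) *v ?y = z" using bwd_fwd[OF A x, of n n z] by simp
        then have "1 \<le> ?C * ?r ^ n * norm ?y"
          using udec[OF goodT[OF g, of n] uinvn[OF x zu, of n], of n] z(1) by simp
        also have "\<dots> \<le> (?C * ?r ^ n) * (?C * ?r ^ n)"
          using z(2)[of n] C r by (intro mult_left_mono) auto
        finally show ?thesis .
      qed
      moreover have "(\<lambda>n. (?C * ?r ^ n) * (?C * ?r ^ n)) \<longlonglongrightarrow> (?C * 0) * (?C * 0)"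
        using r by (intro tendsto_mult tendsto_const LIMSEQ_power_zero) auto
      ultimately have "1 \<le> (?C * 0) * (?C * 0)" by (intro LIMSEQ_le_const) auto
      then show False by simp
    qed
    then have d: "area p z \<noteq> 0" .
    have "u x \<inter> s x = {0}"
    proof (intro equalityI subsetI)
      fix v assume "v \<in> u x \<inter> s x"
      then obtain a b where ab: "v = a *\<^sub>R p" "v = b *\<^sub>R z" unfolding ux sx by blast
      have "area v z = 0" using ab(2) by (simp add: area_scale_left)
      then have "a = 0" using ab(1) d by (simp add: area_scale_left)
      then show "v \<in> {0}" using ab by simp
    next
      fix v :: "real^2" assume "v \<in> {0}"
      then show "v \<in> u x \<inter> s x" unfolding ux sx by (auto simp: image_iff intro: exI[of _ 0])
    qed
    moreover have "v \<in> {a + b | a b. a \<in> u x \<and> b \<in> s x}" for v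
    proof -
      \<comment> \<open>Cramer's rule in terms of areas.\<close>
      have "area p z *\<^sub>R v = area v z *\<^sub>R p + area p v *\<^sub>R z"
        by (simp add: vec2_eq_iff area_def algebra_simps)
      then have "v = (1 / area p z) *\<^sub>R (area v z *\<^sub>R p + area p v *\<^sub>R z)"
        using d by (metis divideR_right scaleR_one divide_inverse mult_1 inverse_eq_divide)
      then have "v = (area v z / area p z) *\<^sub>R p + (area p v / area p z) *\<^sub>R z"
        by (simp add: scaleR_add_right)
      then show ?thesis unfolding ux sx by blast
    qed
    ultimately show ?thesis using range_scale_subspace by (auto simp: ux sx)
  qed
  define Eu where "Eu x = (if x \<in> G then u x else {0})" for x
  define Es where "Es x = (if x \<in> G then s x else {0})" for x
  have mu: "measurable_subspace_field M Eu"
    unfolding Eu_def u_def using bwd_measurable[OF A] Gs bwd_det[OF A] Gsp Gg uv r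
    by (intro line_field_measurable[where C="?C" and \<tau>="?r"]) auto
  have ms: "measurable_subspace_field M Es"
    unfolding Es_def s_def using cocycle_measurable[OF A] Gs cocycle_det[OF A] Gsp Gg sv r
    by (intro line_field_measurable[where C="?C" and \<tau>="?r"]) auto
  have 1: "AE x in M. subspace (Eu x) \<and> subspace (Es x) \<and> Eu x \<inter> Es x = {0} \<and>
      {a + b | a b. a \<in> Eu x \<and> b \<in> Es x} = UNIV"
    using aeG by eventually_elim (use split Gg in \<open>simp add: Eu_def Es_def\<close>)
  have 2: "AE x in M. (\<lambda>v. A x *v v) ` Eu x = Eu (T x) \<and> (\<lambda>v. A x *v v) ` Es x = Es (T x)"
    using aeG AE_T[OF aeG]
  proof eventually_elim
    case (elim x)
    have "(\<lambda>v. A x *v v) ` u x = u (T x)" "(\<lambda>v. A x *v v) ` s x = s (T x)"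
      using LinfD(2)[OF A] Gsp[OF elim(1)] uinv sinv by (intro image_matrix_iff; simp)+
    then show ?case using elim by (simp add: Eu_def Es_def)
  qed
  have 3: "AE x in M. \<forall>n. \<forall>v\<in>Es x. norm (cocycle_fwd T A n x *v v) \<le> ?C * ?r ^ n * norm v"
    using aeG by eventually_elim (use sdec Gg in \<open>simp add: Es_def\<close>)
  have 4: "AE x in M. \<forall>n. \<forall>v\<in>Eu x. norm (cocycle_bwd Ti A n x *v v) \<le> ?C * ?r ^ n * norm v"
    using aeG by eventually_elim (use udec Gg in \<open>simp add: Eu_def\<close>)
  show ?thesis unfolding uniformly_hyperbolic_def
    using mu ms C r 1 2 3 4 by blast
qed

end

section \<open>The greedy perturbation\<close>

lemma pert_mnorm_le:
  assumes A: "\<And>i. mnorm (A ((T ^^ i) x)) \<le> K" and P: "\<And>i. P i \<in> near_id \<eta>" and \<eta>: "\<eta> \<le> 1"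
  shows "mnorm (pert T A P m x) \<le> (2 * K) ^ m"
proof (induction m)
  case (Suc m)
  have K: "K \<ge> 0" using order_trans[OF mnorm_nonneg A[of 0]] .
  have "mnorm (A ((T ^^ m) x) ** P m) \<le> mnorm (A ((T ^^ m) x)) * mnorm (P m)" by (rule mnorm_mult)
  also have "\<dots> \<le> K * 2" using A[of m] near_id_mnorm[OF P[of m]] \<eta> K by (intro mult_mono) auto
  finally have 1: "mnorm (A ((T ^^ m) x) ** P m) \<le> 2 * K" by simp
  have "mnorm (pert T A P (Suc m) x) \<le> mnorm (A ((T ^^ m) x) ** P m) * mnorm (pert T A P m x)"
    using mnorm_mult by simp
  also have "\<dots> \<le> (2 * K) * (2 * K) ^ m" using 1 Suc K by (intro mult_mono) auto
  finally show ?case by simp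
qed simp

lemma sum_indicator_ge: "real r - real R \<le> (\<Sum>j<r. if R \<le> j then 1 else 0)"
  by (induction r) auto

lemma measurable_Least_nat:
  assumes "\<And>i::nat. {x \<in> space N. P i x} \<in> sets N"
  shows "(\<lambda>x. LEAST i. P i x) \<in> N \<rightarrow>\<^sub>M count_space UNIV"
  by (rule measurable_Least) (use assms in \<open>simp add: pred_def\<close>)

text \<open>By \<open>sparse\<close>, an alignment of \<open>m\<close> steps is finished before the
  next visit to \<open>Z\<close>. The condition \<open>flex\<close> concerns only orbits bounded by
  \<open>K\<close>, as almost every orbit is.\<close>

locale greedy_perturbation = ergodic_automorphism M T for M :: "'a measure" and T +
  fixes A :: "'a \<Rightarrow> mat2" and e :: "nat \<Rightarrow> nat \<Rightarrow> mat2" and \<eta> K :: real and m :: nat and Z W :: "'a set"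
  assumes A: "A \<in> Linf_SL2 M" and K: "K \<ge> 1" and AK: "AE x in M. mnorm (A x) \<le> K"
    and \<eta>: "0 \<le> \<eta>" "\<eta> \<le> 1" and e: "\<And>q i. e q i \<in> near_id \<eta>"
    and Zs: "Z \<in> sets M" and Ws: "W \<in> sets M" and WZ: "W \<subseteq> Z" and Wpos: "measure M W > 0"
    and sparse: "\<And>z j. z \<in> Z \<Longrightarrow> 0 < j \<Longrightarrow> j < m \<Longrightarrow> (T ^^ j) z \<notin> Z"
    and flex: "\<And>z u v r. z \<in> Z \<Longrightarrow> (\<And>i. mnorm (A ((T ^^ i) z)) \<le> K) \<Longrightarrow> r > 0 \<Longrightarrow>
        \<exists>q. \<bar>area (pert T A (e q) m z *v u) v\<bar> < r"
begin

section \<open>Recursive definition of the perturbed cocycle\<close>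

definition "age x = (LEAST j. (Ti ^^ j) x \<in> Z)"
definition "wage x = (LEAST j. (Ti ^^ j) x \<in> W)"
definition "ret x = (LEAST j. 0 < j \<and> (T ^^ j) x \<in> Z)"
definition "hitW x = (LEAST j. (T ^^ j) x \<in> W)"
text \<open>The unperturbed remainder of a block, from the end of the alignment to the next visit to
  \<open>Z\<close>.\<close>

definition "gap z = cocycle_fwd T A (ret z - m) ((T ^^ m) z)"
text \<open>The constant of \<open>aligned_product_norm\<close> for \<open>c = (2 * K) ^ m\<close>,
  which bounds \<open>m\<close> perturbed factors.\<close>

definition "step_const = 5 * (2 * K) ^ m"
definition "choice z F = (LEAST q. mnorm (gap z ** pert T A (e q) m z ** F) \<le> step_const * max (mnorm F) (mnorm (gap z)))"
definition "correction x q = (if age x < m then e q (age x) else mat 1)"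

text \<open>Started at a point of \<open>W\<close>, the circular dependence of perturbation and
  product is an honest recursion: the state carries the product so far and the index of the
  alignment in progress. The initial index 0 is not consulted from there, because \<open>W\<close>
  lies in \<open>Z\<close> and the very first step chooses afresh.\<close>

fun state :: "nat \<Rightarrow> 'a \<Rightarrow> mat2 \<times> nat" where
  "state 0 y = (mat 1, 0)"
| "state (Suc n) y =
    (let x = (T ^^ n) y; F = fst (state n y); q = (if x \<in> Z then choice x F else snd (state n y))
     in (A x ** correction x q ** F, q))"

definition "prod_since x = fst (state (wage x) ((Ti ^^ wage x) x))"
definition "code x = (if x \<in> Z then choice x (prod_since x) else snd (state (wage x) ((Ti ^^ wage x) x)))"
definition "B x = A x ** correction x (code x)"

section \<open>Measurability and size of the perturbation\<close>

lemma [measurable]: "Z \<in> sets M" "W \<in> sets M" "A \<in> borel_measurable M"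
  using Zs Ws LinfD(1)[OF A] by auto

lemma age_meas [measurable]: "age \<in> M \<rightarrow>\<^sub>M count_space UNIV"
  unfolding age_def by (rule measurable_Least_nat) measurable
lemma wage_meas [measurable]: "wage \<in> M \<rightarrow>\<^sub>M count_space UNIV"
  unfolding wage_def by (rule measurable_Least_nat) measurable
lemma ret_meas [measurable]: "ret \<in> M \<rightarrow>\<^sub>M count_space UNIV"
  unfolding ret_def by (rule measurable_Least_nat) measurable
lemma hitW_meas [measurable]: "hitW \<in> M \<rightarrow>\<^sub>M count_space UNIV"
  unfolding hitW_def by (rule measurable_Least_nat) measurable

lemma gap_meas [measurable]: "gap \<in> borel_measurable M"
proof -
  have "(\<lambda>z. cocycle_fwd T A (i - m) ((T ^^ m) z)) \<in> borel_measurable M" for i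
    using measurable_compose[OF Tn_meas cocycle_measurable[OF A]] .
  then have "(\<lambda>z. cocycle_fwd T A (ret z - m) ((T ^^ m) z)) \<in> borel_measurable M"
    by (rule measurable_compose_countable[OF _ ret_meas])
  then show ?thesis unfolding gap_def[abs_def] .
qed

lemma choice_meas:
  assumes [measurable]: "f \<in> M \<rightarrow>\<^sub>M M" "F \<in> borel_measurable M"
  shows "(\<lambda>y. choice (f y) (F y)) \<in> M \<rightarrow>\<^sub>M count_space UNIV"
proof -
  have [measurable]: "(\<lambda>y. pert T A (e q) m (f y)) \<in> borel_measurable M" for q
    using measurable_compose[OF assms(1) pert_measurable[OF A]] .
  show ?thesis unfolding choice_def by (rule measurable_Least_nat) measurable
qed

lemma correction_meas:
  assumes [measurable]: "f \<in> M \<rightarrow>\<^sub>M M" "q \<in> M \<rightarrow>\<^sub>M count_space UNIV"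
  shows "(\<lambda>y. correction (f y) (q y)) \<in> borel_measurable M"
proof -
  have "(\<lambda>y. age (f y)) \<in> M \<rightarrow>\<^sub>M count_space UNIV" by measurable
  then have "(\<lambda>y. e i (age (f y))) \<in> borel_measurable M" for i
    by (rule measurable_compose) simp
  then have [measurable]: "(\<lambda>y. e (q y) (age (f y))) \<in> borel_measurable M"
    by (rule measurable_compose_countable[OF _ assms(2)])
  show ?thesis unfolding correction_def by measurable
qed

lemma state_meas:
  "(\<lambda>y. fst (state n y)) \<in> borel_measurable M \<and> (\<lambda>y. snd (state n y)) \<in> M \<rightarrow>\<^sub>M count_space UNIV"
proof (induction n)
  case (Suc n)
  then have [measurable]: "(\<lambda>y. fst (state n y)) \<in> borel_measurable M"
      "(\<lambda>y. snd (state n y)) \<in> M \<rightarrow>\<^sub>M count_space UNIV" by auto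
  have [measurable]: "(\<lambda>y. choice ((T ^^ n) y) (fst (state n y))) \<in> M \<rightarrow>\<^sub>M count_space UNIV"
    by (rule choice_meas) measurable
  let ?q = "\<lambda>y. if (T ^^ n) y \<in> Z then choice ((T ^^ n) y) (fst (state n y)) else snd (state n y)"
  have q [measurable]: "?q \<in> M \<rightarrow>\<^sub>M count_space UNIV" by measurable
  have [measurable]: "(\<lambda>y. correction ((T ^^ n) y) (?q y)) \<in> borel_measurable M"
    by (rule correction_meas) measurable
  have "(\<lambda>y. A ((T ^^ n) y) ** correction ((T ^^ n) y) (?q y) ** fst (state n y)) \<in> borel_measurable M"
    by measurable
  then show ?case using q by (simp add: Let_def)
qed simp

lemma B_meas: "B \<in> borel_measurable M"
proof -
  have "(\<lambda>x. fst (state i ((Ti ^^ i) x))) \<in> borel_measurable M" for i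
    using measurable_compose[OF Tin_meas conjunct1[OF state_meas]] .
  then have F [measurable]: "prod_since \<in> borel_measurable M"
    unfolding prod_since_def[abs_def] by (rule measurable_compose_countable[OF _ wage_meas])
  have "(\<lambda>x. snd (state i ((Ti ^^ i) x))) \<in> M \<rightarrow>\<^sub>M count_space UNIV" for i
    using measurable_compose[OF Tin_meas conjunct2[OF state_meas]] .
  then have [measurable]: "(\<lambda>x. snd (state (wage x) ((Ti ^^ wage x) x))) \<in> M \<rightarrow>\<^sub>M count_space UNIV"
    by (rule measurable_compose_countable[OF _ wage_meas])
  have [measurable]: "(\<lambda>x. choice x (prod_since x)) \<in> M \<rightarrow>\<^sub>M count_space UNIV"
    by (rule choice_meas) measurable
  have [measurable]: "code \<in> M \<rightarrow>\<^sub>M count_space UNIV" unfolding code_def[abs_def] by measurable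
  have [measurable]: "(\<lambda>x. correction x (code x)) \<in> borel_measurable M"
    by (rule correction_meas) measurable
  show ?thesis unfolding B_def[abs_def] by measurable
qed

lemma correction_near: "correction x q \<in> near_id \<eta>"
  using e id_near_id[OF \<eta>(1)] by (simp add: correction_def)

lemma B_mnorm: "mnorm (B x) \<le> 2 * mnorm (A x)"
proof -
  have "mnorm (B x) \<le> mnorm (A x) * mnorm (correction x (code x))" unfolding B_def by (rule mnorm_mult)
  also have "\<dots> \<le> mnorm (A x) * 2"
    using near_id_mnorm[OF correction_near[of x "code x"]] \<eta> by (intro mult_left_mono) auto
  finally show ?thesis by simp
qed

lemma B_Linf: "B \<in> Linf_SL2 M"
  unfolding Linf_SL2_def
proof (intro CollectI conjI ballI)
  show "B \<in> borel_measurable M" by (rule B_meas)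
  show "det (B x) = 1" if "x \<in> space M" for x
    using LinfD(2)[OF A that] correction_near[of x "code x"] by (simp add: B_def det_mul near_id_def)
  show "\<exists>C. AE x in M. mnorm (B x) \<le> C"
    using AK by (intro exI[of _ "2 * K"], eventually_elim) (use B_mnorm in \<open>smt (verit)\<close>)
qed

lemma B_dist: "linf_dist M A B \<le> K * \<eta>"
proof (rule linf_dist_le[OF A B_Linf])
  show "AE x in M. mnorm (A x - B x) \<le> K * \<eta>" using AK
  proof eventually_elim
    case (elim x)
    let ?P = "correction x (code x)"
    have "B x - A x = A x ** (?P - mat 1)"
      by (simp add: B_def vec_eq_iff forall_2 matrix_matrix_mult_def sum_2 mat_def algebra_simps)
    then have "mnorm (A x - B x) \<le> mnorm (A x) * mnorm (?P - mat 1)"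
      using mnorm_minus_commute[of "A x" "B x"] mnorm_mult by simp
    also have "\<dots> \<le> K * \<eta>"
      using elim correction_near[of x "code x"] K by (intro mult_mono) (auto simp: near_id_def)
    finally show ?case .
  qed
qed

section \<open>The accumulated product along good orbits\<close>

definition "okay x \<longleftrightarrow> mnorm (A x) \<le> K \<and> (\<exists>n. (T ^^ n) x \<in> W) \<and> (\<exists>n. (Ti ^^ n) x \<in> W)"
definition "good x \<longleftrightarrow> x \<in> space M \<and> (\<forall>n. okay ((T ^^ n) x)) \<and> (\<forall>n. okay ((Ti ^^ n) x))"

lemma AE_good: "AE x in M. good x"
proof -
  have "AE x in M. okay x" unfolding okay_def
    using AK AE_hits[OF Ws Wpos] AE_hits_bwd[OF Ws Wpos] by eventually_elim simp
  from AE_Tn[OF this] AE_Tin[OF this] AE_space show ?thesis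
    by eventually_elim (simp add: good_def)
qed

lemma goodD:
  assumes "good x"
  shows "x \<in> space M" "\<And>n. mnorm (A ((T ^^ n) x)) \<le> K" "\<exists>n. (T ^^ n) x \<in> W" "\<exists>n. (Ti ^^ n) x \<in> W"
proof -
  have "okay ((T ^^ 0) x)" using assms unfolding good_def by blast
  then show "\<exists>n. (T ^^ n) x \<in> W" "\<exists>n. (Ti ^^ n) x \<in> W" by (simp_all add: okay_def)
qed (use assms in \<open>auto simp: good_def okay_def\<close>)

lemma good_T: "good x \<Longrightarrow> good ((T ^^ n) x)"
proof (induction n)
  case (Suc n)
  let ?y = "(T ^^ n) x"
  have y: "good ?y" and ys: "?y \<in> space M" using Suc goodD by auto
  have "okay ((T ^^ k) (T ?y))" for k
    using y unfolding good_def by (metis funpow_swap1 funpow.simps(2) o_apply)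
  moreover have "okay ((Ti ^^ k) (T ?y))" for k
  proof (cases k)
    case 0
    have "okay ((T ^^ 1) ?y)" using y unfolding good_def by blast
    then show ?thesis using 0 by simp
  next
    case (Suc j)
    then have "(Ti ^^ k) (T ?y) = (Ti ^^ j) ?y" using ys by (simp only: funpow_Suc_right o_apply Ti_T)
    then show ?thesis using y unfolding good_def by simp
  qed
  ultimately show ?case using ys by (simp add: good_def)
qed simp

lemma good_hits_Z: "good x \<Longrightarrow> \<exists>n. (Ti ^^ n) x \<in> Z" "good x \<Longrightarrow> \<exists>j>0. (T ^^ j) x \<in> Z"
proof -
  assume g: "good x"
  show "\<exists>n. (Ti ^^ n) x \<in> Z" using goodD(4)[OF g] WZ by blast
  obtain n where "(T ^^ n) ((T ^^ 1) x) \<in> W" using goodD(3)[OF good_T[OF g, of 1]] by blast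
  then have "(T ^^ (n + 1)) x \<in> Z" using WZ by (auto simp: funpow_swap1)
  then show "\<exists>j>0. (T ^^ j) x \<in> Z" by (intro exI[of _ "n + 1"]) simp
qed

lemma back_age_T:
  assumes g: "good x" and h: "\<exists>n. (Ti ^^ n) x \<in> E"
  shows "(LEAST j. (Ti ^^ j) (T x) \<in> E) = (if T x \<in> E then 0 else Suc (LEAST j. (Ti ^^ j) x \<in> E))"
proof (cases "T x \<in> E")
  case True then show ?thesis by (simp add: Least_eq_0)
next
  case False
  have x: "x \<in> space M" using goodD[OF g] by simp
  obtain n where n: "(Ti ^^ n) x \<in> E" using h by blast
  have s: "(Ti ^^ Suc j) (T x) = (Ti ^^ j) x" for j using x by (simp only: funpow_Suc_right o_apply Ti_T)
  have "(LEAST j. (Ti ^^ j) (T x) \<in> E) = Suc (LEAST j. (Ti ^^ Suc j) (T x) \<in> E)"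
  proof (rule Least_Suc[of _ "Suc n"])
    show "(Ti ^^ Suc n) (T x) \<in> E" using n s by simp
    show "\<not> (Ti ^^ 0) (T x) \<in> E" using False by simp
  qed
  then show ?thesis using False by (simp only: s if_False)
qed

lemma age_T: "good x \<Longrightarrow> age (T x) = (if T x \<in> Z then 0 else Suc (age x))"
  unfolding age_def using back_age_T good_hits_Z by blast

lemma wage_T: "good x \<Longrightarrow> wage (T x) = (if T x \<in> W then 0 else Suc (wage x))"
  unfolding wage_def using back_age_T goodD(4) by blast

text \<open>Unless \<open>T x\<close> lies in \<open>W\<close>, going back from \<open>T x\<close>
  and from \<open>x\<close> leads to the same visit to \<open>W\<close>. This turns the recursion
  from points of \<open>W\<close> into a law along the orbit of \<open>x\<close>, generated by
  \<open>B\<close>.\<close>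

lemma state_T:
  assumes g: "good x"
  shows "prod_since (T x) = (if T x \<in> W then mat 1 else B x ** prod_since x)"
    and "T x \<notin> Z \<Longrightarrow> code (T x) = code x"
proof -
  have x: "x \<in> space M" using goodD[OF g] by simp
  have st: "state (wage (T x)) ((Ti ^^ wage (T x)) (T x)) = (B x ** prod_since x, code x)" if n: "T x \<notin> W"
  proof -
    have "(Ti ^^ Suc (wage x)) (T x) = (Ti ^^ wage x) x" using x by (simp only: funpow_Suc_right o_apply Ti_T)
    then have "state (wage (T x)) ((Ti ^^ wage (T x)) (T x)) = state (Suc (wage x)) ((Ti ^^ wage x) x)"
      using wage_T[OF g] n by simp
    also have "\<dots> = (B x ** prod_since x, code x)"
      using x by (simp add: Let_def B_def code_def prod_since_def)
    finally show ?thesis .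
  qed
  show "prod_since (T x) = (if T x \<in> W then mat 1 else B x ** prod_since x)"
  proof (cases "T x \<in> W")
    case True
    then have "wage (T x) = 0" using wage_T[OF g] by simp
    then show ?thesis using True by (simp add: prod_since_def)
  next
    case False then show ?thesis using st by (simp add: prod_since_def)
  qed
  show "code (T x) = code x" if "T x \<notin> Z"
  proof -
    have "T x \<notin> W" using that WZ by blast
    then show ?thesis using that st by (simp add: code_def[of "T x"])
  qed
qed

lemma prod_since_W: "x \<in> W \<Longrightarrow> prod_since x = mat 1"
  by (simp add: prod_since_def wage_def Least_eq_0)

lemma prod_since_det: "x \<in> space M \<Longrightarrow> det (prod_since x) = 1"
proof -
  have "det (fst (state n y)) = 1" if "y \<in> space M" for n y
  proof (induction n)
    case (Suc n)
    then show ?case using that LinfD(2)[OF A, of "(T ^^ n) y"] correction_near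
      by (simp add: Let_def det_mul near_id_def)
  qed simp
  then show "x \<in> space M \<Longrightarrow> det (prod_since x) = 1" by (simp add: prod_since_def)
qed

lemma ret_props:
  assumes z: "z \<in> Z" and g: "good z"
  shows "0 < ret z" "(T ^^ ret z) z \<in> Z" "\<And>j. 0 < j \<Longrightarrow> j < ret z \<Longrightarrow> (T ^^ j) z \<notin> Z" "m \<le> ret z"
proof -
  have *: "0 < ret z \<and> (T ^^ ret z) z \<in> Z"
    unfolding ret_def using good_hits_Z(2)[OF g] by (rule LeastI_ex)
  then show "0 < ret z" "(T ^^ ret z) z \<in> Z" by auto
  show "(T ^^ j) z \<notin> Z" if "0 < j" "j < ret z" for j
    using that not_less_Least[of j "\<lambda>j. 0 < j \<and> (T ^^ j) z \<in> Z"] by (auto simp: ret_def)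
  show "m \<le> ret z" using * sparse[OF z] not_less by blast
qed

lemma column:
  assumes z: "z \<in> Z" and g: "good z" and i: "i < ret z"
  shows "age ((T ^^ i) z) = i \<and> code ((T ^^ i) z) = code z \<and>
     prod_since ((T ^^ i) z) = cocycle_fwd T B i z ** prod_since z"
  using i
proof (induction i)
  case 0 then show ?case using z by (simp add: age_def Least_eq_0)
next
  case (Suc i)
  have n: "T ((T ^^ i) z) \<notin> Z" using ret_props(3)[OF z g, of "Suc i"] Suc.prems by simp
  then have nW: "T ((T ^^ i) z) \<notin> W" using WZ by blast
  have gi: "good ((T ^^ i) z)" by (rule good_T[OF g])
  show ?case using Suc n nW age_T[OF gi] state_T[OF gi] by (simp add: matrix_mul_assoc)
qed

lemma column_end:
  assumes z: "z \<in> Z" and g: "good z"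
  shows "prod_since ((T ^^ ret z) z) = (if (T ^^ ret z) z \<in> W then mat 1 else cocycle_fwd T B (ret z) z ** prod_since z)"
proof -
  obtain i where i: "ret z = Suc i" using ret_props(1)[OF z g] by (cases "ret z") auto
  have gi: "good ((T ^^ i) z)" by (rule good_T[OF g])
  show ?thesis unfolding i using state_T(1)[OF gi] column[OF z g, of i] i by (simp add: matrix_mul_assoc)
qed

lemma column_product:
  assumes z: "z \<in> Z" and g: "good z"
  shows "cocycle_fwd T B (ret z) z = gap z ** pert T A (e (code z)) m z"
proof -
  have B: "B ((T ^^ i) z) = A ((T ^^ i) z) ** (if i < m then e (code z) i else mat 1)" if "i < ret z" for i
    using column[OF z g that] by (simp add: B_def correction_def)
  have mr: "m \<le> ret z" using ret_props[OF z g] by simp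
  have 1: "cocycle_fwd T B i z = pert T A (e (code z)) i z" if "i \<le> m" for i
    using that
  proof (induction i)
    case (Suc i) then show ?case using B[of i] mr by (simp add: matrix_mul_assoc)
  qed simp
  have "cocycle_fwd T B i z = cocycle_fwd T A (i - m) ((T ^^ m) z) ** pert T A (e (code z)) m z"
    if "m \<le> i" "i \<le> ret z" for i
    using that
  proof (induction i rule: dec_induct)
    case base then show ?case using 1 by simp
  next
    case (step i)
    have "(T ^^ (i - m)) ((T ^^ m) z) = (T ^^ i) z"
      using step.hyps by (metis funpow_add le_add_diff_inverse2 o_apply)
    then show ?case using step B[of i] by (simp add: Suc_diff_le matrix_mul_assoc)
  qed
  from this[OF mr] show ?thesis by (simp add: gap_def)
qed

lemma gap_det: "z \<in> space M \<Longrightarrow> det (gap z) = 1"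
  unfolding gap_def by (rule cocycle_det[OF A]) simp

lemma step_const_ge: "step_const \<ge> 5"
  using K one_le_power[of "2 * K" m] by (simp add: step_const_def)

lemma greedy_step:
  assumes z: "z \<in> Z" and g: "good z"
  shows "mnorm (cocycle_fwd T B (ret z) z ** prod_since z) \<le> step_const * max (mnorm (prod_since z)) ((2 * K) ^ ret z)"
proof -
  have zs: "z \<in> space M" using goodD[OF g] by simp
  let ?Q = "\<lambda>q. pert T A (e q) m z"
  have "\<exists>q\<in>UNIV. mnorm (gap z ** ?Q q ** prod_since z) \<le> 5 * (2 * K) ^ m * max (mnorm (prod_since z)) (mnorm (gap z))"
  proof (rule aligned_product_norm[OF prod_since_det[OF zs] gap_det[OF zs]])
    show "1 \<le> (2 * K) ^ m" using K by (intro one_le_power) simp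
    show "mnorm (?Q q) \<le> (2 * K) ^ m" for q
      using goodD(2)[OF g] e \<eta>(2) by (rule pert_mnorm_le[where x=z])
    show "\<exists>q\<in>UNIV. \<bar>area (?Q q *v u) v\<bar> < r" if "r > 0" for u v r
      using flex[OF z goodD(2)[OF g] that] by auto
  qed
  then have ex: "\<exists>q. mnorm (gap z ** ?Q q ** prod_since z) \<le> step_const * max (mnorm (prod_since z)) (mnorm (gap z))"
    by (simp add: step_const_def)
  have "mnorm (gap z ** ?Q (code z) ** prod_since z) \<le> step_const * max (mnorm (prod_since z)) (mnorm (gap z))"
    using LeastI_ex[OF ex] z by (simp add: code_def choice_def)
  also have "\<dots> \<le> step_const * max (mnorm (prod_since z)) ((2 * K) ^ ret z)"
  proof -
    have "mnorm (gap z) \<le> K ^ (ret z - m)" unfolding gap_def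
      using goodD(2)[OF good_T[OF g]] by (intro cocycle_mnorm_le) blast
    also have "\<dots> \<le> (2 * K) ^ (ret z - m)" using K by (intro power_mono) auto
    also have "\<dots> \<le> (2 * K) ^ ret z" using K by (intro power_increasing) auto
    finally show ?thesis using step_const_ge by (intro mult_left_mono max.mono) auto
  qed
  finally show ?thesis by (simp add: column_product[OF z g])
qed

section \<open>Accounting of the growth\<close>

definition "\<kappa> = ln (2 * K)"
text \<open>Bookkeeping that pays for the longest block. Each visit to \<open>Z\<close> pays the
  constant of one greedy step; each visit to \<open>W\<close> pays for one block of length
  \<open>R\<close>; each point of age at least \<open>R\<close> pays \<open>\<kappa>\<close>, so a
  block longer than \<open>R\<close> pays for its own excess. All three terms can be given a small
  mean.\<close>

definition "charge R x = ln step_const * indicator Z x + R * \<kappa> * indicator W x + (if R \<le> age x then \<kappa> else 0)" for R :: nat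

lemma \<kappa>: "\<kappa> \<ge> 0" using K by (simp add: \<kappa>_def)

lemma ln_step_const: "ln step_const \<ge> 0" using step_const_ge by simp

lemma charge_nonneg: "charge R x \<ge> 0"
  using \<kappa> ln_step_const by (simp add: charge_def)

lemma charge_column:
  assumes z: "z \<in> Z" and g: "good z"
  shows "ln step_const + (if z \<in> W then R * \<kappa> else 0) + max 0 (\<kappa> * (real (ret z) - real R)) \<le> (\<Sum>j<ret z. charge R ((T ^^ j) z))"
proof -
  let ?r = "ret z"
  have "(\<Sum>j<?r. charge R ((T ^^ j) z)) = (\<Sum>j<?r. ln step_const * indicator Z ((T ^^ j) z) + R * \<kappa> * indicator W ((T ^^ j) z))
      + (\<Sum>j<?r. if R \<le> age ((T ^^ j) z) then \<kappa> else 0)"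
    by (simp add: charge_def sum.distrib)
  moreover have "ln step_const * indicator Z ((T ^^ 0) z) + R * \<kappa> * indicator W ((T ^^ 0) z)
      \<le> (\<Sum>j<?r. ln step_const * indicator Z ((T ^^ j) z) + R * \<kappa> * indicator W ((T ^^ j) z))"
    using ret_props(1)[OF z g] \<kappa> ln_step_const by (intro member_le_sum) auto
  moreover have "max 0 (\<kappa> * (real ?r - real R)) \<le> (\<Sum>j<?r. if R \<le> age ((T ^^ j) z) then \<kappa> else 0)"
  proof (rule max.boundedI)
    show "0 \<le> (\<Sum>j<?r. if R \<le> age ((T ^^ j) z) then \<kappa> else 0)" using \<kappa> by (intro sum_nonneg) auto
    have "\<kappa> * (real ?r - real R) \<le> \<kappa> * (\<Sum>j<?r. if R \<le> j then 1 else 0)"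
      by (intro mult_left_mono sum_indicator_ge \<kappa>)
    also have "\<dots> = (\<Sum>j<?r. if R \<le> age ((T ^^ j) z) then \<kappa> else 0)"
      unfolding sum_distrib_left using column[OF z g] by (intro sum.cong) auto
    finally show "\<kappa> * (real ?r - real R) \<le> (\<Sum>j<?r. if R \<le> age ((T ^^ j) z) then \<kappa> else 0)" .
  qed
  ultimately show ?thesis using z by (auto simp: indicator_def)
qed

lemma sum_shift:
  "(\<Sum>j<a + b. f ((T ^^ j) x)) = (\<Sum>j<a. f ((T ^^ j) x)) + (\<Sum>j<b. f ((T ^^ j) ((T ^^ a) x)))" for f :: "'a \<Rightarrow> real"
proof (induction b)
  case (Suc b)
  have "(T ^^ (a + b)) x = (T ^^ b) ((T ^^ a) x)" by (metis add.commute funpow_add o_apply)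
  then show ?case using Suc by simp
qed simp

lemma age_visit:
  assumes x: "x \<in> space M" and k: "k \<le> n" "(T ^^ k) x \<in> Z"
  shows "age ((T ^^ n) x) \<le> n - k" "(T ^^ (n - age ((T ^^ n) x))) x \<in> Z"
    "\<And>j. n - age ((T ^^ n) x) < j \<Longrightarrow> j \<le> n \<Longrightarrow> (T ^^ j) x \<notin> Z"
proof -
  let ?a = "age ((T ^^ n) x)"
  have h: "(Ti ^^ (n - k)) ((T ^^ n) x) \<in> Z" using Tin_Tn_le[OF x, of "n - k" n] k by simp
  show a: "?a \<le> n - k" unfolding age_def using h by (rule Least_le)
  have "(Ti ^^ ?a) ((T ^^ n) x) \<in> Z" unfolding age_def using h by (rule LeastI)
  then show "(T ^^ (n - ?a)) x \<in> Z" using Tin_Tn_le[OF x, of ?a n] a by simp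
  fix j assume j: "n - ?a < j" "j \<le> n"
  then have "n - j < ?a" using a by linarith
  then have "(Ti ^^ (n - j)) ((T ^^ n) x) \<notin> Z" unfolding age_def by (rule not_less_Least)
  then show "(T ^^ j) x \<notin> Z" using Tin_Tn_le[OF x, of "n - j" n] j by simp
qed

text \<open>The greedy choice gives \<open>s' \<le> ln step_const + max s (\<kappa> * r)\<close> for the logarithms \<open>s\<close>, \<open>s'\<close> of the norm of
  the product since the last visit to \<open>W\<close>; so \<open>s\<close> is bounded by the number of visits to \<open>Z\<close> plus the
  maximal gap rather than by the sum of the gaps.\<close>

lemma product_from_W:
  assumes w: "w \<in> W" and g: "good w"
  shows "(T ^^ n) w \<in> Z \<Longrightarrow> \<exists>Y t. cocycle_fwd T B n w = prod_since ((T ^^ n) w) ** Y \<and> det Y = 1 \<and> ln (mnorm Y) \<le> t \<and>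
     ln (mnorm (prod_since ((T ^^ n) w))) + t \<le> (\<Sum>j<n. charge R ((T ^^ j) w)) \<and>
     t + (if (T ^^ n) w \<in> W then 0 else R * \<kappa>) \<le> (\<Sum>j<n. charge R ((T ^^ j) w))"
\<comment> \<open>\<open>Y\<close> is the product up to the last visit to \<open>W\<close> and
  \<open>t\<close> bounds its logarithm. The last inequality records a reserve
  \<open>R * \<kappa>\<close> that was paid at this visit and is still available. It is dropped when
  time \<open>n\<close> is itself in \<open>W\<close>, since the charge of time \<open>n\<close> is
  outside the sum.\<close>
proof (induction n rule: less_induct)
  case (less n)
  have ws: "w \<in> space M" using goodD[OF g] by simp
  show ?case
  proof (cases "n = 0")
    case True
    then show ?thesis using w prod_since_W[OF w] by (intro exI[of _ "mat 1"] exI[of _ 0]) simp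
  next
    case False
    then obtain l where l: "n = Suc l" by (cases n) auto
    \<comment> \<open>\<open>k\<close> is the last visit to \<open>Z\<close> strictly before
      \<open>n\<close>; looking back from \<open>l = n - 1\<close> excludes \<open>n\<close>
      itself.\<close>
    define k where "k = l - age ((T ^^ l) w)"
    have w0: "(T ^^ 0) w \<in> Z" using w WZ by auto
    note av = age_visit[OF ws _ w0, of l, folded k_def, simplified]
    have kn: "k < n" by (simp add: k_def l)
    define z where "z = (T ^^ k) w"
    have z: "z \<in> Z" using av by (simp add: z_def)
    have gz: "good z" unfolding z_def by (rule good_T[OF g])
    have zs: "z \<in> space M" using goodD[OF gz] by simp
    have Tz: "(T ^^ j) z = (T ^^ (k + j)) w" for j by (metis z_def add.commute funpow_add o_apply)
    have r: "ret z = n - k"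
      unfolding ret_def
    proof (rule Least_equality)
      show "0 < n - k \<and> (T ^^ (n - k)) z \<in> Z" using kn less.prems by (simp add: Tz)
      fix j assume j: "0 < j \<and> (T ^^ j) z \<in> Z"
      show "n - k \<le> j"
      proof (rule ccontr)
        assume "\<not> n - k \<le> j"
        then have "(T ^^ (k + j)) w \<notin> Z" using av(3)[of "k + j"] j l by simp
        then show False using j by (simp add: Tz)
      qed
    qed
    have Tr: "(T ^^ ret z) z = (T ^^ n) w" using kn by (simp add: Tz r)
    obtain Y t where Y: "cocycle_fwd T B k w = prod_since z ** Y" "det Y = 1" "ln (mnorm Y) \<le> t"
        "ln (mnorm (prod_since z)) + t \<le> (\<Sum>j<k. charge R ((T ^^ j) w))"
        "t + (if z \<in> W then 0 else R * \<kappa>) \<le> (\<Sum>j<k. charge R ((T ^^ j) w))"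
      using less.IH[OF kn] z unfolding z_def by blast
    define G where "G = cocycle_fwd T B (ret z) z ** prod_since z"
    have cn: "cocycle_fwd T B n w = G ** Y"
      using cocycle_add[of T B "n - k" k w] kn Y(1) by (simp add: G_def r matrix_mul_assoc flip: z_def)
    have dG: "det G = 1" unfolding G_def using cocycle_det[OF B_Linf zs] prod_since_det[OF zs] by (simp add: det_mul)
    have G1: "1 \<le> mnorm G" by (rule mnorm_ge_1[OF dG])
    have P1: "1 \<le> mnorm (prod_since z)" by (rule mnorm_ge_1[OF prod_since_det[OF zs]])
    have Y1: "1 \<le> mnorm Y" by (rule mnorm_ge_1[OF Y(2)])
    have sumn: "(\<Sum>j<n. charge R ((T ^^ j) w)) = (\<Sum>j<k. charge R ((T ^^ j) w)) + (\<Sum>j<ret z. charge R ((T ^^ j) z))"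
      using sum_shift[of "charge R" w k "ret z"] kn by (simp add: r flip: z_def)
    note cz = charge_column[OF z gz, of R]
    have lG: "ln (mnorm G) \<le> ln step_const + max (ln (mnorm (prod_since z))) (\<kappa> * ret z)"
    proof -
      have "ln (mnorm G) \<le> ln (step_const * max (mnorm (prod_since z)) ((2 * K) ^ ret z))"
        unfolding G_def using greedy_step[OF z gz] G1 unfolding G_def by (intro ln_mono) auto
      also have "\<dots> = ln step_const + ln (max (mnorm (prod_since z)) ((2 * K) ^ ret z))"
        using step_const_ge P1 by (simp add: ln_mult_pos less_max_iff_disj)
      also have "ln (max (mnorm (prod_since z)) ((2 * K) ^ ret z)) \<le> max (ln (mnorm (prod_since z))) (\<kappa> * ret z)"
      proof -
        have lp: "ln ((2 * K) ^ ret z) = \<kappa> * ret z"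
          using ln_realpow[of "2 * K" "ret z"] K unfolding \<kappa>_def by (simp only: mult.commute)
        have "ln (max p q) \<le> max (ln p) (ln q)" for p q :: real by (simp add: max_def)
        from this[of "mnorm (prod_since z)" "(2 * K) ^ ret z"] show ?thesis unfolding lp .
      qed
      finally show ?thesis by simp
    qed
    \<comment> \<open>The cost of a block splits into the reserve and the excess beyond length
      \<open>R\<close>, which the block pays itself. So whichever term of the maximum wins, the sum
      of charges covers it.\<close>
    have rR: "\<kappa> * ret z \<le> R * \<kappa> + max 0 (\<kappa> * (real (ret z) - real R))" by (simp add: algebra_simps max_def)
    have W0: "ln (mnorm (prod_since z)) \<ge> 0" using P1 by simp
    have 1: "ln (mnorm G) + t \<le> (\<Sum>j<n. charge R ((T ^^ j) w))"
    proof (cases "z \<in> W")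
      case True
      then have "ln (mnorm G) \<le> ln step_const + \<kappa> * ret z" using lG \<kappa> by (simp add: prod_since_W)
      then show ?thesis using True Y(5) cz rR unfolding sumn by simp
    next
      case False
      then show ?thesis using lG Y(4,5) cz rR unfolding sumn by (simp add: max_def split: if_splits)
    qed
    have 2: "t + R * \<kappa> \<le> (\<Sum>j<n. charge R ((T ^^ j) w))"
      using Y(5) cz ln_step_const unfolding sumn by (simp add: max_def split: if_splits)
    have ce: "prod_since ((T ^^ n) w) = (if (T ^^ n) w \<in> W then mat 1 else G)"
      using column_end[OF z gz] by (simp add: Tr G_def)
    show ?thesis
    proof (cases "(T ^^ n) w \<in> W")
      case True
      \<comment> \<open>At a visit to \<open>W\<close> the finished product \<open>G\<close> is
        absorbed into \<open>Y\<close>, and the whole sum of charges becomes the new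
        \<open>t\<close>.\<close>
      have "mnorm (G ** Y) \<ge> 1" by (rule mnorm_ge_1) (simp add: det_mul dG Y(2))
      then have "ln (mnorm (G ** Y)) \<le> ln (mnorm G * mnorm Y)" using mnorm_mult by (intro ln_mono) auto
      also have "\<dots> = ln (mnorm G) + ln (mnorm Y)" using G1 Y1 by (simp add: ln_mult_pos)
      finally have "ln (mnorm (G ** Y)) \<le> (\<Sum>j<n. charge R ((T ^^ j) w))" using 1 Y(3) by simp
      then show ?thesis using True ce cn dG Y(2)
        by (intro exI[of _ "G ** Y"] exI[of _ "\<Sum>j<n. charge R ((T ^^ j) w)"]) (simp add: det_mul)
    next
      case False
      then show ?thesis using ce cn Y(2,3) 1 2 by (intro exI[of _ Y] exI[of _ t]) simp
    qed
  qed
qed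

lemma log_norm_from_W:
  assumes w: "w \<in> W" and g: "good w" and n: "(T ^^ n) w \<in> Z"
  shows "log_norm B n w \<le> (\<Sum>j<n. charge R ((T ^^ j) w))"
proof -
  have ws: "w \<in> space M" using goodD[OF g] by simp
  obtain Y t where Y: "cocycle_fwd T B n w = prod_since ((T ^^ n) w) ** Y" "det Y = 1" "ln (mnorm Y) \<le> t"
     "ln (mnorm (prod_since ((T ^^ n) w))) + t \<le> (\<Sum>j<n. charge R ((T ^^ j) w))"
    using product_from_W[OF w g n] by blast
  have P1: "1 \<le> mnorm (prod_since ((T ^^ n) w))" using ws by (intro mnorm_ge_1 prod_since_det) simp
  have Y1: "1 \<le> mnorm Y" by (rule mnorm_ge_1[OF Y(2)])
  have "1 \<le> mnorm (cocycle_fwd T B n w)" by (rule mnorm_ge_1[OF cocycle_det[OF B_Linf ws]])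
  then have "log_norm B n w \<le> ln (mnorm (prod_since ((T ^^ n) w)) * mnorm Y)"
    unfolding log_norm_def Y(1) using mnorm_mult by (intro ln_mono) auto
  also have "\<dots> = ln (mnorm (prod_since ((T ^^ n) w))) + ln (mnorm Y)" using P1 Y1 by (simp add: ln_mult_pos)
  finally show ?thesis using Y(3,4) by simp
qed

lemma log_norm_trivial: "good x \<Longrightarrow> log_norm B n x \<le> n * \<kappa>"
proof -
  assume g: "good x"
  show "log_norm B n x \<le> n * \<kappa>" unfolding \<kappa>_def
  proof (rule log_norm_le[OF B_Linf goodD(1)[OF g]])
    show "mnorm (B ((T ^^ i) x)) \<le> 2 * K" for i
      using B_mnorm[of "(T ^^ i) x"] goodD(2)[OF g, of i] by simp
  qed (use K in simp)
qed

text \<open>Charges cover the stretch from the first visit to \<open>W\<close> to the last visit to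
  \<open>Z\<close>; the two ends are estimated by \<open>\<kappa>\<close> per step. The minimum with
  \<open>n\<close> includes orbits that have not met \<open>W\<close> before time
  \<open>n\<close>.\<close>

lemma log_norm_bound:
  assumes g: "good x"
  shows "log_norm B n x \<le> \<kappa> * min n (hitW x) + \<kappa> * min n (age ((T ^^ n) x)) + (\<Sum>j<n. charge R ((T ^^ j) x))"
proof -
  have x: "x \<in> space M" using goodD[OF g] by simp
  have s0: "(\<Sum>j<k. charge R ((T ^^ j) y)) \<ge> 0" for k y by (intro sum_nonneg charge_nonneg)
  define h where "h = hitW x"
  have h: "(T ^^ h) x \<in> W" unfolding h_def hitW_def using goodD(3)[OF g] by (rule LeastI_ex)
  show ?thesis
  proof (cases "n \<le> h")
    case True
    have "0 \<le> \<kappa> * min n (age ((T ^^ n) x))" using \<kappa> by simp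
    then show ?thesis using True log_norm_trivial[OF g, of n] s0[of x n] by (simp add: h_def[symmetric] mult.commute)
  next
    case False
    define w where "w = (T ^^ h) x"
    define a where "a = age ((T ^^ n) x)"
    have hZ: "(T ^^ h) x \<in> Z" using h WZ by blast
    have a1: "a \<le> n - h" and a2: "(T ^^ (n - a)) x \<in> Z"
      unfolding a_def using age_visit[OF x _ hZ, of n] False by auto
    define k where "k = n - a - h"
    have n: "n = a + (k + h)" using a1 False by (simp add: k_def)
    have gw: "good w" unfolding w_def by (rule good_T[OF g])
    have kw: "(T ^^ k) w = (T ^^ (k + h)) x" by (simp add: w_def funpow_add)
    have "(T ^^ k) w \<in> Z" using a2 n kw by simp
    then have 1: "log_norm B k w \<le> (\<Sum>j<k. charge R ((T ^^ j) w))"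
      using h by (intro log_norm_from_W gw) (simp_all add: w_def)
    have "log_norm B n x \<le> log_norm B a ((T ^^ (k + h)) x) + log_norm B (k + h) x"
      unfolding n by (rule log_norm_subadd[OF B_Linf x])
    also have "log_norm B (k + h) x \<le> log_norm B k w + log_norm B h x"
      unfolding w_def by (rule log_norm_subadd[OF B_Linf x])
    also have "log_norm B a ((T ^^ (k + h)) x) \<le> a * \<kappa>" by (rule log_norm_trivial[OF good_T[OF g]])
    also have "log_norm B h x \<le> h * \<kappa>" by (rule log_norm_trivial[OF g])
    finally have "log_norm B n x \<le> a * \<kappa> + ((\<Sum>j<k. charge R ((T ^^ j) w)) + h * \<kappa>)" using 1 by simp
    moreover have "(\<Sum>j<n. charge R ((T ^^ j) x)) = (\<Sum>j<h. charge R ((T ^^ j) x)) + (\<Sum>j<k. charge R ((T ^^ j) w)) + (\<Sum>j<a. charge R ((T ^^ j) ((T ^^ (h + k)) x)))"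
      using sum_shift[of "charge R" x "h + k" a] sum_shift[of "charge R" x h k] n by (simp add: w_def add.commute add.left_commute)
    moreover have "min n (hitW x) = h" "min n a = a" using False n by (auto simp: h_def[symmetric])
    ultimately show ?thesis using s0[of x h] s0[of "(T ^^ (h + k)) x" a] by (simp add: a_def[symmetric] mult.commute)
  qed
qed

section \<open>Passage to means\<close>

text \<open>Visiting times are finite but possibly not integrable; cut off at \<open>n\<close> and
  divided by \<open>n\<close>, they are bounded by 1 and tend to 0 pointwise.\<close>

lemma integral_min_over_n:
  fixes t :: "'a \<Rightarrow> nat"
  assumes [measurable]: "t \<in> M \<rightarrow>\<^sub>M count_space UNIV"
  shows "(\<lambda>n. (\<integral>x. real (min n (t x)) \<partial>M) / n) \<longlonglongrightarrow> 0"
proof -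
  have "(\<lambda>n. \<integral>x. real (min n (t x)) / n \<partial>M) \<longlonglongrightarrow> (\<integral>x. 0 \<partial>M)"
  proof (rule integral_dominated_convergence[where w="\<lambda>_. 1"])
    show "AE x in M. (\<lambda>n. real (min n (t x)) / n) \<longlonglongrightarrow> 0"
    proof (rule AE_I2)
      fix x
      have "(\<lambda>n. real (t x) / real n) \<longlonglongrightarrow> 0" by (rule lim_const_over_n)
      then show "(\<lambda>n. real (min n (t x)) / n) \<longlonglongrightarrow> 0"
        by (rule Lim_null_comparison[rotated]) (auto intro!: divide_right_mono always_eventually)
    qed
    show "AE x in M. norm (real (min n (t x)) / n) \<le> 1" for n
      by (intro AE_I2) (auto simp: divide_le_eq_1)
  qed auto
  then show ?thesis by simp
qed

lemma min_integrable:
  fixes t :: "'a \<Rightarrow> nat"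
  assumes [measurable]: "t \<in> M \<rightarrow>\<^sub>M count_space UNIV"
  shows "integrable M (\<lambda>x. real (min n (t x)))"
  by (rule integrable_const_bound[where B="real n"]) auto

lemma charge_integral:
  "integrable M (charge R)"
  "(\<integral>x. charge R x \<partial>M) = ln step_const * measure M Z + R * \<kappa> * measure M W + \<kappa> * measure M {x \<in> space M. R \<le> age x}"
proof -
  have [measurable]: "{x \<in> space M. R \<le> age x} \<in> sets M" by measurable
  have eq: "charge R x = ln step_const * indicator Z x + R * \<kappa> * indicator W x + \<kappa> * indicator {x \<in> space M. R \<le> age x} x"
    if "x \<in> space M" for x using that by (simp add: charge_def)
  have "integrable M (\<lambda>x. ln step_const * indicator Z x + R * \<kappa> * indicator W x + \<kappa> * indicator {x \<in> space M. R \<le> age x} x)"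
    by (intro Bochner_Integration.integrable_add integrable_mult_right integrable_real_indicator) (auto simp: less_top[symmetric])
  then show "integrable M (charge R)" by (simp add: eq cong: Bochner_Integration.integrable_cong)
  have "(\<integral>x. charge R x \<partial>M) = (\<integral>x. ln step_const * indicator Z x + R * \<kappa> * indicator W x + \<kappa> * indicator {x \<in> space M. R \<le> age x} x \<partial>M)"
    by (intro Bochner_Integration.integral_cong eq) auto
  also have "\<dots> = ln step_const * measure M Z + R * \<kappa> * measure M W + \<kappa> * measure M {x \<in> space M. R \<le> age x}"
    by (simp add: less_top[symmetric])
  finally show "(\<integral>x. charge R x \<partial>M) = ln step_const * measure M Z + R * \<kappa> * measure M W + \<kappa> * measure M {x \<in> space M. R \<le> age x}" .
qed

lemma B_small:
  fixes R :: nat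
  assumes less: "ln step_const * measure M Z + R * \<kappa> * measure M W + \<kappa> * measure M {x \<in> space M. R \<le> age x} < d"
  shows "B \<in> small_LE d"
proof -
  define I where "I = (\<integral>x. charge R x \<partial>M)"
  have Id: "I < d" using less charge_integral(2)[of R] by (simp add: I_def)
  have ub: "(\<integral>x. log_norm B n x \<partial>M) \<le> \<kappa> * (\<integral>x. real (min n (hitW x)) \<partial>M) + \<kappa> * (\<integral>x. real (min n (age x)) \<partial>M) + n * I" for n
  proof -
    have i1: "integrable M (\<lambda>x. real (min n (hitW x)))" by (rule min_integrable) measurable
    have i2: "integrable M (\<lambda>x. real (min n (age x)))" by (rule min_integrable) measurable
    have i3: "integrable M (\<lambda>x. real (min n (age ((T ^^ n) x))))" by (rule integrable_Tn[OF i2])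
    have i4: "integrable M (\<lambda>x. charge R ((T ^^ j) x))" for j by (rule integrable_Tn[OF charge_integral(1)])
    have "AE x in M. log_norm B n x \<le> \<kappa> * min n (hitW x) + \<kappa> * min n (age ((T ^^ n) x)) + (\<Sum>j<n. charge R ((T ^^ j) x))"
      using AE_good by eventually_elim (rule log_norm_bound)
    then have "(\<integral>x. log_norm B n x \<partial>M) \<le> (\<integral>x. \<kappa> * min n (hitW x) + \<kappa> * min n (age ((T ^^ n) x)) + (\<Sum>j<n. charge R ((T ^^ j) x)) \<partial>M)"
      using i1 i3 i4 log_norm_integrable[OF B_Linf] by (intro integral_mono_AE) auto
    also have "\<dots> = \<kappa> * (\<integral>x. real (min n (hitW x)) \<partial>M) + \<kappa> * (\<integral>x. real (min n (age ((T ^^ n) x))) \<partial>M) + (\<Sum>j<n. \<integral>x. charge R ((T ^^ j) x) \<partial>M)"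
      using i1 i3 i4 by simp
    \<comment> \<open>Invariance of the measure replaces the age at time \<open>n\<close> by the age
      at time 0.\<close>
    also have "(\<integral>x. real (min n (age ((T ^^ n) x))) \<partial>M) = (\<integral>x. real (min n (age x)) \<partial>M)"
      using i2 by (intro integral_Tn) auto
    also have "(\<Sum>j<n. \<integral>x. charge R ((T ^^ j) x) \<partial>M) = n * I"
      unfolding I_def using charge_integral(1) by (subst integral_Tn) auto
    finally show ?thesis .
  qed
  have "(\<lambda>n. \<kappa> * ((\<integral>x. real (min n (hitW x)) \<partial>M) / n) + \<kappa> * ((\<integral>x. real (min n (age x)) \<partial>M) / n)) \<longlonglongrightarrow> \<kappa> * 0 + \<kappa> * 0"
    by (intro tendsto_intros integral_min_over_n) measurable
  then have "\<forall>\<^sub>F n in sequentially. \<kappa> * ((\<integral>x. real (min n (hitW x)) \<partial>M) / n) + \<kappa> * ((\<integral>x. real (min n (age x)) \<partial>M) / n) < d - I"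
    using Id by (intro order_tendstoD(2)[where y="\<kappa> * 0 + \<kappa> * 0"]) auto
  then obtain n0 where n0: "\<And>n. n \<ge> n0 \<Longrightarrow> \<kappa> * ((\<integral>x. real (min n (hitW x)) \<partial>M) / n) + \<kappa> * ((\<integral>x. real (min n (age x)) \<partial>M) / n) < d - I"
    unfolding eventually_sequentially by blast
  define n where "n = Suc n0"
  have n: "real n > 0" by (simp add: n_def)
  have "n * (\<kappa> * ((\<integral>x. real (min n (hitW x)) \<partial>M) / n) + \<kappa> * ((\<integral>x. real (min n (age x)) \<partial>M) / n)) < n * (d - I)"
    using n0[of n] n by (intro mult_strict_left_mono) (auto simp: n_def)
  then have "\<kappa> * (\<integral>x. real (min n (hitW x)) \<partial>M) + \<kappa> * (\<integral>x. real (min n (age x)) \<partial>M) < n * (d - I)"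
    using n by (simp add: distrib_left)
  then have "(\<integral>x. log_norm B n x \<partial>M) < n * d" using ub[of n] by (simp add: algebra_simps)
  then show ?thesis using B_Linf by (auto simp: small_LE_def n_def intro!: exI[of _ n])
qed

end

section \<open>Robustly positive exponents\<close>

lemma dense_sequence_plane:
  obtains dv :: "nat \<Rightarrow> real^2" where "\<And>x r. r > 0 \<Longrightarrow> \<exists>i. norm (dv i - x) < r"
proof -
  obtain D :: "(real^2) set" where D: "countable D" "D \<subseteq> UNIV" "UNIV \<subseteq> closure D"
    by (rule separable)
  have ne: "D \<noteq> {}" using D(3) by auto
  show ?thesis
  proof (rule that[of "from_nat_into D"])
    fix x :: "real^2" and r :: real assume r: "r > 0"
    have "x \<in> closure D" using D(3) by auto
    then obtain y where y: "y \<in> D" "dist y x < r" using r unfolding closure_approachable by auto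
    moreover obtain i where "from_nat_into D i = y" using range_from_nat_into[OF ne D(1)] y(1) by force
    ultimately show "\<exists>i. norm (from_nat_into D i - x) < r" by (auto simp: dist_norm)
  qed
qed

text \<open>Alignment is tested on a dense sequence of directions so that the test is measurable;
  this estimate transfers it to all directions.\<close>

lemma area_approx:
  assumes Q: "mnorm Q \<le> c" and c: "c \<ge> 0" and u: "norm (u' - u) \<le> \<delta>" and v: "norm (v' - v) \<le> \<delta>" and \<delta>: "\<delta> \<le> 1"
  shows "\<bar>area (Q *v u) v\<bar> \<le> \<bar>area (Q *v u') v'\<bar> + c * \<delta> * (norm u + norm v + 1)"
proof -
  have d0: "\<delta> \<ge> 0" using u norm_ge_zero order_trans by blast
  have "area (Q *v u') v' = area (Q *v u) v + area (Q *v (u' - u)) v + area (Q *v u') (v' - v)"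
    by (simp add: matrix_vector_mult_diff_distrib area_diff_left area_diff_right)
  moreover have "\<bar>area (Q *v (u' - u)) v\<bar> \<le> c * \<delta> * norm v"
  proof -
    have "\<bar>area (Q *v (u' - u)) v\<bar> \<le> norm (Q *v (u' - u)) * norm v" by (rule area_le)
    also have "\<dots> \<le> mnorm Q * norm (u' - u) * norm v" by (intro mult_right_mono norm_le_mnorm) simp
    also have "\<dots> \<le> c * \<delta> * norm v" using Q u c by (intro mult_right_mono mult_mono) auto
    finally show ?thesis .
  qed
  moreover have "\<bar>area (Q *v u') (v' - v)\<bar> \<le> c * (norm u + 1) * \<delta>"
  proof -
    have nu: "norm u' \<le> norm u + 1" using norm_triangle_sub[of u' u] u \<delta> by linarith
    have "\<bar>area (Q *v u') (v' - v)\<bar> \<le> norm (Q *v u') * norm (v' - v)" by (rule area_le)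
    also have "\<dots> \<le> mnorm Q * norm u' * norm (v' - v)" by (intro mult_right_mono norm_le_mnorm) simp
    also have "\<dots> \<le> c * (norm u + 1) * \<delta>" using Q nu v c d0 by (intro mult_mono) auto
    finally show ?thesis .
  qed
  ultimately show ?thesis by (simp add: algebra_simps)
qed

context ergodic_automorphism begin

lemma flexible_perturbation:
  fixes e :: "nat \<Rightarrow> nat \<Rightarrow> mat2" and d K \<eta> :: real
  assumes na: "nonatomic M" and A: "A \<in> Linf_SL2 M" and K: "K \<ge> 1" and AK: "AE x in M. mnorm (A x) \<le> K"
    and \<eta>: "0 \<le> \<eta>" "\<eta> \<le> 1" and e: "\<And>q i. e q i \<in> near_id \<eta>"
    and E: "E \<in> sets M" "measure M E > 0" and d: "d > 0"
    and flex: "\<And>z u v r. z \<in> E \<Longrightarrow> (\<And>i. mnorm (A ((T ^^ i) z)) \<le> K) \<Longrightarrow> r > 0 \<Longrightarrow>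
        \<exists>q. \<bar>area (pert T A (e q) m z *v u) v\<bar> < r"
  shows "\<exists>B\<in>small_LE d. linf_dist M A B \<le> K * \<eta>"
proof -
  define c where "c = ln (5 * (2 * K) ^ m)"
  define \<kappa> where "\<kappa> = ln (2 * K)"
  have k0: "\<kappa> \<ge> 0" using K by (simp add: \<kappa>_def)
  have "1 \<le> (2 * K) ^ m" using K by (intro one_le_power) simp
  then have c0: "c \<ge> 0" by (simp add: c_def)
  obtain N0 :: nat where N0: "real N0 > 4 * c / d" using reals_Archimedean2 by blast
  \<comment> \<open>\<open>N \<ge> m\<close> leaves room for the alignment, and
    \<open>measure M Z < 1 / N\<close> brings the mean charge of the visits to \<open>Z\<close>
    below \<open>d / 4\<close>.\<close>
  define N where "N = Suc (max N0 m)"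
  have N: "N > 0" "m \<le> N" "c / N < d / 4"
  proof -
    have "4 * c / d < N" using N0 by (simp add: N_def)
    then show "c / N < d / 4" using d by (simp add: N_def field_simps)
  qed (auto simp: N_def)
  obtain Z where Z: "Z \<in> sets M" "Z \<subseteq> E" "0 < measure M Z" "measure M Z < 1 / N"
      "\<And>z j. z \<in> Z \<Longrightarrow> 0 < j \<Longrightarrow> j < N \<Longrightarrow> (T ^^ j) z \<notin> Z"
    using sparse_subset[OF na E N(1)] by blast
  define a where "a x = (LEAST j. (Ti ^^ j) x \<in> Z)" for x
  have am [measurable]: "a \<in> M \<rightarrow>\<^sub>M count_space UNIV"
    unfolding a_def[abs_def] by (rule measurable_Least_nat) (use Z(1) in measurable)
  have "(\<lambda>R. measure M {x \<in> space M. R \<le> a x}) \<longlonglongrightarrow> measure M (\<Inter>R. {x \<in> space M. R \<le> a x})"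
  proof (rule finite_Lim_measure_decseq)
    show "range (\<lambda>R. {x \<in> space M. R \<le> a x}) \<subseteq> sets M" by auto
    show "decseq (\<lambda>R. {x \<in> space M. R \<le> a x})" by (rule decseq_SucI) auto
  qed
  moreover have "(\<Inter>R. {x \<in> space M. R \<le> a x}) = {}" using not_less_eq_eq by blast
  ultimately have "(\<lambda>R. \<kappa> * measure M {x \<in> space M. R \<le> a x}) \<longlonglongrightarrow> \<kappa> * 0"
    by (intro tendsto_mult tendsto_const) simp
  then have "\<forall>\<^sub>F R in sequentially. \<kappa> * measure M {x \<in> space M. R \<le> a x} < d / 4"
    using d by (intro order_tendstoD(2)[where y="\<kappa> * 0"]) auto
  then obtain R where R: "\<kappa> * measure M {x \<in> space M. R \<le> a x} < d / 4"
    by (auto simp: eventually_sequentially)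
  \<comment> \<open>The summand 1 avoids a division by zero when \<open>R\<close> is 0.\<close>
  have Rk: "real R * \<kappa> + 1 > 0" using k0 by (simp add: add_nonneg_pos)
  obtain W where W: "W \<in> sets M" "W \<subseteq> Z" "0 < measure M W" "measure M W < d / 4 / (R * \<kappa> + 1)"
    using small_subset[OF na Z(1,3), of "d / 4 / (R * \<kappa> + 1)"] d Rk by auto
  interpret g: greedy_perturbation M T A e \<eta> K m Z W
    by unfold_locales (use A K AK \<eta> e Z W N flex in auto)
  have "c * measure M Z \<le> c * (1 / N)" using Z(4) c0 by (intro mult_left_mono) auto
  then have 1: "ln g.step_const * measure M Z < d / 4" using N(3) unfolding c_def g.step_const_def by (simp only: times_divide_eq_right mult_1_right)
  have "R * \<kappa> * measure M W \<le> (R * \<kappa> + 1) * measure M W" by (intro mult_right_mono) auto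
  also have "\<dots> < d / 4" using W(4) unfolding pos_less_divide_eq[OF Rk] by (simp only: mult.commute)
  finally have 2: "R * g.\<kappa> * measure M W < d / 4" by (simp add: \<kappa>_def g.\<kappa>_def)
  have 3: "g.\<kappa> * measure M {x \<in> space M. R \<le> g.age x} < d / 4"
    using R by (simp add: g.\<kappa>_def g.age_def \<kappa>_def a_def)
  have "g.B \<in> small_LE d" by (rule g.B_small[of R]) (use 1 2 3 d in linarith)
  then show ?thesis using g.B_dist by blast
qed

lemma robust_imp_uniformly_hyperbolic:
  assumes na: "nonatomic M" and A: "A \<in> Linf_SL2 M" and d: "d > 0" and \<epsilon>: "\<epsilon> > 0"
    and robust: "\<And>B. B \<in> Linf_SL2 M \<Longrightarrow> linf_dist M A B < \<epsilon> \<Longrightarrow> B \<notin> small_LE d"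
  shows "uniformly_hyperbolic M T A"
proof -
  obtain K where K: "K \<ge> 1" and AK: "AE x in M. mnorm (A x) \<le> K" using LinfD(3)[OF A] by blast
  \<comment> \<open>The factor 2 turns the bound \<open>K * \<eta>\<close> on the distance into a
    strict inequality with \<open>\<epsilon>\<close>; the cap 1 keeps the norms of perturbing
    factors below 2.\<close>
  define \<eta> where "\<eta> = min 1 (\<epsilon> / (2 * K))"
  have \<eta>: "0 < \<eta>" "\<eta> \<le> 1" using K \<epsilon> by (auto simp: \<eta>_def)
  have "K * \<eta> \<le> K * (\<epsilon> / (2 * K))" using K by (intro mult_left_mono) (auto simp: \<eta>_def)
  then have K\<eta>: "K * \<eta> < \<epsilon>" using K \<epsilon> by simp
  obtain e :: "nat \<Rightarrow> nat \<Rightarrow> mat2" where e: "\<And>q i. e q i \<in> near_id \<eta>"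
    and dense: "\<And>P m. (\<And>i. P i \<in> near_id \<eta>) \<Longrightarrow> \<exists>q. \<forall>i<m. (\<lambda>j. e (q j) i) \<longlonglongrightarrow> P i"
    using countable_dense_perturbations[of \<eta>] \<eta> by (metis less_imp_le)
  obtain dv :: "nat \<Rightarrow> real^2" where dv: "\<And>x r. r > 0 \<Longrightarrow> \<exists>i. norm (dv i - x) < r"
    using dense_sequence_plane by blast
  \<comment> \<open>Only countable quantifiers occur, over dense directions, tolerances and indices
    of perturbations; hence \<open>E m\<close> is measurable.\<close>
  define E where "E m = {x \<in> space M. \<forall>i j k::nat. \<exists>q. \<bar>area (pert T A (e q) m x *v dv i) (dv j)\<bar> < 1 / Suc k}" for m
  note [measurable] = pert_measurable[OF A]
  have Es: "E m \<in> sets M" for m unfolding E_def by measurable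
  show ?thesis
  proof (cases "\<forall>m. measure M (E m) = 0")
    case True
    then have "AE x in M. x \<notin> E m" for m using Es by (simp add: prob_eq_0)
    then have "AE x in M. \<forall>m. x \<notin> E m" by (simp add: AE_all_countable)
    then have "AE x in M. unalignable \<eta> A x" using AE_space
    proof eventually_elim
      case (elim x)
      have "\<exists>u v. \<forall>P. (\<forall>i. P i \<in> near_id \<eta>) \<longrightarrow> area (pert T A P m x *v u) v \<noteq> 0" for m
      proof -
        obtain i j and k :: nat where ijk: "\<And>q. 1 / Suc k \<le> \<bar>area (pert T A (e q) m x *v dv i) (dv j)\<bar>"
        proof -
          have "x \<notin> E m" using elim(1) by blast
          then have "\<not> (\<forall>i j k::nat. \<exists>q. \<bar>area (pert T A (e q) m x *v dv i) (dv j)\<bar> < 1 / Suc k)"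
            using elim(2) unfolding E_def by blast
          then show ?thesis using that unfolding not_all not_ex not_less by blast
        qed
        \<comment> \<open>Failure of the approximate test gives a lower bound that is uniform over
          the dense family. It survives the limit to an arbitrary admissible \<open>P\<close>, so
          exact alignment is impossible as well.\<close>
        have "area (pert T A P m x *v dv i) (dv j) \<noteq> 0" if P: "\<forall>i. P i \<in> near_id \<eta>" for P
        proof -
          obtain q where "\<forall>i<m. (\<lambda>j. e (q j) i) \<longlonglongrightarrow> P i" using dense P by blast
          then have "(\<lambda>l. pert T A (e (q l)) m x) \<longlonglongrightarrow> pert T A P m x" by (intro pert_tendsto) auto
          then have "(\<lambda>l. \<bar>area (pert T A (e (q l)) m x *v dv i) (dv j)\<bar>) \<longlonglongrightarrow> \<bar>area (pert T A P m x *v dv i) (dv j)\<bar>"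
            unfolding area_def matvec_nth by (intro tendsto_intros)
          then have "1 / Suc k \<le> \<bar>area (pert T A P m x *v dv i) (dv j)\<bar>"
            by (rule LIMSEQ_le_const) (use ijk in blast)
          moreover have "(0::real) < 1 / Suc k" by simp
          ultimately show ?thesis by linarith
        qed
        then show ?thesis by blast
      qed
      then show ?case unfolding unalignable_def by blast
    qed
    then show ?thesis by (rule unalignable_imp_uniformly_hyperbolic[OF A \<eta>(1)])
  next
    case False
    then obtain m where m: "measure M (E m) > 0" by (auto simp: zero_less_measure_iff)
    have "\<exists>B\<in>small_LE d. linf_dist M A B \<le> K * \<eta>"
    proof (rule flexible_perturbation[OF na A K AK _ \<eta>(2) e Es m d])
      show "0 \<le> \<eta>" using \<eta> by simp
      fix z and u v :: "real^2" and r :: real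
      assume z: "z \<in> E m" and zK: "\<And>i. mnorm (A ((T ^^ i) z)) \<le> K" and r: "r > 0"
      define c where "c = (2 * K) ^ m"
      have c: "c > 0" using K by (simp add: c_def)
      let ?s = "norm u + norm v + 1"
      have s: "?s > 0" by (simp add: add_nonneg_pos)
      \<comment> \<open>Moving \<open>u\<close> and \<open>v\<close> to dense directions costs at
        most \<open>r / 2\<close>; the tolerance \<open>1 / Suc k\<close> takes the other
        half.\<close>
      define \<delta> where "\<delta> = min 1 (r / 2 / (c * ?s))"
      have \<delta>: "\<delta> > 0" "\<delta> \<le> 1" using r c s by (auto simp: \<delta>_def)
      obtain i where i: "norm (dv i - u) < \<delta>" using dv[OF \<delta>(1)] by blast
      obtain j where j: "norm (dv j - v) < \<delta>" using dv[OF \<delta>(1)] by blast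
      obtain k where k: "1 / Suc k < r / 2" using nat_approx_posE[of "r / 2"] r by auto
      obtain q where q: "\<bar>area (pert T A (e q) m z *v dv i) (dv j)\<bar> < 1 / Suc k"
        using z unfolding E_def by blast
      have Q: "mnorm (pert T A (e q) m z) \<le> c"
        unfolding c_def using zK e \<eta>(2) by (rule pert_mnorm_le[where x=z])
      have "\<bar>area (pert T A (e q) m z *v u) v\<bar> \<le> \<bar>area (pert T A (e q) m z *v dv i) (dv j)\<bar> + c * \<delta> * ?s"
        using Q c i j \<delta> by (intro area_approx) auto
      moreover have "c * \<delta> * ?s \<le> r / 2"
      proof -
        have "\<delta> \<le> r / 2 / (c * ?s)" by (simp add: \<delta>_def)
        then have "\<delta> * (c * ?s) \<le> r / 2" using c s by (simp add: pos_le_divide_eq)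
        then show ?thesis by (simp add: mult_ac)
      qed
      ultimately show "\<exists>q. \<bar>area (pert T A (e q) m z *v u) v\<bar> < r"
        using q k by (intro exI[of _ q]) linarith
    qed
    then show ?thesis using robust K\<eta> by (auto simp: small_LE_def)
  qed
qed

end

theorem theoremB:
  fixes M :: "'a measure" and T :: "'a \<Rightarrow> 'a"
  assumes "prob_space M"
    and "nonatomic M"
    and "automorphism M T"
    and "ergodic M T"
  shows "\<exists>R. residual_in_Linf M R \<and>
           (\<forall>A\<in>R. uniformly_hyperbolic M T A \<or> LE M T A = 0)"
proof -
  interpret prob_space M by fact
  interpret ergodic_automorphism M T by unfold_locales fact+
  obtain R where R: "residual_in_Linf M R" "\<forall>A\<in>R. A \<in> Linf_SL2 M \<and> (LE M T A = 0 \<or>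
      (\<exists>d>0. \<exists>e>0. \<forall>B\<in>Linf_SL2 M. linf_dist M A B < e \<longrightarrow> B \<notin> small_LE d))"
    using residual_dichotomy by blast
  have "uniformly_hyperbolic M T A \<or> LE M T A = 0" if A: "A \<in> R" for A
  proof (cases "LE M T A = 0")
    case False
    then obtain d e :: real where "d > 0" "e > 0" "\<And>B. B \<in> Linf_SL2 M \<Longrightarrow> linf_dist M A B < e \<Longrightarrow> B \<notin> small_LE d"
      using R(2) A by blast
    then show ?thesis using robust_imp_uniformly_hyperbolic[OF assms(2)] R(2) A by blast
  qed simp
  then show ?thesis using R(1) by blast
qed

end
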